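(* Assume that at least one of the following holds: (a) $A-iB^*TB\colon\mathbb{V}_h(\Omega)\to\mathbb{V}_h(\Omega)^*$ is invertible; (b) $\operatorname{Im}\{\langle\mathcal{A}_\Gamma(v,q),(\overline v,\overline q)\rangle\}\le0$ for all $v\in H^{1/2}(\Gamma)$ and all $q\in H^{-1/2}(\Gamma)$. Then there exists a unique linear map $S\colon\mathbb{V}_h(\Sigma)^*\to\mathbb{V}_h(\Sigma)^*$ satisfying $$\boldsymbol p+iT\boldsymbol v=S(\boldsymbol p-iT\boldsymbol v)\qquad\forall(\boldsymbol v,\boldsymbol p)\in\mathscr{C}_h(A).$$ This operator is also given by the formula $S=\mathrm{Id}+2iTB(A-iB^*TB)^\dagger B^*$. Besides, assuming (b), $S$ is $T^{-1}$-contractive, i.e. $\|S(\boldsymbol q)\|_{T^{-1}}\le\|\boldsymbol q\|_{T^{-1}}$ for all $\boldsymbol q\in\mathbb{V}_h(\Sigma)^*$. More precisely, for all $\boldsymbol q\in\mathbb{V}_h(\Sigma)^*$, $$\|S(\boldsymbol q)\|_{T^{-1}}^2-4\operatorname{Im}\{\langle A(\boldsymbol u),\overline{\boldsymbol u}\rangle\}=\|\boldsymbol q\|_{T^{-1}}^2,\qquad\text{where }\boldsymbol u=(A-iB^*TB)^\dagger B^*\boldsymbol q.$$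
   Context: Conventions. All vector spaces are complex; duality pairings $\langle\cdot,\cdot\rangle$ are bilinear (no complex conjugation) and act componentwise on Cartesian products. For a bounded linear $L\colon H\to V$, the adjoint $L^*\colon V^*\to H^*$ is defined by $\langle L^*p,u\rangle=\langle p,Lu\rangle$ (no conjugation), and $\overline{L}$ by $\overline{L}(\overline u)=\overline{L(u)}$. $\operatorname{Im}\{z\}$ denotes the imaginary part of a complex number $z$. Setting. $\Omega\subset\mathbb{R}^d$ ($d=2,3$) is a bounded polyhedral open set, $\Gamma=\partial\Omega$; $H^{1/2}(\Gamma)$ is the space of traces of $H^1(\Omega)$ and $H^{-1/2}(\Gamma)$ its dual. $\kappa\colon\mathbb{R}^d\to\mathbb{C}$ is measurable and essentially bounded, with $\operatorname{Im}\{\kappa(x)^2\}\ge0$ for all $x\in\Omega$, and equal to a constant $\tilde k>0$ outside $\Omega$. $\mathcal{A}_\Gamma\colon H^{1/2}(\Gamma)\times H^{-1/2}(\Gamma)\to H^{-1/2}(\Gamma)\times H^{1/2}(\Gamma)$ is a given bounded linear operator. Discretization. $\Omega$ is covered by a regular simplicial mesh; $V_h(\Omega)\subset H^1(\Omega)$ is the space of continuous $\mathbb{P}_k$-Lagrange finite element functions; for a subset $\Theta\subset\overline\Omega$ that is a union of mesh cells or of mesh faces, $V_h(\Theta)=\{v|_\Theta: v\in V_h(\Omega)\}$. $Q_h(\Gamma)\subset H^{-1/2}(\Gamma)$ is a finite-dimensional subspace. Domain decomposition. $\overline\Omega=\overline\Omega_1\cup\dots\cup\overline\Omega_J$ with pairwise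 disjoint polyhedral open sets $\Omega_j$ that are unions of mesh cells, $\Gamma_j=\partial\Omega_j$, $\Sigma=\Gamma\cup\Gamma_1\cup\dots\cup\Gamma_J$. Set $V_h^{b}(\Gamma)=V_h(\Gamma)\times Q_h(\Gamma)$, $\mathbb{V}_h(\Omega)=V_h^{b}(\Gamma)\times V_h(\Omega_1)\times\dots\times V_h(\Omega_J)$, $\mathbb{V}_h(\Sigma)=V_h(\Gamma)\times V_h(\Gamma_1)\times\dots\times V_h(\Gamma_J)$. The trace operator $B\colon\mathbb{V}_h(\Omega)\to\mathbb{V}_h(\Sigma)$ is $B((v,q),u_1,\dots,u_J)=(v,u_1|_{\Gamma_1},\dots,u_J|_{\Gamma_J})$. $A=\operatorname{diag}(A_\Gamma,A_{\Omega_1},\dots,A_{\Omega_J})\colon\mathbb{V}_h(\Omega)\to\mathbb{V}_h(\Omega)^*$, where $\langle A_\Gamma(u),v\rangle=\langle\mathcal{A}_\Gamma(u),v\rangle$ for $u,v\in V_h^b(\Gamma)$ and $\langle A_{\Omega_j}(u),v\rangle=\int_{\Omega_j}(\nabla u\cdot\nabla v-\kappa^2uv)\,dx$ for $u,v\in V_h(\Omega_j)$. $T\colon\mathbb{V}_h(\Sigma)\to\mathbb{V}_h(\Sigma)^*$ is any linear operator with $T^*=T=\overline T$ and $\langle T(u),\overline u\rangle>0$ for all $u\neq0$; $\|\boldsymbol p\|_{T^{-1}}^2=\langle T^{-1}(\boldsymbol p),\overline{\boldsymbol p}\rangle$. The Cauchy data set is $\mathscr{C}_h(A)=\{(B(\boldsymbol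 u),\boldsymbol p)\in\mathbb{V}_h(\Sigma)\times\mathbb{V}_h(\Sigma)^*:\ \boldsymbol u\in\mathbb{V}_h(\Omega),\ A\boldsymbol u=B^*\boldsymbol p\}$. The symbol $\dagger$ denotes the Moore-Penrose pseudo-inverse with respect to a fixed Hilbert norm on $\mathbb{V}_h(\Omega)$ (e.g. the product of the $H^{1/2}(\Gamma)\times H^{-1/2}(\Gamma)$ and $H^1(\Omega_j)$ norms) and the dual norm on $\mathbb{V}_h(\Omega)^*$.
   Formalization: When (b) holds, the space Q_h(Γ) is additionally assumed closed under complex conjugation; otherwise ⟨A(u), ū⟩ is not defined, and existence of S can fail under (b). *)

theory Defs
  imports "HOL-Analysis.Analysis" "HOL-Library.Function_Algebras"
begin

section \<open>Complex vector spaces, duals and transposes\<close>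

class complex_vector = ab_group_add +
  fixes scaleC :: "complex \<Rightarrow> 'a \<Rightarrow> 'a" (infixr \<open>*\<^sub>C\<close> 75)
  assumes scaleC_add_right: "a *\<^sub>C (x + y) = a *\<^sub>C x + a *\<^sub>C y"
    and scaleC_add_left: "(a + b) *\<^sub>C x = a *\<^sub>C x + b *\<^sub>C x"
    and scaleC_scaleC: "a *\<^sub>C b *\<^sub>C x = (a * b) *\<^sub>C x"
    and scaleC_one: "1 *\<^sub>C x = x"

instantiation complex :: complex_vector
begin
definition scaleC_complex :: "complex \<Rightarrow> complex \<Rightarrow> complex"
  where "scaleC_complex c z = c * z"
instance by standard (simp_all add: scaleC_complex_def algebra_simps)
end

instantiation "fun" :: (type, complex_vector) complex_vector
begin
definition scaleC_fun :: "complex \<Rightarrow> ('a \<Rightarrow> 'b) \<Rightarrow> 'a \<Rightarrow> 'b"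
  where "scaleC_fun c f = (\<lambda>x. c *\<^sub>C f x)"
instance
  by standard
    (simp_all add: fun_eq_iff scaleC_fun_def scaleC_add_right scaleC_add_left
      scaleC_scaleC scaleC_one)
end

instantiation prod :: (complex_vector, complex_vector) complex_vector
begin
definition scaleC_prod :: "complex \<Rightarrow> 'a \<times> 'b \<Rightarrow> 'a \<times> 'b"
  where "scaleC_prod c z = (c *\<^sub>C fst z, c *\<^sub>C snd z)"
instance
  by standard
    (simp_all add: prod_eq_iff scaleC_prod_def scaleC_add_right scaleC_add_left
      scaleC_scaleC scaleC_one)
end

global_interpretation complex_vector: vector_space "scaleC :: complex \<Rightarrow> 'a \<Rightarrow> 'a::complex_vector"
  by standard (simp_all add: scaleC_add_right scaleC_add_left scaleC_scaleC scaleC_one)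

definition clinear_on :: "'a::complex_vector set \<Rightarrow> ('a \<Rightarrow> 'b::complex_vector) \<Rightarrow> bool"
  where "clinear_on V f \<longleftrightarrow>
    (\<forall>x\<in>V. \<forall>y\<in>V. f (x + y) = f x + f y) \<and> (\<forall>c. \<forall>x\<in>V. f (c *\<^sub>C x) = c *\<^sub>C f x)"

text \<open>Vector spaces are subsets of a type. A linear map on such a subset is represented by
  the function that vanishes off the subset, so that equality of maps is equality of functions.\<close>

definition lin_maps :: "'a::complex_vector set \<Rightarrow> 'b::complex_vector set \<Rightarrow> ('a \<Rightarrow> 'b) set"
  where "lin_maps V W = {f. clinear_on V f \<and> f ` V \<subseteq> W \<and> (\<forall>x. x \<notin> V \<longrightarrow> f x = 0)}"

text \<open>The algebraic dual, which is the topological one in finite dimension; the pairing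
  \<open>\<langle>p, u\<rangle>\<close> is \<open>p u\<close>.\<close>

definition cdual :: "'a::complex_vector set \<Rightarrow> ('a \<Rightarrow> complex) set"
  where "cdual V = lin_maps V UNIV"

definition transpose_on ::
    "'a::complex_vector set \<Rightarrow> ('a \<Rightarrow> 'b) \<Rightarrow> ('b \<Rightarrow> complex) \<Rightarrow> 'a \<Rightarrow> complex"
  where "transpose_on H L p = (\<lambda>u. if u \<in> H then p (L u) else 0)"

text \<open>For a conjugation \<open>c\<close>, the conjugate functional is
  \<open>\<langle>conj p, u\<rangle> = cnj \<langle>p, c u\<rangle>\<close>.\<close>

definition dual_conj :: "('a \<Rightarrow> 'a) \<Rightarrow> ('a \<Rightarrow> complex) \<Rightarrow> 'a \<Rightarrow> complex"
  where "dual_conj c p = (\<lambda>u. cnj (p (c u)))"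

section \<open>Moore--Penrose pseudo-inverse\<close>

definition inner_product_on :: "'a::complex_vector set \<Rightarrow> ('a \<Rightarrow> 'a \<Rightarrow> complex) \<Rightarrow> bool"
  where "inner_product_on V ip \<longleftrightarrow>
    (\<forall>y\<in>V. clinear_on V (\<lambda>x. ip x y)) \<and>
    (\<forall>x\<in>V. \<forall>y\<in>V. ip y x = cnj (ip x y)) \<and>
    (\<forall>x\<in>V. x \<noteq> 0 \<longrightarrow> Re (ip x x) > 0)"

definition riesz_rep :: "'a set \<Rightarrow> ('a \<Rightarrow> 'a \<Rightarrow> complex) \<Rightarrow> ('a \<Rightarrow> complex) \<Rightarrow> 'a"
  where "riesz_rep V ip f = (THE r. r \<in> V \<and> (\<forall>x\<in>V. f x = ip x r))"

text \<open>The inner product of the dual norm. The Riesz map is antilinear, whence the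
  exchanged arguments.\<close>

definition dual_ip ::
    "'a set \<Rightarrow> ('a \<Rightarrow> 'a \<Rightarrow> complex) \<Rightarrow> ('a \<Rightarrow> complex) \<Rightarrow> ('a \<Rightarrow> complex) \<Rightarrow> complex"
  where "dual_ip V ip f g = ip (riesz_rep V ip g) (riesz_rep V ip f)"

definition is_moore_penrose ::
    "'a::complex_vector set \<Rightarrow> ('a \<Rightarrow> 'a \<Rightarrow> complex) \<Rightarrow>
     'b::complex_vector set \<Rightarrow> ('b \<Rightarrow> 'b \<Rightarrow> complex) \<Rightarrow> ('a \<Rightarrow> 'b) \<Rightarrow> ('b \<Rightarrow> 'a) \<Rightarrow> bool"
  where "is_moore_penrose V ipV W ipW M X \<longleftrightarrow>
    X \<in> lin_maps W V \<and>
    (\<forall>u\<in>V. M (X (M u)) = M u) \<and>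
    (\<forall>w\<in>W. X (M (X w)) = X w) \<and>
    (\<forall>w\<in>W. \<forall>z\<in>W. ipW (M (X w)) z = ipW w (M (X z))) \<and>
    (\<forall>u\<in>V. \<forall>v\<in>V. ipV (X (M u)) v = ipV u (X (M v)))"

definition moore_penrose ::
    "'a::complex_vector set \<Rightarrow> ('a \<Rightarrow> 'a \<Rightarrow> complex) \<Rightarrow>
     'b::complex_vector set \<Rightarrow> ('b \<Rightarrow> 'b \<Rightarrow> complex) \<Rightarrow> ('a \<Rightarrow> 'b) \<Rightarrow> 'b \<Rightarrow> 'a"
  where "moore_penrose V ipV W ipW M = (THE X. is_moore_penrose V ipV W ipW M X)"

section \<open>The space \<open>H\<^sup>1\<close>\<close>

type_synonym 'n cfun = "real^'n \<Rightarrow> complex"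

definition cnj_fun :: "('a \<Rightarrow> complex) \<Rightarrow> 'a \<Rightarrow> complex"
  where "cnj_fun u = (\<lambda>x. cnj (u x))"

definition L2 :: "(real^'n) set \<Rightarrow> 'n::finite cfun set"
  where "L2 \<Omega> = {f. set_borel_measurable lebesgue \<Omega> f \<and>
                    set_integrable lebesgue \<Omega> (\<lambda>x. (cmod (f x))\<^sup>2)}"

text \<open>\<open>C\<^sup>1\<close> test functions with compact support; they define the same weak gradient as
  \<open>C\<^sup>\<infinity>\<close> ones.\<close>

definition test_fun :: "(real^'n) set \<Rightarrow> (real^'n \<Rightarrow> real) \<Rightarrow> (real^'n \<Rightarrow> real^'n::finite) \<Rightarrow> bool"
  where "test_fun \<Omega> \<phi> D \<longleftrightarrow>
    (\<forall>x. (\<phi> has_derivative (\<lambda>h. D x \<bullet> h)) (at x)) \<and> continuous_on UNIV D \<and>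
    (\<exists>K\<subseteq>\<Omega>. compact K \<and> (\<forall>x. x \<notin> K \<longrightarrow> \<phi> x = 0))"

definition is_weak_grad ::
    "(real^'n) set \<Rightarrow> 'n::finite cfun \<Rightarrow> (real^'n \<Rightarrow> complex^'n) \<Rightarrow> bool"
  where "is_weak_grad \<Omega> u g \<longleftrightarrow>
    (\<forall>i. (\<lambda>x. g x $ i) \<in> L2 \<Omega>) \<and>
    (\<forall>\<phi> D. test_fun \<Omega> \<phi> D \<longrightarrow>
      (\<forall>i. (LINT x:\<Omega>|lebesgue. complex_of_real (D x $ i) * u x)
         = - (LINT x:\<Omega>|lebesgue. complex_of_real (\<phi> x) * g x $ i)))"

definition H1 :: "(real^'n) set \<Rightarrow> 'n::finite cfun set"
  where "H1 \<Omega> = {u \<in> L2 \<Omega>. \<exists>g. is_weak_grad \<Omega> u g}"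

definition weak_grad :: "(real^'n) set \<Rightarrow> 'n::finite cfun \<Rightarrow> real^'n \<Rightarrow> complex^'n"
  where "weak_grad \<Omega> u = (SOME g. is_weak_grad \<Omega> u g)"

definition H1_norm :: "(real^'n) set \<Rightarrow> 'n::finite cfun \<Rightarrow> real"
  where "H1_norm \<Omega> u =
    sqrt (LINT x:\<Omega>|lebesgue. (cmod (u x))\<^sup>2 + (\<Sum>i\<in>UNIV. (cmod (weak_grad \<Omega> u x $ i))\<^sup>2))"

section \<open>Trace spaces\<close>

definition hausdorff_pre :: "nat \<Rightarrow> real \<Rightarrow> 'a::metric_space set \<Rightarrow> ennreal"
  where "hausdorff_pre s \<delta> E =
    (INF U \<in> {U :: nat \<Rightarrow> 'a set. E \<subseteq> (\<Union>i. U i) \<and> (\<forall>i. bounded (U i) \<and> diameter (U i) \<le> \<delta>)}.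
      (\<Sum>i. ennreal (unit_ball_vol (real s) * (diameter (U i) / 2) ^ s)))"

text \<open>Surface measure on hypersurfaces of \<open>\<real>\<^sup>d\<close>: the normalised
  \<open>(d-1)\<close>-dimensional Hausdorff measure on the Borel sets (\<open>d \<ge> 2\<close>).\<close>

definition surface_measure :: "(real^'n::finite) measure"
  where "surface_measure =
    measure_of UNIV (sets borel) (\<lambda>E. SUP \<delta>\<in>{0<..}. hausdorff_pre (CARD('n) - 1) \<delta> E)"

definition restr :: "'a set \<Rightarrow> ('a \<Rightarrow> complex) \<Rightarrow> 'a \<Rightarrow> complex"
  where "restr \<Theta> u = (\<lambda>x. if x \<in> \<Theta> then u x else 0)"

text \<open>The trace operator is the continuous extension of the restriction of functions that
  are continuous up to the boundary. Functions on a set \<open>\<Theta>\<close> are extended by \<open>0\<close>.\<close>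

definition has_trace :: "(real^'n) set \<Rightarrow> 'n::finite cfun \<Rightarrow> 'n cfun \<Rightarrow> bool"
  where "has_trace \<Omega> u g \<longleftrightarrow>
    g \<in> borel_measurable borel \<and> (\<forall>x. x \<notin> frontier \<Omega> \<longrightarrow> g x = 0) \<and>
    (\<exists>\<phi>. (\<forall>n. \<phi> n \<in> H1 \<Omega> \<and> continuous_on (closure \<Omega>) (\<phi> n)) \<and>
      (\<lambda>n. H1_norm \<Omega> (\<phi> n - u)) \<longlonglongrightarrow> 0 \<and>
      (\<lambda>n. \<integral>\<^sup>+x. ennreal ((cmod (restr (frontier \<Omega>) (\<phi> n) x - g x))\<^sup>2) \<partial>surface_measure)
         \<longlonglongrightarrow> 0)"

text \<open>\<open>H\<^sup>1\<^sup>/\<^sup>2(\<Gamma>)\<close> for \<open>\<Gamma> = frontier \<Omega>\<close>. Its elements are representatives, which are identified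
  when the seminorm \<open>trace_norm\<close> of their difference is zero.\<close>

definition H_half :: "(real^'n) set \<Rightarrow> 'n::finite cfun set"
  where "H_half \<Omega> = {g. \<exists>u\<in>H1 \<Omega>. has_trace \<Omega> u g}"

definition trace_norm :: "(real^'n) set \<Rightarrow> 'n::finite cfun \<Rightarrow> real"
  where "trace_norm \<Omega> g = Inf {H1_norm \<Omega> u | u. u \<in> H1 \<Omega> \<and> has_trace \<Omega> u g}"

definition H_mhalf :: "(real^'n) set \<Rightarrow> ('n::finite cfun \<Rightarrow> complex) set"
  where "H_mhalf \<Omega> = {f \<in> cdual (H_half \<Omega>). \<exists>C. \<forall>g\<in>H_half \<Omega>. cmod (f g) \<le> C * trace_norm \<Omega> g}"

definition mhalf_norm :: "(real^'n) set \<Rightarrow> ('n::finite cfun \<Rightarrow> complex) \<Rightarrow> real"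
  where "mhalf_norm \<Omega> f = Sup {cmod (f g) | g. g \<in> H_half \<Omega> \<and> trace_norm \<Omega> g \<le> 1}"

definition boundary_pairing ::
    "('n cfun \<Rightarrow> complex) \<times> 'n cfun \<Rightarrow> 'n cfun \<times> ('n cfun \<Rightarrow> complex) \<Rightarrow> complex"
  where "boundary_pairing y x = fst y (fst x) + snd x (snd y)"

definition cnj_boundary ::
    "'n cfun \<times> ('n cfun \<Rightarrow> complex) \<Rightarrow> 'n cfun \<times> ('n cfun \<Rightarrow> complex)"
  where "cnj_boundary x = (cnj_fun (fst x), dual_conj cnj_fun (snd x))"

text \<open>Bounded linear operators from \<open>H\<^sup>1\<^sup>/\<^sup>2 \<times> H\<^sup>-\<^sup>1\<^sup>/\<^sup>2\<close> to \<open>H\<^sup>-\<^sup>1\<^sup>/\<^sup>2 \<times> H\<^sup>1\<^sup>/\<^sup>2\<close>, acting on representatives: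
  linearity of the second component holds up to functions of seminorm zero.\<close>

definition boundary_eq ::
    "(real^'n) set \<Rightarrow> ('n::finite cfun \<Rightarrow> complex) \<times> 'n cfun \<Rightarrow> ('n cfun \<Rightarrow> complex) \<times> 'n cfun \<Rightarrow> bool"
  where "boundary_eq \<Omega> y z \<longleftrightarrow> fst y = fst z \<and> trace_norm \<Omega> (snd y - snd z) = 0"

definition bounded_boundary_op ::
    "(real^'n) set \<Rightarrow>
     ('n::finite cfun \<times> ('n cfun \<Rightarrow> complex) \<Rightarrow> ('n cfun \<Rightarrow> complex) \<times> 'n cfun) \<Rightarrow> bool"
  where "bounded_boundary_op \<Omega> \<A> \<longleftrightarrow>
    (let X = H_half \<Omega> \<times> H_mhalf \<Omega> in
      \<A> ` X \<subseteq> H_mhalf \<Omega> \<times> H_half \<Omega> \<and>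
      (\<forall>x\<in>X. \<forall>y\<in>X. boundary_eq \<Omega> (\<A> (x + y)) (\<A> x + \<A> y)) \<and>
      (\<forall>c. \<forall>x\<in>X. boundary_eq \<Omega> (\<A> (c *\<^sub>C x)) (c *\<^sub>C \<A> x)) \<and>
      (\<exists>C. \<forall>x\<in>X. mhalf_norm \<Omega> (fst (\<A> x)) + trace_norm \<Omega> (snd (\<A> x))
               \<le> C * (trace_norm \<Omega> (fst x) + mhalf_norm \<Omega> (snd x))))"

definition dissipative ::
    "(real^'n) set \<Rightarrow>
     ('n::finite cfun \<times> ('n cfun \<Rightarrow> complex) \<Rightarrow> ('n cfun \<Rightarrow> complex) \<times> 'n cfun) \<Rightarrow> bool"
  where "dissipative \<Omega> \<A> \<longleftrightarrow>
    (\<forall>v\<in>H_half \<Omega>. \<forall>q\<in>H_mhalf \<Omega>. Im (boundary_pairing (\<A> (v, q)) (cnj_boundary (v, q))) \<le> 0)"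

section \<open>Meshes, finite elements and domain decomposition\<close>

text \<open>Interiors of finite unions of simplices; in particular, slits are excluded.\<close>

definition polyhedral_open :: "(real^'n::finite) set \<Rightarrow> bool"
  where "polyhedral_open \<Omega> \<longleftrightarrow>
    (\<exists>\<S>. finite \<S> \<and> (\<forall>S\<in>\<S>. int CARD('n) simplex S) \<and> \<Omega> = interior (\<Union>\<S>))"

definition simplicial_mesh :: "(real^'n::finite) set \<Rightarrow> (real^'n) set set \<Rightarrow> bool"
  where "simplicial_mesh \<Omega> \<T> \<longleftrightarrow>
    triangulation \<T> \<and> (\<forall>\<tau>\<in>\<T>. int CARD('n) simplex \<tau>) \<and> \<Union>\<T> = closure \<Omega>"

definition polys :: "nat \<Rightarrow> 'n::finite cfun set"
  where "polys k = {p. \<exists>c :: ('n \<Rightarrow> nat) \<Rightarrow> complex.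
    p = (\<lambda>x. \<Sum>\<alpha> | (\<Sum>i\<in>UNIV. \<alpha> i) \<le> k. c \<alpha> * complex_of_real (\<Prod>i\<in>UNIV. (x $ i) ^ \<alpha> i))}"

definition fe_space :: "nat \<Rightarrow> (real^'n) set set \<Rightarrow> (real^'n) set \<Rightarrow> 'n::finite cfun set"
  where "fe_space k \<T> \<Omega> =
    {u \<in> H1 \<Omega>. (\<forall>x. x \<notin> closure \<Omega> \<longrightarrow> u x = 0) \<and> continuous_on (closure \<Omega>) u \<and>
       (\<forall>\<tau>\<in>\<T>. \<exists>p\<in>polys k. \<forall>x\<in>\<tau>. u x = p x)}"

definition fe_restr ::
    "nat \<Rightarrow> (real^'n) set set \<Rightarrow> (real^'n) set \<Rightarrow> (real^'n) set \<Rightarrow> 'n::finite cfun set"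
  where "fe_restr k \<T> \<Omega> \<Theta> = restr \<Theta> ` fe_space k \<T> \<Omega>"

definition domain_decomposition ::
    "(real^'n) set \<Rightarrow> (real^'n) set set \<Rightarrow> nat \<Rightarrow> (nat \<Rightarrow> (real^'n::finite) set) \<Rightarrow> bool"
  where "domain_decomposition \<Omega> \<T> J \<Omega>s \<longleftrightarrow>
    closure \<Omega> = (\<Union>j<J. closure (\<Omega>s j)) \<and>
    disjoint_family_on \<Omega>s {..<J} \<and>
    (\<forall>j<J. polyhedral_open (\<Omega>s j) \<and> (\<exists>\<T>'\<subseteq>\<T>. closure (\<Omega>s j) = \<Union>\<T>'))"

text \<open>\<open>J\<close>-tuples are functions on \<open>nat\<close> that vanish from \<open>J\<close> on.\<close>

definition tuples :: "nat \<Rightarrow> (nat \<Rightarrow> 'a::zero set) \<Rightarrow> (nat \<Rightarrow> 'a) set"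
  where "tuples J S = {u. (\<forall>j<J. u j \<in> S j) \<and> (\<forall>j\<ge>J. u j = 0)}"

text \<open>The cells of a mesh being closed, \<open>V\<^sub>h(\<Omega>\<^sub>j)\<close> consists of functions on the
  closure of \<open>\<Omega>\<^sub>j\<close>, which have pointwise boundary values.\<close>

definition volume_space ::
    "nat \<Rightarrow> (real^'n) set set \<Rightarrow> (real^'n) set \<Rightarrow> ('n::finite cfun \<Rightarrow> complex) set \<Rightarrow>
     nat \<Rightarrow> (nat \<Rightarrow> (real^'n) set) \<Rightarrow>
     (('n cfun \<times> ('n cfun \<Rightarrow> complex)) \<times> (nat \<Rightarrow> 'n cfun)) set"
  where "volume_space k \<T> \<Omega> Q J \<Omega>s =
    (fe_restr k \<T> \<Omega> (frontier \<Omega>) \<times> Q) \<times> tuples J (\<lambda>j. fe_restr k \<T> \<Omega> (closure (\<Omega>s j)))"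

definition skeleton_space ::
    "nat \<Rightarrow> (real^'n) set set \<Rightarrow> (real^'n) set \<Rightarrow> nat \<Rightarrow> (nat \<Rightarrow> (real^'n) set) \<Rightarrow>
     ('n::finite cfun \<times> (nat \<Rightarrow> 'n cfun)) set"
  where "skeleton_space k \<T> \<Omega> J \<Omega>s =
    fe_restr k \<T> \<Omega> (frontier \<Omega>) \<times> tuples J (\<lambda>j. fe_restr k \<T> \<Omega> (frontier (\<Omega>s j)))"

definition cnj_volume ::
    "('n cfun \<times> ('n cfun \<Rightarrow> complex)) \<times> (nat \<Rightarrow> 'n cfun) \<Rightarrow>
     ('n cfun \<times> ('n cfun \<Rightarrow> complex)) \<times> (nat \<Rightarrow> 'n cfun)"
  where "cnj_volume w = (cnj_boundary (fst w), \<lambda>j. cnj_fun (snd w j))"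

definition cnj_skeleton :: "'n cfun \<times> (nat \<Rightarrow> 'n cfun) \<Rightarrow> 'n cfun \<times> (nat \<Rightarrow> 'n cfun)"
  where "cnj_skeleton v = (cnj_fun (fst v), \<lambda>j. cnj_fun (snd v j))"

definition trace_op ::
    "(nat \<Rightarrow> (real^'n) set) \<Rightarrow>
     ('n cfun \<times> ('n cfun \<Rightarrow> complex)) \<times> (nat \<Rightarrow> 'n cfun) \<Rightarrow> 'n cfun \<times> (nat \<Rightarrow> 'n cfun)"
  where "trace_op \<Omega>s w = (fst (fst w), \<lambda>j. restr (frontier (\<Omega>s j)) (snd w j))"

section \<open>Operators\<close>

definition helmholtz_form :: "'n cfun \<Rightarrow> (real^'n) set \<Rightarrow> 'n::finite cfun \<Rightarrow> 'n cfun \<Rightarrow> complex"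
  where "helmholtz_form \<kappa> \<Omega> u v =
    (LINT x:\<Omega>|lebesgue.
      (\<Sum>i\<in>UNIV. weak_grad \<Omega> u x $ i * weak_grad \<Omega> v x $ i) - (\<kappa> x)\<^sup>2 * u x * v x)"

definition block_op ::
    "(('n::finite cfun \<times> ('n cfun \<Rightarrow> complex)) \<times> (nat \<Rightarrow> 'n cfun)) set \<Rightarrow>
     nat \<Rightarrow> (nat \<Rightarrow> (real^'n) set) \<Rightarrow> 'n cfun \<Rightarrow>
     ('n cfun \<times> ('n cfun \<Rightarrow> complex) \<Rightarrow> ('n cfun \<Rightarrow> complex) \<times> 'n cfun) \<Rightarrow>
     ('n cfun \<times> ('n cfun \<Rightarrow> complex)) \<times> (nat \<Rightarrow> 'n cfun) \<Rightarrow>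
     ('n cfun \<times> ('n cfun \<Rightarrow> complex)) \<times> (nat \<Rightarrow> 'n cfun) \<Rightarrow> complex"
  where "block_op V J \<Omega>s \<kappa> \<A> w = (\<lambda>z. if z \<in> V
    then boundary_pairing (\<A> (fst w)) (fst z)
       + (\<Sum>j<J. helmholtz_form \<kappa> (\<Omega>s j) (snd w j) (snd z j))
    else 0)"

text \<open>\<open>T\<^sup>* = T = conj T\<close> and positivity, with \<open>V\<^sup>*\<^sup>*\<close> identified with \<open>V\<close> by evaluation.\<close>

definition impedance_op ::
    "'a::complex_vector set \<Rightarrow> ('a \<Rightarrow> 'a) \<Rightarrow> ('a \<Rightarrow> 'a \<Rightarrow> complex) \<Rightarrow> bool"
  where "impedance_op V c T \<longleftrightarrow>
    T \<in> lin_maps V (cdual V) \<and>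
    (\<forall>u\<in>V. transpose_on V T (\<lambda>p. p u) = T u) \<and>
    (\<forall>u\<in>V. T (c u) = dual_conj c (T u)) \<and>
    (\<forall>u\<in>V. u \<noteq> 0 \<longrightarrow> T u (c u) \<in> \<real> \<and> Re (T u (c u)) > 0)"

definition inv_norm ::
    "'a set \<Rightarrow> ('a \<Rightarrow> 'a) \<Rightarrow> ('a \<Rightarrow> 'a \<Rightarrow> complex) \<Rightarrow> ('a \<Rightarrow> complex) \<Rightarrow> real"
  where "inv_norm V c T p = sqrt (Re (dual_conj c p (inv_into V T p)))"

definition cauchy_data ::
    "'a::complex_vector set \<Rightarrow> 'b::complex_vector set \<Rightarrow> ('a \<Rightarrow> 'a \<Rightarrow> complex) \<Rightarrow> ('a \<Rightarrow> 'b) \<Rightarrow>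
     ('b \<times> ('b \<Rightarrow> complex)) set"
  where "cauchy_data V V\<Sigma> A B = {(B u, p) | u p. u \<in> V \<and> p \<in> cdual V\<Sigma> \<and> A u = transpose_on V B p}"

definition is_scattering ::
    "'b::complex_vector set \<Rightarrow> ('b \<Rightarrow> 'b \<Rightarrow> complex) \<Rightarrow> ('b \<times> ('b \<Rightarrow> complex)) set \<Rightarrow>
     (('b \<Rightarrow> complex) \<Rightarrow> ('b \<Rightarrow> complex)) \<Rightarrow> bool"
  where "is_scattering V\<Sigma> T \<C> S \<longleftrightarrow>
    S \<in> lin_maps (cdual V\<Sigma>) (cdual V\<Sigma>) \<and>
    (\<forall>(v, p)\<in>\<C>. p + \<i> *\<^sub>C T v = S (p - \<i> *\<^sub>C T v))"

end

(* With M = A - i B^T T B, a pair (B u, p) with A u = B^T p is a Cauchy datum iff q = p - i T B u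
   satisfies M u = B^T q, and then p + i T B u = q + 2 i T B u. So S exists and is unique as soon
   as B^T q lies in the range of M for all q and B vanishes on the kernel of M. If M is bijective
   this is clear. In the dissipative case Im <M u, conj u> = 0 forces B u = 0, which settles the
   kernel; A need not be symmetric, but the adjoint problem is dissipative as well: if w is
   annihilated by the range of M, then <M (conj w), w> = 0, hence B w = 0 and B^T q annihilates w.
   The energy identity is the expansion of the T-norm of w + 2 i B u, where q = T w.

   All of this needs the Helmholtz form to be bilinear. As weak gradients are chosen by SOME, this
   rests on their almost everywhere uniqueness, that is, on the fundamental lemma of the calculus
   of variations, obtained here by approximating indicators of boxes by C^1 bumps. *)
theory Submission
  imports Defs
begin

text \<open>Two further obstacles shape the proof. Elements of \<open>H_half\<close> are
  representatives, and the second component of a \<open>bounded_boundary_op\<close> is linear only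
  up to functions of seminorm zero. The block operator is linear nevertheless: that component is
  paired with functionals bounded by the seminorm, which cannot see such a difference. To argue so,
  \<open>H_half\<close> must be a vector space, hence traces must add, hence \<open>H1_norm\<close>
  must satisfy a triangle inequality, at least up to a constant. Second,
  \<open>moore_penrose\<close> is a definite description, so a pseudo-inverse has to be constructed
  and shown unique. Orthogonal projections in finite dimension give the least-squares solution of
  minimal norm; its uniqueness yields both the linearity of the construction and its agreement with
  every Moore-Penrose inverse. The scattering argument then uses the pseudo-inverse through
  \<open>M (Mdag (M u)) = M u\<close>: if \<open>M u = Bt q\<close> is solvable at all,
  \<open>Mdag (Bt q)\<close> solves it. The Riesz map of the chosen inner product also converts a
  functional orthogonal to the range of \<open>M\<close> into a vector annihilated by that range, so
  that the adjoint problem can be treated inside \<open>V\<close>.\<close>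

section \<open>Finite-dimensional subspaces and maps that are linear on a subspace\<close>

lemma fun_scaleC [simp]: "(c *\<^sub>C f) x = c * (f x :: complex)"
  by (simp add: scaleC_fun_def scaleC_complex_def)

lemma clinear_onD:
  assumes "clinear_on V f"
  shows "x \<in> V \<Longrightarrow> y \<in> V \<Longrightarrow> f (x + y) = f x + f y"
    and "x \<in> V \<Longrightarrow> f (c *\<^sub>C x) = c *\<^sub>C f x"
  using assms by (auto simp: clinear_on_def)

lemma clinear_on_zero:
  assumes "clinear_on V f" "0 \<in> V"
  shows "f 0 = 0"
  using clinear_onD(2)[OF assms, of 0] by simp

lemma clinear_on_diff:
  assumes f: "clinear_on V f" and V: "complex_vector.subspace V" and x: "x \<in> V" and y: "y \<in> V"
  shows "f (x - y) = f x - f y"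
  using clinear_onD(1)[OF f complex_vector.subspace_diff[OF V x y] y] by (simp add: algebra_simps)

text \<open>The finite spanning set may leave \<open>V\<close>. This makes the property pass to
  arbitrary subsets, and later allows discontinuous functions to span a finite element
  space.\<close>

definition fin_dim :: "'a::complex_vector set \<Rightarrow> bool"
  where "fin_dim V \<longleftrightarrow> (\<exists>b. finite b \<and> V \<subseteq> complex_vector.span b)"

lemma fin_dim_subset: "fin_dim V \<Longrightarrow> U \<subseteq> V \<Longrightarrow> fin_dim U"
  unfolding fin_dim_def by blast

lemma fin_dim_basis:
  assumes "complex_vector.subspace V" "fin_dim V"
  obtains b where "finite b" "b \<subseteq> V" "V = complex_vector.span b"
proof -
  obtain a where a: "finite a" "V \<subseteq> complex_vector.span a"
    using assms(2) unfolding fin_dim_def by blast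
  obtain b where b: "b \<subseteq> V" "complex_vector.independent b" "V \<subseteq> complex_vector.span b"
    using complex_vector.basis_exists[of V] by metis
  have "finite b"
    using complex_vector.independent_span_bound[OF a(1) b(2)] a b by auto
  moreover have "V = complex_vector.span b"
    using b assms(1) by (metis complex_vector.span_subspace)
  ultimately show thesis using that b by blast
qed

lemma subspace_image:
  assumes V: "complex_vector.subspace V" and f: "clinear_on V f"
  shows "complex_vector.subspace (f ` V)"
  unfolding complex_vector.subspace_def
proof (intro conjI ballI allI)
  show "0 \<in> f ` V"
    using clinear_on_zero[OF f] complex_vector.subspace_0[OF V] by force
next
  fix x y assume "x \<in> f ` V" "y \<in> f ` V"
  then obtain u v where "u \<in> V" "v \<in> V" "x = f u" "y = f v" by blast
  then show "x + y \<in> f ` V"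
    using clinear_onD(1)[OF f, of u v] complex_vector.subspace_add[OF V, of u v] by force
next
  fix c x assume "x \<in> f ` V"
  then obtain u where "u \<in> V" "x = f u" by blast
  then show "c *\<^sub>C x \<in> f ` V"
    using clinear_onD(2)[OF f, of u c] complex_vector.subspace_scale[OF V, of u c] by force
qed

lemma fin_dim_image:
  assumes V: "complex_vector.subspace V" and fd: "fin_dim V" and f: "clinear_on V f"
  shows "fin_dim (f ` V)"
proof -
  obtain b where b: "finite b" "b \<subseteq> V" "V = complex_vector.span b"
    using fin_dim_basis[OF V fd] by metis
  \<comment> \<open>Membership in \<open>V\<close> is carried through the induction because
    \<open>f\<close> is known to be linear on \<open>V\<close> only.\<close>
  have "x \<in> V \<and> f x \<in> complex_vector.span (f ` b)" if "x \<in> complex_vector.span b" for x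
    using that
  proof (induction rule: complex_vector.span_induct_alt)
    case base
    show ?case
      using clinear_on_zero[OF f complex_vector.subspace_0[OF V]] complex_vector.subspace_0[OF V]
      by (auto intro: complex_vector.span_zero)
  next
    case (step c x y)
    then have "x \<in> V" "c *\<^sub>C x \<in> V" using b complex_vector.subspace_scale[OF V] by auto
    moreover have "c *\<^sub>C f x + f y \<in> complex_vector.span (f ` b)"
      by (rule complex_vector.span_add[OF complex_vector.span_scale[OF complex_vector.span_base]])
        (use step in auto)
    ultimately show ?case
      using step by (simp add: clinear_onD[OF f] complex_vector.subspace_add[OF V])
  qed
  then have "f ` V \<subseteq> complex_vector.span (f ` b)" using b by auto
  then show ?thesis using b(1) unfolding fin_dim_def by blast
qed

section \<open>Inner products\<close>

lemma inner_product_onD: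
  assumes "inner_product_on V ip"
  shows "y \<in> V \<Longrightarrow> clinear_on V (\<lambda>x. ip x y)"
    and "x \<in> V \<Longrightarrow> y \<in> V \<Longrightarrow> ip y x = cnj (ip x y)"
    and "x \<in> V \<Longrightarrow> x \<noteq> 0 \<Longrightarrow> Re (ip x x) > 0"
  by (fact assms[unfolded inner_product_on_def, THEN conjunct1, rule_format]
      assms[unfolded inner_product_on_def, THEN conjunct2, THEN conjunct1, rule_format]
      assms[unfolded inner_product_on_def, THEN conjunct2, THEN conjunct2, rule_format])+

lemma ip_add_left:
  assumes "inner_product_on V ip" "x \<in> V" "y \<in> V" "z \<in> V"
  shows "ip (x + y) z = ip x z + ip y z"
  using clinear_onD(1)[OF inner_product_onD(1)[OF assms(1,4)]] assms by blast

lemma ip_scale_left: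
  assumes "inner_product_on V ip" "x \<in> V" "z \<in> V"
  shows "ip (c *\<^sub>C x) z = c * ip x z"
  using clinear_onD(2)[OF inner_product_onD(1)[OF assms(1,3)] assms(2)]
  by (simp add: scaleC_complex_def)

context
  fixes V :: "'a::complex_vector set" and ip :: "'a \<Rightarrow> 'a \<Rightarrow> complex"
  assumes V: "complex_vector.subspace V" and ip: "inner_product_on V ip"
begin

lemma ip_diff_left:
  assumes "x \<in> V" "y \<in> V" "z \<in> V"
  shows "ip (x - y) z = ip x z - ip y z"
  using clinear_on_diff[OF inner_product_onD(1)[OF ip assms(3)] V assms(1,2)] .

lemma ip_add_right:
  assumes "x \<in> V" "y \<in> V" "z \<in> V"
  shows "ip z (x + y) = ip z x + ip z y"
proof -
  have "x + y \<in> V" using assms complex_vector.subspace_add[OF V] by blast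
  then show ?thesis
    using assms inner_product_onD(2)[OF ip] ip_add_left[OF ip assms] by (metis complex_cnj_add)
qed

lemma ip_diff_right:
  assumes "x \<in> V" "y \<in> V" "z \<in> V"
  shows "ip z (x - y) = ip z x - ip z y"
proof -
  have "x - y \<in> V" using assms complex_vector.subspace_diff[OF V] by blast
  then show ?thesis
    using assms inner_product_onD(2)[OF ip] ip_diff_left[OF assms] by (metis complex_cnj_diff)
qed

lemma ip_scale_right:
  assumes "x \<in> V" "z \<in> V"
  shows "ip z (c *\<^sub>C x) = cnj c * ip z x"
proof -
  have "c *\<^sub>C x \<in> V" using assms complex_vector.subspace_scale[OF V] by blast
  then show ?thesis
    using assms inner_product_onD(2)[OF ip] ip_scale_left[OF ip assms] by (metis complex_cnj_mult)
qed

lemma ip_zero_left: "z \<in> V \<Longrightarrow> ip 0 z = 0"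
  using ip_scale_left[OF ip, of 0 z 0] complex_vector.subspace_0[OF V] by simp

lemma ip_zero_right: "z \<in> V \<Longrightarrow> ip z 0 = 0"
  using ip_scale_right[of 0 z 0] complex_vector.subspace_0[OF V] by simp

lemma ip_eq_zero_imp: "x \<in> V \<Longrightarrow> ip x x = 0 \<Longrightarrow> x = 0"
  using inner_product_onD(3)[OF ip] by force

text \<open>A Gram-Schmidt step: the new vector \<open>a\<close> is replaced by its component
  \<open>d\<close> orthogonal to the old span, and the old projection of \<open>w\<close> is
  corrected along \<open>d\<close>.\<close>

lemma projection_span:
  assumes "finite b" "b \<subseteq> V" "w \<in> V"
  shows "\<exists>r\<in>complex_vector.span b. \<forall>y\<in>complex_vector.span b. ip (w - r) y = 0"
  using assms
proof (induction b arbitrary: w)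
  case empty
  then show ?case by (simp add: ip_zero_right)
next
  case (insert a b)
  have sub: "complex_vector.span b \<subseteq> V" 
    using insert V by (simp add: complex_vector.span_minimal)
  obtain p where p: "p \<in> complex_vector.span b" "\<And>y. y \<in> complex_vector.span b \<Longrightarrow> ip (a - p) y = 0"
    using insert.IH[of a] insert.prems by auto
  obtain r where r: "r \<in> complex_vector.span b" "\<And>y. y \<in> complex_vector.span b \<Longrightarrow> ip (w - r) y = 0"
    using insert.IH[of w] insert.prems by auto
  define d where "d = a - p"
  have V': "a \<in> V" "p \<in> V" "r \<in> V" "w \<in> V" "d \<in> V"
    using insert.prems p(1) r(1) sub V by (auto simp: d_def intro: complex_vector.subspace_diff)
  \<comment> \<open>If \<open>a\<close> already lies in the span of \<open>b\<close>, then
    \<open>d = 0\<close>, the quotient by zero is 0, and the correction vanishes as it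
    should.\<close>
  define c where "c = ip (w - r) d / ip d d"
  have ins: "a \<in> complex_vector.span (insert a b)"
      "complex_vector.span b \<subseteq> complex_vector.span (insert a b)"
    by (auto intro: complex_vector.span_base complex_vector.span_mono[THEN subsetD])
  have dins: "d \<in> complex_vector.span (insert a b)"
    using ins p(1) by (auto simp: d_def intro: complex_vector.span_diff)
  show ?case
  proof (intro bexI ballI)
    show "r + c *\<^sub>C d \<in> complex_vector.span (insert a b)"
      using dins ins r(1) by (auto intro!: complex_vector.span_add complex_vector.span_scale)
    fix y assume "y \<in> complex_vector.span (insert a b)"
    then obtain k where k: "y - k *\<^sub>C a \<in> complex_vector.span b"
      by (auto simp: complex_vector.span_breakdown_eq)
    \<comment> \<open>Trading \<open>k\<close> times \<open>a\<close> for \<open>k\<close> times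
      \<open>p\<close> splits \<open>y\<close> into a part in the old span and a multiple of
      \<open>d\<close>.\<close>
    define y' where "y' = y - k *\<^sub>C a + k *\<^sub>C p"
    have y': "y' \<in> complex_vector.span b"
      unfolding y'_def using k p(1) by (auto intro!: complex_vector.span_add complex_vector.span_scale)
    have y: "y = y' + k *\<^sub>C d"
      by (simp add: y'_def d_def complex_vector.scale_right_diff_distrib)
    have mem: "y' \<in> V" "k *\<^sub>C d \<in> V" "c *\<^sub>C d \<in> V" "w - r \<in> V" 
      using y' sub V' V by (auto intro: complex_vector.subspace_scale complex_vector.subspace_diff)
    define e where "e = w - r"
    have e: "e \<in> V" "e - c *\<^sub>C d \<in> V"
      using mem complex_vector.subspace_diff[OF V mem(4,3)] by (auto simp: e_def)
    have "ip (e - c *\<^sub>C d) (y' + k *\<^sub>C d)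
        = ip e y' - c * ip d y' + cnj k * (ip e d - c * ip d d)"
      using mem V' e
      by (simp add: ip_add_right ip_diff_left ip_scale_left[OF ip] ip_scale_right algebra_simps)
    also have "ip e d - c * ip d d = 0"
      using ip_eq_zero_imp[OF V'(5)] ip_zero_right[OF e(1)] by (auto simp: c_def e_def)
    also have "ip d y' = 0" using p(2)[OF y'] by (simp add: d_def)
    finally show "ip (w - (r + c *\<^sub>C d)) y = 0"
      using r(2)[OF y'] by (simp add: y e_def diff_diff_eq)
  qed
qed

lemma projection_exists:
  assumes "complex_vector.subspace R" "fin_dim R" "R \<subseteq> V" "w \<in> V"
  shows "\<exists>r\<in>R. \<forall>y\<in>R. ip (w - r) y = 0"
proof -
  obtain b where b: "finite b" "b \<subseteq> R" "R = complex_vector.span b"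
    using fin_dim_basis[OF assms(1,2)] by metis
  then show ?thesis using projection_span[of b w] assms by auto
qed

end

lemma subspace_kernel:
  assumes V: "complex_vector.subspace V" and f: "clinear_on V f"
  shows "complex_vector.subspace {x \<in> V. f x = 0}"
  unfolding complex_vector.subspace_def
  using clinear_on_zero[OF f complex_vector.subspace_0[OF V]] clinear_onD[OF f]
    complex_vector.subspace_0[OF V] complex_vector.subspace_add[OF V]
    complex_vector.subspace_scale[OF V]
  by auto

section \<open>The dual space\<close>

lemma cdualD:
  assumes "f \<in> cdual V"
  shows "clinear_on V f" "x \<notin> V \<Longrightarrow> f x = 0"
  using assms by (auto simp: cdual_def lin_maps_def)

lemma cdualI:
  assumes "\<And>x y. x \<in> V \<Longrightarrow> y \<in> V \<Longrightarrow> f (x + y) = f x + f y"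
    and "\<And>c x. x \<in> V \<Longrightarrow> f (c *\<^sub>C x) = c * f x"
    and "\<And>x. x \<notin> V \<Longrightarrow> f x = 0"
  shows "f \<in> cdual V"
  using assms by (auto simp: cdual_def lin_maps_def clinear_on_def scaleC_complex_def)

lemma cdual_add: "f \<in> cdual V \<Longrightarrow> x \<in> V \<Longrightarrow> y \<in> V \<Longrightarrow> f (x + y) = f x + f y"
  by (simp add: cdual_def lin_maps_def clinear_on_def)

lemma cdual_scale: "f \<in> cdual V \<Longrightarrow> x \<in> V \<Longrightarrow> f (c *\<^sub>C x) = c * f x"
  by (simp add: cdual_def lin_maps_def clinear_on_def scaleC_complex_def)

lemma subspace_cdual: "complex_vector.subspace (cdual V)"
  unfolding complex_vector.subspace_def
  by (auto intro!: cdualI simp: cdual_add cdual_scale cdualD(2) algebra_simps)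

text \<open>A vector \<open>d\<close> orthogonal to the kernel with \<open>f d \<noteq> 0\<close>
  represents \<open>f\<close> up to a factor, because \<open>x\<close> minus
  \<open>f x / f d\<close> times \<open>d\<close> lies in the kernel for every
  \<open>x\<close>.\<close>

lemma riesz_exists:
  assumes V: "complex_vector.subspace V" and fd: "fin_dim V" and ip: "inner_product_on V ip"
    and f: "f \<in> cdual V"
  shows "\<exists>!r. r \<in> V \<and> (\<forall>x\<in>V. f x = ip x r)"
proof (rule ex_ex1I)
  note lin = cdualD(1)[OF f]
  define N where "N = {x \<in> V. f x = 0}"
  have N: "complex_vector.subspace N" "fin_dim N" "N \<subseteq> V"
    using subspace_kernel[OF V lin] fin_dim_subset[OF fd] by (auto simp: N_def)
  show "\<exists>r. r \<in> V \<and> (\<forall>x\<in>V. f x = ip x r)"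
  proof (cases "N = V")
    case True
    then show ?thesis
      using complex_vector.subspace_0[OF V] ip_zero_right[OF V ip] 
      by (intro exI[of _ 0]) (auto simp: N_def)
  next
    case False
    then obtain a where a: "a \<in> V" "f a \<noteq> 0" by (auto simp: N_def)
    obtain p where p: "p \<in> N" "\<And>y. y \<in> N \<Longrightarrow> ip (a - p) y = 0"
      using projection_exists[OF V ip N a(1)] by auto
    define d where "d = a - p"
    have pV: "p \<in> V" using p N by auto
    have d: "d \<in> V" "f d \<noteq> 0"
      using clinear_on_diff[OF lin V a(1) pV] a p(1) complex_vector.subspace_diff[OF V a(1) pV]
      by (auto simp: d_def N_def)
    have "d \<noteq> 0" using d clinear_on_zero[OF lin complex_vector.subspace_0[OF V]] by auto
    then have dd: "ip d d \<noteq> 0" using ip_eq_zero_imp[OF V ip d(1)] by auto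
    have ddr: "cnj (ip d d) = ip d d" using inner_product_onD(2)[OF ip d(1) d(1)] by (rule sym)
    \<comment> \<open>The factor is forced by taking \<open>x = d\<close>; it is conjugated because
      \<open>ip\<close> is antilinear in its second argument.\<close>
    show ?thesis
    proof (intro exI[of _ "(cnj (f d) / ip d d) *\<^sub>C d"] conjI ballI)
      show "(cnj (f d) / ip d d) *\<^sub>C d \<in> V"
        using d complex_vector.subspace_scale[OF V] by blast
      fix x assume x: "x \<in> V"
      have sc: "(f x / f d) *\<^sub>C d \<in> V" using d complex_vector.subspace_scale[OF V] by blast
      have "x - (f x / f d) *\<^sub>C d \<in> N"
        using d x clinear_on_diff[OF lin V x sc] cdual_scale[OF f d(1)]
          complex_vector.subspace_diff[OF V x sc] by (simp add: N_def)
      then have "ip d (x - (f x / f d) *\<^sub>C d) = 0" "x - (f x / f d) *\<^sub>C d \<in> V"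
        using p(2) N by (auto simp: d_def)
      then have "ip (x - (f x / f d) *\<^sub>C d) d = 0"
        using inner_product_onD(2)[OF ip d(1), of "x - (f x / f d) *\<^sub>C d"] by simp
      then have "ip x d = f x / f d * ip d d"
        using ip_diff_left[OF V ip x sc d(1)] ip_scale_left[OF ip d(1) d(1)] by simp
      then show "f x = ip x ((cnj (f d) / ip d d) *\<^sub>C d)"
        using d dd ddr by (simp add: ip_scale_right[OF V ip d(1) x])
    qed
  qed
next
  fix r s
  assume "r \<in> V \<and> (\<forall>x\<in>V. f x = ip x r)" "s \<in> V \<and> (\<forall>x\<in>V. f x = ip x s)"
  then have rs: "r \<in> V" "s \<in> V" "\<And>x. x \<in> V \<Longrightarrow> ip x r = ip x s" by auto
  have m: "r - s \<in> V" using rs complex_vector.subspace_diff[OF V] by blast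
  then have "ip (r - s) (r - s) = 0"
    using ip_diff_right[OF V ip rs(1,2) m] rs by simp
  then show "r = s" using ip_eq_zero_imp[OF V ip m] by simp
qed

context
  fixes V :: "'a::complex_vector set" and ip :: "'a \<Rightarrow> 'a \<Rightarrow> complex"
  assumes V: "complex_vector.subspace V" and fd: "fin_dim V" and ip: "inner_product_on V ip"
begin

lemma riesz_rep:
  assumes "f \<in> cdual V"
  shows "riesz_rep V ip f \<in> V" "x \<in> V \<Longrightarrow> f x = ip x (riesz_rep V ip f)"
  using theI'[OF riesz_exists[OF V fd ip assms]] by (auto simp: riesz_rep_def)

text \<open>Translates orthogonality in the dual into vanishing at a vector of \<open>V\<close>;
  this is how annihilators enter the range argument below.\<close>

lemma dual_ip_apply:
  assumes "f \<in> cdual V" "g \<in> cdual V"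
  shows "dual_ip V ip f g = f (riesz_rep V ip g)"
  using riesz_rep assms by (simp add: dual_ip_def)

lemma inner_product_dual: "inner_product_on (cdual V) (dual_ip V ip)"
  unfolding inner_product_on_def
proof (intro conjI ballI impI)
  fix g assume g: "g \<in> cdual V"
  show "clinear_on (cdual V) (\<lambda>f. dual_ip V ip f g)"
    using g complex_vector.subspace_add[OF subspace_cdual[of V]]
      complex_vector.subspace_scale[OF subspace_cdual[of V]]
    by (simp add: clinear_on_def dual_ip_apply scaleC_complex_def)
next
  fix f g assume "f \<in> cdual V" "g \<in> cdual V"
  then show "dual_ip V ip g f = cnj (dual_ip V ip f g)"
    unfolding dual_ip_def using inner_product_onD(2)[OF ip] riesz_rep(1) by blast
next
  fix f assume f: "f \<in> cdual V" "f \<noteq> 0"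
  have "riesz_rep V ip f \<noteq> 0"
  proof
    assume "riesz_rep V ip f = 0"
    then have "f x = 0" for x
      using riesz_rep(2)[OF f(1)] ip_zero_right[OF V ip] cdualD(2)[OF f(1)] by (cases "x \<in> V") auto
    then show False using f(2) by auto
  qed
  then show "Re (dual_ip V ip f f) > 0"
    using inner_product_onD(3)[OF ip] riesz_rep(1)[OF f(1)] by (simp add: dual_ip_def)
qed

end

section \<open>Existence and uniqueness of the pseudo-inverse\<close>

text \<open>Serves to give \<open>moore_penrose\<close> a meaning: the description by
  \<open>THE\<close> says nothing until exactly one map is known to satisfy the Penrose
  equations.\<close>

locale pseudo_inverse =
  fixes V :: "'a::complex_vector set" and ipV :: "'a \<Rightarrow> 'a \<Rightarrow> complex"
    and W :: "'b::complex_vector set" and ipW :: "'b \<Rightarrow> 'b \<Rightarrow> complex" and M :: "'a \<Rightarrow> 'b"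
  assumes V: "complex_vector.subspace V" and fd: "fin_dim V" and ipV: "inner_product_on V ipV"
    and W: "complex_vector.subspace W" and ipW: "inner_product_on W ipW"
    and M: "clinear_on V M" "M ` V \<subseteq> W"
begin

text \<open>\<open>u\<close> is the least-squares solution of \<open>M u = w\<close> of minimal norm.\<close>

definition least_squares :: "'b \<Rightarrow> 'a \<Rightarrow> bool"
  where "least_squares w u \<longleftrightarrow> u \<in> V \<and> (\<forall>n\<in>V. M n = 0 \<longrightarrow> ipV u n = 0) \<and>
    (\<forall>v\<in>V. ipW (w - M u) (M v) = 0)"

text \<open>Project \<open>w\<close> onto the range of \<open>M\<close>, choose a preimage, and
  subtract the projection of that preimage onto the kernel; the subtraction does not change the
  image.\<close>

lemma least_squares_exists:
  assumes w: "w \<in> W"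
  shows "\<exists>u. least_squares w u"
proof -
  obtain r where r: "r \<in> M ` V" "\<And>y. y \<in> M ` V \<Longrightarrow> ipW (w - r) y = 0"
    using projection_exists[OF W ipW subspace_image[OF V M(1)] fin_dim_image[OF V fd M(1)] M(2) w]
    by auto
  obtain v where v: "v \<in> V" "r = M v" using r by auto
  obtain n where n: "n \<in> V" "M n = 0" "\<And>y. y \<in> V \<Longrightarrow> M y = 0 \<Longrightarrow> ipV (v - n) y = 0"
    using projection_exists[OF V ipV subspace_kernel[OF V M(1)] fin_dim_subset[OF fd] _ v(1)]
    by auto
  have "M (v - n) = r" using clinear_on_diff[OF M(1) V v(1) n(1)] v n by simp
  then have "least_squares w (v - n)"
    unfolding least_squares_def using n r complex_vector.subspace_diff[OF V v(1) n(1)] by auto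
  then show ?thesis ..
qed

text \<open>For the difference \<open>d\<close> of two solutions, \<open>M d\<close> is a difference
  of residuals, so it is orthogonal to the range and also in it. Hence \<open>d\<close> is in the
  kernel, and it is orthogonal to the kernel too.\<close>

lemma least_squares_unique:
  assumes w: "w \<in> W" and u: "least_squares w u" and v: "least_squares w v"
  shows "u = v"
proof -
  have uv: "u \<in> V" "v \<in> V" using u v by (auto simp: least_squares_def)
  define d where "d = u - v"
  have d: "d \<in> V" using complex_vector.subspace_diff[OF V uv] by (simp add: d_def)
  have mem: "M u \<in> W" "M v \<in> W" "M d \<in> W" using M(2) uv d by auto
  then have mem': "w - M u \<in> W" "w - M v \<in> W"
    using complex_vector.subspace_diff[OF W w] by auto
  have Md: "M d = (w - M v) - (w - M u)"
    using clinear_on_diff[OF M(1) V uv] by (simp add: d_def)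
  then have "ipW (M d) (M d) = ipW ((w - M v) - (w - M u)) (M d)" by simp
  also have "\<dots> = ipW (w - M v) (M d) - ipW (w - M u) (M d)"
    by (rule ip_diff_left[OF W ipW mem'(2,1) mem(3)])
  also have "\<dots> = 0" using u v d by (auto simp: least_squares_def)
  finally have "M d = 0" using ip_eq_zero_imp[OF W ipW mem(3)] by simp
  then have "ipV d d = 0"
    using ip_diff_left[OF V ipV uv d] u v d by (auto simp: least_squares_def d_def)
  then show ?thesis using ip_eq_zero_imp[OF V ipV d] by (simp add: d_def)
qed

text \<open>Each pair of Penrose equations gives one orthogonality. \<open>X w = X (M (X w))\<close>
  and the symmetry of \<open>X M\<close> move the operator onto a kernel element, where it gives 0;
  the symmetry of \<open>M X\<close> and \<open>M X M = M\<close> give \<open>w\<close> and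
  \<open>M (X w)\<close> the same product with every \<open>M v\<close>.\<close>

lemma moore_penrose_least_squares:
  assumes X: "is_moore_penrose V ipV W ipW M X" and w: "w \<in> W"
  shows "least_squares w (X w)"
proof -
  have lin: "clinear_on W X" "X ` W \<subseteq> V" using X by (auto simp: is_moore_penrose_def lin_maps_def)
  have Xw: "X w \<in> V" using lin w by auto
  have MX: "M (X w) \<in> W" using Xw M(2) by auto
  have "ipV (X w) n = 0" if n: "n \<in> V" "M n = 0" for n
  proof -
    have "ipV (X (M (X w))) n = ipV (X w) (X (M n))"
      using X Xw n by (auto simp: is_moore_penrose_def)
    also have "X (M n) = 0" using n clinear_on_zero[OF lin(1) complex_vector.subspace_0[OF W]] by simp
    finally show ?thesis
      using X w ip_zero_right[OF V ipV Xw] by (auto simp: is_moore_penrose_def)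
  qed
  moreover have "ipW (w - M (X w)) (M v) = 0" if v: "v \<in> V" for v
  proof -
    have Mv: "M v \<in> W" using v M by auto
    have "ipW (M (X w)) (M v) = ipW w (M v)"
      using X v w Mv by (auto simp: is_moore_penrose_def)
    then show ?thesis using ip_diff_left[OF W ipW w MX Mv] by simp
  qed
  ultimately show ?thesis using Xw by (auto simp: least_squares_def)
qed

definition pinv :: "'b \<Rightarrow> 'a"
  where "pinv w = (if w \<in> W then (SOME u. least_squares w u) else 0)"

lemma pinv: "w \<in> W \<Longrightarrow> least_squares w (pinv w)"
  unfolding pinv_def using someI_ex[OF least_squares_exists] by simp

lemma pinv_eq: "w \<in> W \<Longrightarrow> least_squares w u \<Longrightarrow> pinv w = u"
  using least_squares_unique pinv by blast

lemma pinv_in: "w \<in> W \<Longrightarrow> pinv w \<in> V"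
  using pinv by (auto simp: least_squares_def)

text \<open>The conditions on a least-squares solution are linear in the pair of datum and solution,
  so linearity of the choice follows from uniqueness.\<close>

lemma pinv_linear: "pinv \<in> lin_maps W V"
proof -
  have "pinv (w + z) = pinv w + pinv z" if wz: "w \<in> W" "z \<in> W" for w z
  proof (rule pinv_eq)
    let ?u = "pinv w" and ?v = "pinv z"
    show "w + z \<in> W" using wz complex_vector.subspace_add[OF W] by blast
    have uv: "?u \<in> V" "?v \<in> V" using wz pinv_in by auto
    have mem: "w - M ?u \<in> W" "z - M ?v \<in> W"
      using uv wz M(2) complex_vector.subspace_diff[OF W] by (metis image_subset_iff)+
    have E: "w + z - M (?u + ?v) = (w - M ?u) + (z - M ?v)"
      using clinear_onD(1)[OF M(1) uv] by simp
    have "M v \<in> W" if "v \<in> V" for v using M(2) that by auto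
    then have "ipW (w + z - M (?u + ?v)) (M v) = 0" if "v \<in> V" for v
      unfolding E using pinv[OF wz(1)] pinv[OF wz(2)] that
      by (simp add: least_squares_def ip_add_left[OF ipW mem])
    then show "least_squares (w + z) (?u + ?v)"
      using pinv[OF wz(1)] pinv[OF wz(2)] complex_vector.subspace_add[OF V uv]
      by (auto simp: least_squares_def ip_add_left[OF ipV])
  qed
  moreover have "pinv (c *\<^sub>C w) = c *\<^sub>C pinv w" if w: "w \<in> W" for c w
  proof (rule pinv_eq)
    let ?u = "pinv w"
    show "c *\<^sub>C w \<in> W" using w complex_vector.subspace_scale[OF W] by blast
    have u: "?u \<in> V" using w pinv_in by auto
    have mem: "w - M ?u \<in> W"
      using u w M(2) complex_vector.subspace_diff[OF W] by (metis image_subset_iff)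
    have E: "c *\<^sub>C w - M (c *\<^sub>C ?u) = c *\<^sub>C (w - M ?u)"
      using clinear_onD(2)[OF M(1) u] by (simp add: complex_vector.scale_right_diff_distrib)
    have "M v \<in> W" if "v \<in> V" for v using M(2) that by auto
    then have "ipW (c *\<^sub>C w - M (c *\<^sub>C ?u)) (M v) = 0" if "v \<in> V" for v
      unfolding E using pinv[OF w] that by (simp add: least_squares_def ip_scale_left[OF ipW mem])
    then show "least_squares (c *\<^sub>C w) (c *\<^sub>C ?u)"
      using pinv[OF w] complex_vector.subspace_scale[OF V u]
      by (auto simp: least_squares_def ip_scale_left[OF ipV])
  qed
  ultimately show ?thesis
    using pinv_in by (auto simp: lin_maps_def clinear_on_def pinv_def)
qed

lemma is_moore_penrose_pinv: "is_moore_penrose V ipV W ipW M pinv"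
  unfolding is_moore_penrose_def
proof (intro conjI ballI)
  show "pinv \<in> lin_maps W V" by (rule pinv_linear)
  have MW: "M v \<in> W" if "v \<in> V" for v using M(2) that by auto
  show MXM: "M (pinv (M u)) = M u" if u: "u \<in> V" for u
  proof -
    have p: "pinv (M u) \<in> V" using pinv_in MW u by auto
    define d where "d = u - pinv (M u)"
    have d: "d \<in> V" using complex_vector.subspace_diff[OF V u p] by (simp add: d_def)
    have E: "M u - M (pinv (M u)) = M d" using clinear_on_diff[OF M(1) V u p] by (simp add: d_def)
    \<comment> \<open>The residual of the datum \<open>M u\<close> is itself \<open>M d\<close>, so
      it is orthogonal to itself.\<close>
    have "ipW (M u - M (pinv (M u))) (M d) = 0"
      using pinv[OF MW[OF u]] d unfolding least_squares_def by blast
    then show ?thesis using ip_eq_zero_imp[OF W ipW MW[OF d]] E by simp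
  qed
  show "pinv (M (pinv w)) = pinv w" if w: "w \<in> W" for w
  proof (rule pinv_eq)
    show "M (pinv w) \<in> W" using MW pinv_in w by auto
    show "least_squares (M (pinv w)) (pinv w)"
      using pinv[OF w] MW by (auto simp: least_squares_def ip_zero_left[OF W ipW])
  qed
  show "ipW (M (pinv w)) z = ipW w (M (pinv z))" if wz: "w \<in> W" "z \<in> W" for w z
  proof -
    have mem: "M (pinv w) \<in> W" "M (pinv z) \<in> W" using wz pinv_in MW by auto
    have "ipW (w - M (pinv w)) (M (pinv z)) = 0" "ipW (z - M (pinv z)) (M (pinv w)) = 0"
      using pinv[OF wz(1)] pinv[OF wz(2)] pinv_in wz by (auto simp: least_squares_def)
    then have "ipW w (M (pinv z)) = ipW (M (pinv w)) (M (pinv z))"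
        "ipW z (M (pinv w)) = ipW (M (pinv z)) (M (pinv w))"
      using ip_diff_left[OF W ipW] wz mem by auto
    then show ?thesis using inner_product_onD(2)[OF ipW] wz mem by metis
  qed
  show "ipV (pinv (M u)) v = ipV u (pinv (M v))" if uv: "u \<in> V" "v \<in> V" for u v
  proof -
    \<comment> \<open>\<open>y - pinv (M y)\<close> lies in the kernel, to which all values of
      \<open>pinv\<close> are orthogonal; thus \<open>pinv\<close> after \<open>M\<close> is an
      orthogonal projection, and symmetry follows.\<close>
    have orth: "ipV (pinv (M x)) (y - pinv (M y)) = 0" if "x \<in> V" "y \<in> V" for x y
    proof -
      have p: "pinv (M y) \<in> V" using pinv_in MW that by auto
      have "M (y - pinv (M y)) = 0" using clinear_on_diff[OF M(1) V that(2) p] MXM that by simp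
      then show ?thesis
        using pinv[OF MW[OF that(1)]] complex_vector.subspace_diff[OF V that(2) p]
        by (auto simp: least_squares_def)
    qed
    have mem: "pinv (M u) \<in> V" "pinv (M v) \<in> V" using uv pinv_in MW by auto
    have "ipV (pinv (M u)) v = ipV (pinv (M u)) (pinv (M v))"
        "ipV (pinv (M v)) u = ipV (pinv (M v)) (pinv (M u))"
      using orth[OF uv] orth[OF uv(2,1)] ip_diff_right[OF V ipV] uv mem by auto
    then show ?thesis using inner_product_onD(2)[OF ipV] uv mem by metis
  qed
qed

lemma is_moore_penrose_moore_penrose:
  "is_moore_penrose V ipV W ipW M (moore_penrose V ipV W ipW M)"
  unfolding moore_penrose_def
proof (rule theI[where P = "is_moore_penrose V ipV W ipW M" and a = pinv])
  show "is_moore_penrose V ipV W ipW M pinv" by (rule is_moore_penrose_pinv)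
  fix X assume X: "is_moore_penrose V ipV W ipW M X"
  show "X = pinv"
  proof
    fix w show "X w = pinv w"
    proof (cases "w \<in> W")
      case True
      then show ?thesis using moore_penrose_least_squares[OF X] pinv_eq by metis
    next
      case False
      then show ?thesis using X by (auto simp: is_moore_penrose_def lin_maps_def pinv_def)
    qed
  qed
qed

end


section \<open>The abstract scattering operator\<close>

text \<open>The discrete problem stripped of its function spaces. A conjugation is given on
  \<open>W\<close>, where \<open>T\<close> refers to it; the one on \<open>V\<close> enters with
  dissipativity.\<close>

locale scattering_problem =
  fixes V :: "'a::complex_vector set" and W :: "'b::complex_vector set"
    and A :: "'a \<Rightarrow> 'a \<Rightarrow> complex" and B :: "'a \<Rightarrow> 'b" and T :: "'b \<Rightarrow> 'b \<Rightarrow> complex"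
    and c :: "'b \<Rightarrow> 'b" and ip :: "'a \<Rightarrow> 'a \<Rightarrow> complex"
  assumes V: "complex_vector.subspace V" and fdV: "fin_dim V"
    and W: "complex_vector.subspace W" and fdW: "fin_dim W"
    and A: "clinear_on V A" "\<And>u. u \<in> V \<Longrightarrow> A u \<in> cdual V"
    and B: "clinear_on V B" "\<And>u. u \<in> V \<Longrightarrow> B u \<in> W"
    and T: "impedance_op W c T"
    and c_in: "\<And>x. x \<in> W \<Longrightarrow> c x \<in> W" and c_add: "\<And>x y. c (x + y) = c x + c y"
    and c_scale: "\<And>a x. c (a *\<^sub>C x) = cnj a *\<^sub>C c x" and c_c: "\<And>x. c (c x) = x"
    and ip: "inner_product_on V ip"
begin

abbreviation Bt :: "('b \<Rightarrow> complex) \<Rightarrow> 'a \<Rightarrow> complex"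
  where "Bt \<equiv> transpose_on V B"

definition M :: "'a \<Rightarrow> 'a \<Rightarrow> complex"
  where "M u = A u - \<i> *\<^sub>C Bt (T (B u))"

definition Mdag :: "('a \<Rightarrow> complex) \<Rightarrow> 'a"
  where "Mdag = moore_penrose V ip (cdual V) (dual_ip V ip) M"

lemma T_in: "u \<in> W \<Longrightarrow> T u \<in> cdual W"
  and T_lin: "clinear_on W T"
  using T by (auto simp: impedance_op_def lin_maps_def)

lemma T_sym: "u \<in> W \<Longrightarrow> x \<in> W \<Longrightarrow> T u x = T x u"
proof -
  assume u: "u \<in> W" and x: "x \<in> W"
  have "transpose_on W T (\<lambda>p. p u) = T u" 
    by (rule T[unfolded impedance_op_def, THEN conjunct2, THEN conjunct1, rule_format, OF u])
  then have "transpose_on W T (\<lambda>p. p u) x = T u x" by (rule fun_cong)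
  then show ?thesis using x by (simp add: transpose_on_def)
qed

lemma T_conj: "u \<in> W \<Longrightarrow> T (c u) x = cnj (T u (c x))"
proof -
  assume u: "u \<in> W"
  have "T (c u) = dual_conj c (T u)" 
    by (rule T[unfolded impedance_op_def, THEN conjunct2, THEN conjunct2, THEN conjunct1,
        rule_format, OF u])
  then show ?thesis by (simp add: dual_conj_def)
qed

lemma T_pos: "u \<in> W \<Longrightarrow> u \<noteq> 0 \<Longrightarrow> Im (T u (c u)) = 0 \<and> Re (T u (c u)) > 0"
  using T[unfolded impedance_op_def, THEN conjunct2, THEN conjunct2, THEN conjunct2, rule_format]
  by (auto simp: complex_is_Real_iff)

lemma c_zero: "c 0 = 0"
  using c_scale[of 0 0] by simp

lemma T_zero: "T 0 = 0"
  using clinear_on_zero[OF T_lin complex_vector.subspace_0[OF W]] .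

lemma T_nonneg: "u \<in> W \<Longrightarrow> Im (T u (c u)) = 0 \<and> Re (T u (c u)) \<ge> 0"
  using T_pos[of u] by (cases "u = 0") (auto simp: T_zero)

lemma T_add: "u \<in> W \<Longrightarrow> v \<in> W \<Longrightarrow> T (u + v) = T u + T v"
  and T_scale: "u \<in> W \<Longrightarrow> T (a *\<^sub>C u) = a *\<^sub>C T u"
  using clinear_onD[OF T_lin] by auto

lemma T_add': "w \<in> W \<Longrightarrow> u \<in> W \<Longrightarrow> v \<in> W \<Longrightarrow> T w (u + v) = T w u + T w v"
  and T_scale': "w \<in> W \<Longrightarrow> u \<in> W \<Longrightarrow> T w (a *\<^sub>C u) = a * T w u"
  using cdual_add[OF T_in] cdual_scale[OF T_in] by auto

text \<open>\<open>T u (c v)\<close> is an inner product of \<open>u\<close> and \<open>v\<close> on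
  \<open>W\<close>, so this is the Riesz theorem. By the symmetry of \<open>T\<close>, the conjugate
  of the representing vector is the preimage.\<close>

lemma T_surj:
  assumes q: "q \<in> cdual W"
  obtains w where "w \<in> W" "T w = q"
proof -
  have "inner_product_on W (\<lambda>u v. T u (c v))"
    unfolding inner_product_on_def
  proof (intro conjI ballI impI)
    show "clinear_on W (\<lambda>x. T x (c y))" for y
      using T_lin by (simp add: clinear_on_def scaleC_complex_def)
    show "T y (c x) = cnj (T x (c y))" if xy: "x \<in> W" "y \<in> W" for x y
      using T_conj[OF xy(1), of y] T_sym[OF xy(2) c_in[OF xy(1)]] by simp
    show "Re (T x (c x)) > 0" if "x \<in> W" "x \<noteq> 0" for x using T_pos that by blast
  qed
  from riesz_exists[OF W fdW this q] obtain r where r: "r \<in> W" "\<forall>x\<in>W. q x = T x (c r)"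
    by blast
  have "T (c r) x = q x" for x
    using r T_sym[OF _ c_in[OF r(1)], of x] cdualD(2)[OF q, of x]
      cdualD(2)[OF T_in[OF c_in[OF r(1)]], of x] by (cases "x \<in> W") auto
  then show thesis using that[of "c r"] c_in[OF r(1)] by blast
qed

lemma T_inj: "inj_on T W"
proof (rule inj_onI)
  fix u v assume uv: "u \<in> W" "v \<in> W" "T u = T v"
  have d: "u - v \<in> W" using complex_vector.subspace_diff[OF W uv(1,2)] .
  have "T (u - v) = 0" using clinear_on_diff[OF T_lin W uv(1,2)] uv(3) by simp
  then show "u = v" using T_pos[OF d] by auto
qed

text \<open>Injectivity makes \<open>inv_into\<close> return \<open>u\<close> itself. Norms of
  functionals become energies of vectors, and later computations take place in
  \<open>W\<close>.\<close>

lemma inv_norm_T: "u \<in> W \<Longrightarrow> inv_norm W c T (T u) = sqrt (Re (T u (c u)))"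
  by (simp add: inv_norm_def dual_conj_def inv_into_f_f[OF T_inj])

lemma Bt_in: "p \<in> cdual W \<Longrightarrow> Bt p \<in> cdual V"
  by (rule cdualI)
    (auto simp: transpose_on_def clinear_onD[OF B(1)] cdual_add cdual_scale B(2)
      complex_vector.subspace_add[OF V] complex_vector.subspace_scale[OF V])

lemma Bt_add: "Bt (p + q) = Bt p + Bt q"
  and Bt_scale: "Bt (a *\<^sub>C p) = a *\<^sub>C Bt p"
  by (auto simp: transpose_on_def fun_eq_iff)

lemma M_apply: "u \<in> V \<Longrightarrow> z \<in> V \<Longrightarrow> M u z = A u z - \<i> * T (B u) (B z)"
  by (simp add: M_def transpose_on_def)

lemma M_in: "u \<in> V \<Longrightarrow> M u \<in> cdual V"
  unfolding M_def
  by (intro complex_vector.subspace_diff[OF subspace_cdual]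
      complex_vector.subspace_scale[OF subspace_cdual] A(2) Bt_in T_in B(2))

lemma M_lin: "clinear_on V M"
  unfolding clinear_on_def M_def
  by (auto simp: clinear_onD[OF A(1)] clinear_onD[OF B(1)] T_add T_scale B(2) Bt_add Bt_scale
      complex_vector.scale_right_distrib complex_vector.scale_right_diff_distrib
      complex_vector.scale_left_commute)

sublocale pinv: pseudo_inverse V ip "cdual V" "dual_ip V ip" M
  using V fdV ip subspace_cdual inner_product_dual[OF V fdV ip] M_lin M_in
  by unfold_locales auto

text \<open>The third fact is the contact with solvability: for \<open>f\<close> in the range of
  \<open>M\<close>, it makes \<open>Mdag f\<close> a solution of \<open>M u = f\<close>.\<close>

lemma Mdag_lin: "clinear_on (cdual V) Mdag"
  and Mdag_in: "f \<in> cdual V \<Longrightarrow> Mdag f \<in> V"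
  and M_Mdag_M: "u \<in> V \<Longrightarrow> M (Mdag (M u)) = M u"
  using pinv.is_moore_penrose_moore_penrose
  by (auto simp: is_moore_penrose_def lin_maps_def Mdag_def)

section \<open>Characterisation of the scattering operator by range and kernel conditions\<close>

text \<open>The value 0 off the dual is the convention of \<open>lin_maps\<close>; it lets
  uniqueness of the operator be equality of functions.\<close>

definition scatter :: "('b \<Rightarrow> complex) \<Rightarrow> 'b \<Rightarrow> complex"
  where "scatter q = (if q \<in> cdual W then q + (2 * \<i>) *\<^sub>C T (B (Mdag (Bt q))) else 0)"

lemma scatter_linear: "scatter \<in> lin_maps (cdual W) (cdual W)"
proof -
  note S = subspace_cdual[of W]
  have "clinear_on (cdual W) scatter"
    unfolding clinear_on_def scatter_def
    by (auto simp: Bt_add Bt_scale clinear_onD[OF Mdag_lin] clinear_onD[OF B(1)] T_add T_scale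
      Bt_in Mdag_in B(2) complex_vector.subspace_add[OF S] complex_vector.subspace_scale[OF S]
      complex_vector.scale_right_distrib complex_vector.scale_left_commute)
  then show ?thesis
    unfolding lin_maps_def scatter_def
    by (auto intro!: complex_vector.subspace_add[OF S] complex_vector.subspace_scale[OF S] T_in
        B(2) Mdag_in Bt_in)
qed

lemma scattering:
  assumes range: "\<And>q. q \<in> cdual W \<Longrightarrow> Bt q \<in> M ` V"
    and kernel: "\<And>u. u \<in> V \<Longrightarrow> M u = 0 \<Longrightarrow> B u = 0"
  shows "is_scattering W T (cauchy_data V W A B) S \<longleftrightarrow> S = scatter"
proof -
  have sol: "M (Mdag (Bt q)) = Bt q" if "q \<in> cdual W" for q
    using range[OF that] M_Mdag_M by auto
  have AM: "A u = Bt p \<longleftrightarrow> M u = Bt (p - \<i> *\<^sub>C T (B u))" for u p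
    by (auto simp: M_def fun_eq_iff transpose_on_def)
  note S = subspace_cdual[of W]
  show ?thesis
  proof
    assume S': "is_scattering W T (cauchy_data V W A B) S"
    show "S = scatter"
    proof
      fix q show "S q = scatter q"
      proof (cases "q \<in> cdual W")
        case True
        define u where "u = Mdag (Bt q)"
        have u: "u \<in> V" using True by (simp add: u_def Mdag_in Bt_in)
        \<comment> \<open>With this \<open>p\<close>, the given \<open>q\<close> is the incoming
          part of the Cauchy datum \<open>(B u, p)\<close>. So every \<open>q\<close> arises from a
          datum, which determines \<open>S\<close> everywhere.\<close>
        define p where "p = q + \<i> *\<^sub>C T (B u)"
        have q: "p - \<i> *\<^sub>C T (B u) = q" by (simp add: p_def)
        have "p \<in> cdual W"
          unfolding p_def by (intro complex_vector.subspace_add[OF S]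
              complex_vector.subspace_scale[OF S] True T_in B(2) u)
        then have "(B u, p) \<in> cauchy_data V W A B"
          unfolding cauchy_data_def using u sol[OF True] AM[of u p] q by (auto simp: u_def)
        then have "p + \<i> *\<^sub>C T (B u) = S (p - \<i> *\<^sub>C T (B u))"
          using S' unfolding is_scattering_def by blast
        then have "S q = p + \<i> *\<^sub>C T (B u)" unfolding q by simp
        also have "\<dots> = scatter q"
          using True by (simp add: scatter_def p_def u_def fun_eq_iff)
        finally show ?thesis .
      next
        case False
        then show ?thesis using S' by (auto simp: is_scattering_def lin_maps_def scatter_def)
      qed
    qed
  next
    assume "S = scatter"
    moreover have "p + \<i> *\<^sub>C T (B u) = scatter (p - \<i> *\<^sub>C T (B u))"
      if u: "u \<in> V" and p: "p \<in> cdual W" and eq: "A u = Bt p" for u p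
    proof -
      define q where "q = p - \<i> *\<^sub>C T (B u)"
      have q: "q \<in> cdual W"
        unfolding q_def by (intro complex_vector.subspace_diff[OF S]
            complex_vector.subspace_scale[OF S] p T_in B(2) u)
      \<comment> \<open>The given \<open>u\<close> need not be the solution selected by the
        pseudo-inverse; the two differ by a kernel element, whose trace vanishes.\<close>
      define v where "v = Mdag (Bt q)"
      have v: "v \<in> V" using q by (simp add: v_def Mdag_in Bt_in)
      have "M u = M v" using AM[of u p] eq sol[OF q] by (simp add: q_def v_def)
      then have "B (u - v) = 0"
        using kernel[OF complex_vector.subspace_diff[OF V u v]] clinear_on_diff[OF M_lin V u v]
        by simp
      then have "B v = B u" using clinear_on_diff[OF B(1) V u v] by simp
      then have "scatter q = q + (2 * \<i>) *\<^sub>C T (B u)" using q by (simp add: scatter_def v_def)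
      then show ?thesis by (simp add: q_def fun_eq_iff)
    qed
    ultimately show "is_scattering W T (cauchy_data V W A B) S"
      using scatter_linear by (auto simp: is_scattering_def cauchy_data_def)
  qed
qed

lemma bij_range_kernel:
  assumes "bij_betw M V (cdual V)"
  shows "q \<in> cdual W \<Longrightarrow> Bt q \<in> M ` V" and "u \<in> V \<Longrightarrow> M u = 0 \<Longrightarrow> B u = 0"
proof -
  show "q \<in> cdual W \<Longrightarrow> Bt q \<in> M ` V" using assms Bt_in by (auto simp: bij_betw_def)
  assume "u \<in> V" "M u = 0"
  moreover have "M 0 = 0" using clinear_on_zero[OF M_lin complex_vector.subspace_0[OF V]] .
  ultimately have "u = 0"
    using assms complex_vector.subspace_0[OF V] by (metis bij_betw_def inj_onD)
  then show "B u = 0" using clinear_on_zero[OF B(1) complex_vector.subspace_0[OF V]] by simp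
qed

end

section \<open>The dissipative case: solvability, energy identity and contraction\<close>

locale dissipative_scattering_problem = scattering_problem +
  fixes cV :: "'a \<Rightarrow> 'a"
  assumes cV_in: "\<And>u. u \<in> V \<Longrightarrow> cV u \<in> V" and cV_cV: "\<And>u. cV (cV u) = u"
    and B_cV: "\<And>u. u \<in> V \<Longrightarrow> B (cV u) = c (B u)"
    and dissipation: "\<And>u. u \<in> V \<Longrightarrow> Im (A u (cV u)) \<le> 0"
begin

text \<open>The vanishing value equates \<open>A u (cV u)\<close> with \<open>\<i>\<close> times the
  energy of \<open>B u\<close>, whose imaginary part would be positive. Assuming one value of
  \<open>M u\<close> rather than \<open>M u = 0\<close> lets the lemma serve both the kernel and the
  annihilator of the range.\<close>

lemma trace_zero:
  assumes u: "u \<in> V" and "M u (cV u) = 0"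
  shows "B u = 0"
proof (rule ccontr)
  assume "B u \<noteq> 0"
  then have "Im (\<i> * T (B u) (B (cV u))) > 0"
    using T_pos[OF B(2)[OF u]] by (simp add: B_cV[OF u])
  moreover have "A u (cV u) = \<i> * T (B u) (B (cV u))"
    using assms by (simp add: M_apply cV_in)
  ultimately show False using dissipation[OF u] by simp
qed

lemma range:
  assumes q: "q \<in> cdual W"
  shows "Bt q \<in> M ` V"
proof -
  let ?d = "dual_ip V ip"
  note D = subspace_cdual[of V] and ipD = inner_product_dual[OF V fdV ip]
  have "M ` V \<subseteq> cdual V" using M_in by blast
  from projection_exists[OF D ipD subspace_image[OF V M_lin] fin_dim_image[OF V fdV M_lin] this
      Bt_in[OF q]]
  obtain r where r: "r \<in> M ` V" "\<And>y. y \<in> M ` V \<Longrightarrow> ?d (Bt q - r) y = 0" by blast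
  define g where "g = Bt q - r"
  have rD: "r \<in> cdual V" using r(1) M_in by blast
  have g: "g \<in> cdual V" unfolding g_def by (rule complex_vector.subspace_diff[OF D Bt_in[OF q] rD])
  \<comment> \<open>\<open>g\<close> is the component of \<open>Bt q\<close> orthogonal to the range
    of \<open>M\<close>; its representing vector \<open>w\<close> is therefore annihilated by that
    range.\<close>
  define w where "w = riesz_rep V ip g"
  have w: "w \<in> V" using riesz_rep(1)[OF V fdV ip g] by (simp add: w_def)
  have Mw: "M u w = 0" if u: "u \<in> V" for u
    using r(2)[of "M u"] u dual_ip_apply[OF V fdV ip M_in[OF u] g]
      inner_product_onD(2)[OF ipD g M_in[OF u]] by (simp add: w_def g_def)
  \<comment> \<open>The preceding lemma applied to \<open>cV w\<close>: the value it asks for is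
    that of \<open>M (cV w)\<close> at \<open>cV (cV w) = w\<close>.\<close>
  have "B (cV w) = 0"
    using trace_zero[OF cV_in[OF w]] Mw[OF cV_in[OF w]] by (simp add: cV_cV)
  then have "c (B w) = 0" using B_cV[OF w] by simp
  then have "B w = 0" using c_c[of "B w"] c_zero by simp
  then have "Bt q w = 0"
    using cdual_scale[OF q complex_vector.subspace_0[OF W], of 0] by (simp add: transpose_on_def)
  moreover have "r w = 0" using Mw r(1) by auto
  \<comment> \<open>The value of \<open>g\<close> at its own representing vector is its squared dual
    norm, so \<open>Bt q\<close> equals its projection \<open>r\<close>.\<close>
  ultimately have "g w = 0" by (simp add: g_def)
  then have "?d g g = 0" using dual_ip_apply[OF V fdV ip g g] by (simp add: w_def)
  then have "g = 0" using ip_eq_zero_imp[OF D ipD g] by simp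
  then show ?thesis using r(1) by (simp add: g_def)
qed

lemma kernel: "u \<in> V \<Longrightarrow> M u = 0 \<Longrightarrow> B u = 0"
  by (rule trace_zero) auto

lemma energy:
  assumes q: "q \<in> cdual W" and u: "u = Mdag (Bt q)"
  shows "(inv_norm W c T (scatter q))\<^sup>2 - 4 * Im (A u (cV u)) = (inv_norm W c T q)\<^sup>2"
proof -
  obtain w where w: "w \<in> W" "T w = q" using T_surj[OF q] .
  have uV: "u \<in> V" using q by (simp add: u Mdag_in Bt_in)
  define b where "b = B u"
  have b: "b \<in> W" using B(2)[OF uV] by (simp add: b_def)
  have sb: "(2 * \<i>) *\<^sub>C b \<in> W" "w + (2 * \<i>) *\<^sub>C b \<in> W"
    using w(1) b complex_vector.subspace_add[OF W] complex_vector.subspace_scale[OF W] by auto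
  have scb: "(- (2 * \<i>)) *\<^sub>C c b \<in> W" using c_in[OF b] complex_vector.subspace_scale[OF W] by blast
  have Mu: "M u = Bt q" using range[OF q] M_Mdag_M by (auto simp: u)
  \<comment> \<open>The equation \<open>M u = Bt q\<close> tested with \<open>cV u\<close>. Its
    imaginary part is Im \<open>T w (c b)\<close> = Im \<open>A u (cV u)\<close> - Re
    \<open>T b (c b)\<close>.\<close>
  have E: "T w (c b) = A u (cV u) - \<i> * T b (c b)"
    using fun_cong[OF Mu, of "cV u"] cV_in[OF uV]
    by (simp add: M_apply[OF uV] transpose_on_def B_cV[OF uV] b_def w(2))
  have E': "T b (c w) = cnj (T w (c b))"
    using T_conj[OF w(1), of b] T_sym[OF b c_in[OF w(1)]] by simp
  have S: "scatter q = T (w + (2 * \<i>) *\<^sub>C b)"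
    using q w sb b by (simp add: scatter_def T_add T_scale u b_def)
  have c_eq: "c (w + (2 * \<i>) *\<^sub>C b) = c w + (- (2 * \<i>)) *\<^sub>C c b"
    by (simp add: c_add c_scale)
  have X: "T v (c (w + (2 * \<i>) *\<^sub>C b)) = T v (c w) - 2 * \<i> * T v (c b)" if "v \<in> W" for v
    by (simp only: c_eq T_add'[OF that c_in[OF w(1)] scb] T_scale'[OF that c_in[OF b]]) simp
  \<comment> \<open>With z = \<open>T w (c b)\<close>, the cross terms add up to -2i(z - cnj z) = 4
    Im z. By \<open>E\<close> this is 4 Im \<open>A u (cV u)\<close> minus 4 Re
    \<open>T b (c b)\<close>, which cancels the last term.\<close>
  have "T (w + (2 * \<i>) *\<^sub>C b) (c (w + (2 * \<i>) *\<^sub>C b))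
      = T w (c w) - 2 * \<i> * T w (c b) + 2 * \<i> * T b (c w) + 4 * T b (c b)"
    using w(1) b sb(1) by (simp add: X T_add T_scale) (simp add: algebra_simps)
  then have "Re (T (w + (2 * \<i>) *\<^sub>C b) (c (w + (2 * \<i>) *\<^sub>C b)))
      = Re (T w (c w)) + 4 * Im (A u (cV u))"
    using T_nonneg[OF b] E E' by simp
  moreover have "(inv_norm W c T (T v))\<^sup>2 = Re (T v (c v))" if "v \<in> W" for v
    using T_nonneg[OF that] inv_norm_T[OF that] by simp
  ultimately show ?thesis using S sb(2) w by auto
qed

lemma contraction:
  assumes q: "q \<in> cdual W"
  shows "inv_norm W c T (scatter q) \<le> inv_norm W c T q"
proof (rule power2_le_imp_le)
  have "Mdag (Bt q) \<in> V" using q by (simp add: Mdag_in Bt_in)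
  then show "(inv_norm W c T (scatter q))\<^sup>2 \<le> (inv_norm W c T q)\<^sup>2"
    using energy[OF q refl] dissipation by fastforce
  obtain w where "w \<in> W" "T w = q" using T_surj[OF q] .
  then show "inv_norm W c T q \<ge> 0" using inv_norm_T T_nonneg by auto
qed

end

section \<open>Continuously differentiable functions\<close>

text \<open>The regularity required by \<open>test_fun\<close> without the support condition, so
  that factors depending on a single coordinate are covered.\<close>

definition c1_fun :: "('a::euclidean_space \<Rightarrow> real) \<Rightarrow> bool"
  where "c1_fun f \<longleftrightarrow>
    (\<exists>D. (\<forall>x. (f has_derivative (\<lambda>h. D x \<bullet> h)) (at x)) \<and> continuous_on UNIV D)"

lemma c1_fun_continuous: "c1_fun f \<Longrightarrow> continuous_on S f"
  unfolding c1_fun_def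
  by (meson continuous_at_imp_continuous_on has_derivative_continuous)

lemma c1_fun_const: "c1_fun (\<lambda>x. c)"
  unfolding c1_fun_def by (rule exI[of _ "\<lambda>x. 0"]) (auto simp: inner_zero_left[abs_def] has_derivative_const)

lemma c1_fun_mult:
  assumes f: "c1_fun f" and g: "c1_fun g"
  shows "c1_fun (\<lambda>x. f x * g x)"
proof -
  obtain D where D: "\<And>x. (f has_derivative (\<lambda>h. D x \<bullet> h)) (at x)" "continuous_on UNIV D"
    using f by (auto simp: c1_fun_def)
  obtain E where E: "\<And>x. (g has_derivative (\<lambda>h. E x \<bullet> h)) (at x)" "continuous_on UNIV E"
    using g by (auto simp: c1_fun_def)
  show ?thesis
    unfolding c1_fun_def
  proof (intro exI[of _ "\<lambda>x. f x *\<^sub>R E x + g x *\<^sub>R D x"] conjI allI)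
    show "((\<lambda>x. f x * g x) has_derivative (\<lambda>h. (f x *\<^sub>R E x + g x *\<^sub>R D x) \<bullet> h)) (at x)" for x
      by (rule has_derivative_eq_rhs[OF has_derivative_mult[OF D(1) E(1)]])
        (auto simp: inner_left_distrib algebra_simps)
    show "continuous_on UNIV (\<lambda>x. f x *\<^sub>R E x + g x *\<^sub>R D x)"
      using D(2) E(2) c1_fun_continuous[OF f] c1_fun_continuous[OF g]
      by (intro continuous_intros)
  qed
qed

lemma c1_fun_prod: "finite I \<Longrightarrow> (\<And>i. i \<in> I \<Longrightarrow> c1_fun (f i)) \<Longrightarrow> c1_fun (\<lambda>x. \<Prod>i\<in>I. f i x)"
  by (induction I rule: finite_induct) (auto intro: c1_fun_const c1_fun_mult)

lemma c1_fun_compose: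
  assumes f: "c1_fun f" and g: "\<And>t. (g has_real_derivative g' t) (at t)" "continuous_on UNIV g'"
  shows "c1_fun (\<lambda>x. g (f x))"
proof -
  obtain D where D: "\<And>x. (f has_derivative (\<lambda>h. D x \<bullet> h)) (at x)" "continuous_on UNIV D"
    using f by (auto simp: c1_fun_def)
  show ?thesis
    unfolding c1_fun_def
  proof (intro exI[of _ "\<lambda>x. g' (f x) *\<^sub>R D x"] conjI allI)
    show "((\<lambda>x. g (f x)) has_derivative (\<lambda>h. (g' (f x) *\<^sub>R D x) \<bullet> h)) (at x)" for x
      using has_derivative_compose[OF D(1) g(1)[unfolded has_field_derivative_def]] by simp
    show "continuous_on UNIV (\<lambda>x. g' (f x) *\<^sub>R D x)"
      using D(2) c1_fun_continuous[OF f, of UNIV] continuous_on_compose2[OF g(2), of UNIV f]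
      by (intro continuous_intros) auto
  qed
qed

section \<open>Bumps that approximate the indicator of a box\<close>

text \<open>A rational cutoff: the square of the positive part removes the kink at 0, and the
  quotient tends to 1 at infinity.\<close>

definition ramp :: "real \<Rightarrow> real"
  where "ramp t = (max 0 t)\<^sup>2 / (1 + (max 0 t)\<^sup>2)"

lemma ramp_bounds: "0 \<le> ramp t" "ramp t \<le> 1"
  using add_pos_nonneg[of 1 "(max 0 t)\<^sup>2"] by (auto simp: ramp_def)

lemma ramp_eq_0: "t \<le> 0 \<Longrightarrow> ramp t = 0"
  by (simp add: ramp_def)

lemma has_derivative_max_square: "((\<lambda>t. (max 0 t)\<^sup>2) has_real_derivative 2 * max 0 t) (at t)"
proof -
  consider "t > 0" | "t < 0" | "t = 0" by linarith
  then show ?thesis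
  proof cases
    case 1
    have "((\<lambda>t. t\<^sup>2) has_real_derivative 2 * max 0 t) (at t)"
      using 1 by (auto intro!: derivative_eq_intros)
    then show ?thesis
      by (rule has_field_derivative_transform_within_open[of _ _ _ "{0<..}"]) (use 1 in auto)
  next
    case 2
    have "((\<lambda>t. 0) has_real_derivative 2 * max 0 t) (at t)"
      using 2 by (auto intro!: derivative_eq_intros)
    then show ?thesis
      by (rule has_field_derivative_transform_within_open[of _ _ _ "{..<0}"]) (use 2 in auto)
  next
    case 3
    show ?thesis
      unfolding 3 CARAT_DERIV
      \<comment> \<open>Caratheodory's slope function at 0, from (max 0 z)^2 = max 0 z * z.\<close>
      by (rule exI[of _ "max 0"]) (auto simp: power2_eq_square max_def intro!: continuous_intros)
  qed
qed

lemma has_derivative_ramp: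
  "(ramp has_real_derivative 2 * max 0 t / (1 + (max 0 t)\<^sup>2)\<^sup>2) (at t)"
proof -
  have nz: "1 + (max 0 t)\<^sup>2 \<noteq> 0" by (smt (verit) zero_le_power2)
  have "((\<lambda>t. (max 0 t)\<^sup>2 / (1 + (max 0 t)\<^sup>2)) has_real_derivative
      2 * max 0 t / (1 + (max 0 t)\<^sup>2)\<^sup>2) (at t)"
    by (rule DERIV_cong[OF DERIV_divide[OF has_derivative_max_square
        DERIV_add[OF DERIV_const has_derivative_max_square] nz]])
      (simp add: power2_eq_square algebra_simps)
  then show ?thesis by (simp add: ramp_def[abs_def])
qed

lemma c1_fun_ramp: "c1_fun f \<Longrightarrow> c1_fun (\<lambda>x. ramp (f x))"
proof (rule c1_fun_compose[OF _ has_derivative_ramp])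
  have "1 + (max 0 t)\<^sup>2 \<noteq> (0::real)" for t by (smt (verit) zero_le_power2)
  then show "continuous_on UNIV (\<lambda>t::real. 2 * max 0 t / (1 + (max 0 t)\<^sup>2)\<^sup>2)"
    by (intro continuous_intros) auto
qed

text \<open>Since \<open>ramp s\<close> is 1 minus the reciprocal of 1 + (max 0 s)^2, it suffices
  that the argument tends to infinity; the shift by 1 does not affect this.\<close>

lemma ramp_limit:
  assumes "t > 0"
  shows "(\<lambda>n. ramp (real (Suc n) * t - 1)) \<longlonglongrightarrow> 1"
proof -
  have lim: "filterlim (\<lambda>n. (max 0 (real (Suc n) * t - 1))\<^sup>2) at_top sequentially"
  proof (rule filterlim_pow_at_top)
    have "filterlim (\<lambda>n. real (Suc n)) at_top sequentially"
      using filterlim_real_sequentially filterlim_Suc filterlim_compose by blast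
    then have "filterlim (\<lambda>n. t * real (Suc n)) at_top sequentially"
      using assms filterlim_tendsto_pos_mult_at_top[OF tendsto_const] by blast
    then have "filterlim (\<lambda>n. -1 + t * real (Suc n)) at_top sequentially"
      using filterlim_tendsto_add_at_top[OF tendsto_const] by blast
    then show "filterlim (\<lambda>n. max 0 (real (Suc n) * t - 1)) at_top sequentially"
      by (rule filterlim_at_top_mono) (auto simp: algebra_simps)
  qed simp
  have "(\<lambda>n. 1 - inverse (1 + (max 0 (real (Suc n) * t - 1))\<^sup>2)) \<longlonglongrightarrow> 1 - 0"
    by (intro tendsto_diff tendsto_const tendsto_inverse_0_at_top
        filterlim_tendsto_add_at_top[OF tendsto_const lim])
  moreover have "1 - inverse (1 + (max 0 s)\<^sup>2) = ramp s" for s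
  proof -
    have "1 + (max 0 s)\<^sup>2 \<noteq> 0" by (smt (verit) zero_le_power2)
    then show ?thesis by (simp add: ramp_def field_simps)
  qed
  ultimately show ?thesis by simp
qed

text \<open>The shift by 1 inside each \<open>ramp\<close> makes the bump vanish within distance
  \<open>1 / real (Suc n)\<close> of every face of the box. Its support is thus compact in the open
  box, and the margin shrinks to 0.\<close>

definition bump :: "real^'n::finite \<Rightarrow> real^'n \<Rightarrow> nat \<Rightarrow> real^'n \<Rightarrow> real"
  where "bump a b n x =
    (\<Prod>i\<in>UNIV. ramp (real (Suc n) * (x $ i - a $ i) - 1) * ramp (real (Suc n) * (b $ i - x $ i) - 1))"

lemma bump_bounds: "0 \<le> bump a b n x" "bump a b n x \<le> 1"
  unfolding bump_def by (intro prod_nonneg prod_le_1 ballI conjI mult_nonneg_nonneg mult_le_one ramp_bounds)+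

lemma c1_fun_affine: "c1_fun (\<lambda>x::real^'n::finite. s * (x $ i) + t)"
  unfolding c1_fun_def
  by (rule exI[of _ "\<lambda>x. s *\<^sub>R axis i 1"])
    (auto simp: inner_axis' intro!: derivative_eq_intros bounded_linear_imp_has_derivative)

lemma c1_fun_bump: "c1_fun (bump a b n)"
proof -
  have 1: "c1_fun (\<lambda>x. real (Suc n) * (x $ i - a $ i) - 1)" for i
    using c1_fun_affine[of "real (Suc n)" i "- real (Suc n) * a $ i - 1"] by (simp add: algebra_simps)
  have 2: "c1_fun (\<lambda>x. real (Suc n) * (b $ i - x $ i) - 1)" for i
    using c1_fun_affine[of "- real (Suc n)" i "real (Suc n) * b $ i - 1"] by (simp add: algebra_simps)
  show ?thesis
    unfolding bump_def[abs_def] by (intro c1_fun_prod c1_fun_mult c1_fun_ramp 1 2) simp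
qed

lemma bump_support:
  assumes "bump a b n x \<noteq> 0"
  shows "x \<in> cbox (a + (1 / real (Suc n)) *\<^sub>R 1) (b - (1 / real (Suc n)) *\<^sub>R 1)"
proof -
  have "real (Suc n) * (x $ i - a $ i) > 1 \<and> real (Suc n) * (b $ i - x $ i) > 1" for i
    using assms ramp_eq_0[of "real (Suc n) * (x $ i - a $ i) - 1"]
      ramp_eq_0[of "real (Suc n) * (b $ i - x $ i) - 1"]
    by (auto simp: bump_def not_le[symmetric] simp del: of_nat_Suc)
  then show ?thesis
    by (auto simp: mem_box_cart less_imp_le field_simps)
qed

text \<open>The margin puts the support into a closed box inside the open one. When a side is too
  short for two margins, that closed box is empty and the bump is 0.\<close>

lemma test_fun_bump:
  assumes "box a b \<subseteq> \<Omega>"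
  shows "\<exists>D. test_fun \<Omega> (bump a b n) D"
proof -
  let ?K = "cbox (a + (1 / real (Suc n)) *\<^sub>R 1) (b - (1 / real (Suc n)) *\<^sub>R 1)"
  have "x \<in> box a b" if "x \<in> ?K" for x
  proof -
    have "0 < 1 / real (Suc n)" by simp
    moreover have "a $ i + 1 / real (Suc n) \<le> x $ i" "x $ i \<le> b $ i - 1 / real (Suc n)" for i
      using that by (auto simp: mem_box_cart)
    ultimately have "a $ i < x $ i \<and> x $ i < b $ i" for i by (smt (verit))
    then show ?thesis unfolding mem_box_cart by blast
  qed
  then have K: "?K \<subseteq> \<Omega>" "\<forall>x. x \<notin> ?K \<longrightarrow> bump a b n x = 0"
    using assms bump_support by blast+
  obtain D where "\<And>x. (bump a b n has_derivative (\<lambda>h. D x \<bullet> h)) (at x)" "continuous_on UNIV D"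
    using c1_fun_bump[of a b n] unfolding c1_fun_def by blast
  then have "test_fun \<Omega> (bump a b n) D"
    unfolding test_fun_def using K compact_cbox by blast
  then show ?thesis by (rule exI[where x = D])
qed

lemma bump_limit: "(\<lambda>n. bump a b n x) \<longlonglongrightarrow> indicator (box a b) x"
proof (cases "x \<in> box a b")
  case True
  have "(\<lambda>n. bump a b n x) \<longlonglongrightarrow> (\<Prod>i\<in>(UNIV::'a set). 1 * 1)"
    unfolding bump_def using True
    by (intro tendsto_prod tendsto_mult ramp_limit) (auto simp: mem_box_cart)
  then show ?thesis using True by simp
next
  case False
  then obtain i where "x $ i - a $ i \<le> 0 \<or> b $ i - x $ i \<le> 0"
    by (auto simp: mem_box_cart not_less)
  then have "ramp (real (Suc n) * (x $ i - a $ i) - 1) * ramp (real (Suc n) * (b $ i - x $ i) - 1) = 0" for n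
  proof
    assume "x $ i - a $ i \<le> 0"
    then have "real (Suc n) * (x $ i - a $ i) \<le> 0" by (rule mult_nonneg_nonpos[rotated]) simp
    then show ?thesis using ramp_eq_0[of "real (Suc n) * (x $ i - a $ i) - 1"] by simp
  next
    assume "b $ i - x $ i \<le> 0"
    then have "real (Suc n) * (b $ i - x $ i) \<le> 0" by (rule mult_nonneg_nonpos[rotated]) simp
    then show ?thesis using ramp_eq_0[of "real (Suc n) * (b $ i - x $ i) - 1"] by simp
  qed
  then have "bump a b n x = 0" for n
    unfolding bump_def by (intro prod_zero bexI[of _ i]) auto
  then show ?thesis using False by simp
qed

section \<open>The fundamental lemma of the calculus of variations\<close>

text \<open>A premise of \<open>density_zero\<close> below; the covering sets of
  \<open>lborel\<close> keep their measure in the completion.\<close>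

lemma sigma_finite_lebesgue: "sigma_finite_measure (lebesgue :: 'a::euclidean_space measure)"
proof
  obtain A :: "'a set set" where "countable A" "A \<subseteq> sets lborel" "\<Union>A = space lborel"
      "\<forall>a\<in>A. emeasure lborel a \<noteq> \<infinity>"
    using lborel.sigma_finite_countable by blast
  then show "\<exists>A. countable A \<and> A \<subseteq> sets lebesgue \<and> \<Union>A = space (lebesgue :: 'a measure) \<and>
      (\<forall>a\<in>A. emeasure lebesgue a \<noteq> \<infinity>)"
    by (intro exI[of _ A]) (auto simp: subset_eq)
qed

context
  fixes \<Omega> :: "(real^'n::finite) set" and f :: "'n cfun"
  assumes f: "set_integrable lebesgue \<Omega> f"
    and test: "\<And>\<phi> D. test_fun \<Omega> \<phi> D \<Longrightarrow>
      (LINT x:\<Omega>|lebesgue. complex_of_real (\<phi> x) * f x) = 0"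
begin

text \<open>The bumps of the box are test functions with values in [0, 1] that converge to its
  indicator; dominated convergence with the bound \<open>norm (F x)\<close> passes to the
  limit.\<close>

lemma integral_box_zero:
  assumes ab: "box a b \<subseteq> \<Omega>"
  shows "(LINT x:box a b|lebesgue. f x) = 0"
proof -
  define F where "F x = indicator \<Omega> x *\<^sub>R f x" for x
  have F: "integrable lebesgue F" using f by (simp add: set_integrable_def F_def[abs_def])
  have "(\<lambda>n. LINT x|lebesgue. of_real (bump a b n x) * F x)
      \<longlonglongrightarrow> (LINT x|lebesgue. of_real (indicator (box a b) x) * F x)"
  proof (rule integral_dominated_convergence[where w = "\<lambda>x. norm (F x)"])
    have [measurable]: "F \<in> borel_measurable lebesgue" using F by auto
    have "bump a b n \<in> borel_measurable lebesgue" for n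
      by (intro measurable_completion)
        (simp add: borel_measurable_continuous_onI c1_fun_continuous c1_fun_bump)
    note [measurable] = this
    show "(\<lambda>x. of_real (bump a b n x) * F x) \<in> borel_measurable lebesgue" for n
      by measurable
    have [measurable]: "(indicator (box a b) :: _ \<Rightarrow> real) \<in> borel_measurable lebesgue"
      by (rule borel_measurable_indicator) simp
    show "(\<lambda>x. of_real (indicator (box a b) x) * F x) \<in> borel_measurable lebesgue"
      by measurable
    show "integrable lebesgue (\<lambda>x. norm (F x))" using F by simp
    show "AE x in lebesgue. (\<lambda>n. of_real (bump a b n x) * F x)
        \<longlonglongrightarrow> of_real (indicator (box a b) x) * F x"
      by (intro AE_I2 tendsto_mult tendsto_of_real bump_limit tendsto_const)
    show "AE x in lebesgue. norm (of_real (bump a b n x) * F x) \<le> norm (F x)" for n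
      using bump_bounds[of a b n] by (auto simp: norm_mult intro!: mult_left_le_one_le)
  qed
  moreover have "(LINT x|lebesgue. of_real (bump a b n x) * F x) = 0" for n
  proof -
    obtain D where "test_fun \<Omega> (bump a b n) D" using test_fun_bump[OF ab] by blast
    from test[OF this] show ?thesis
      by (simp add: set_lebesgue_integral_def F_def)
  qed
  ultimately have "(\<lambda>n. 0) \<longlonglongrightarrow> (LINT x|lebesgue. of_real (indicator (box a b) x) * F x)"
    by simp
  then have "(LINT x|lebesgue. of_real (indicator (box a b) x) * F x) = 0"
    by (simp add: LIMSEQ_const_iff)
  moreover have "of_real (indicator (box a b) x) * F x = indicator (box a b) x *\<^sub>R f x" for x
    using ab by (auto simp: F_def indicator_def)
  ultimately show ?thesis by (simp add: set_lebesgue_integral_def)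
qed

text \<open>Cutting \<open>f\<close> off to one box inside \<Omega> gives \<open>g\<close>, defined
  on the whole space, whose integrals over all boxes vanish. Boxes form an intersection-stable
  generator, so a Dynkin argument reaches the Borel sets; null sets lead to the Lebesgue sets, and a
  function with zero integral over each of these is zero almost everywhere.\<close>

lemma AE_box_zero:
  assumes ab: "box a b \<subseteq> \<Omega>"
  shows "AE x in lebesgue. x \<in> box a b \<longrightarrow> f x = 0"
proof -
  define g where "g x = indicator (box a b) x *\<^sub>R f x" for x
  have "set_integrable lebesgue (box a b) f"
    by (rule set_integrable_subset[OF f _ ab]) simp
  then have g: "integrable lebesgue g" by (simp add: set_integrable_def g_def[abs_def])
  have gE: "set_integrable lebesgue E g" if "E \<in> sets lebesgue" for E
    using g that by (simp add: set_integrable_def integrable_mult_indicator)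
  have box: "(LINT x:box c d|lebesgue. g x) = 0" for c d
  proof -
    obtain u v where uv: "box c d \<inter> box a b = box u v" using box_Int_box by blast
    then have "box u v \<subseteq> \<Omega>" using ab by blast
    from integral_box_zero[OF this] show ?thesis
      unfolding uv[symmetric] by (simp add: g_def set_lebesgue_integral_def indicator_inter_arith)
  qed
  have borel: "(LINT x:E|lebesgue. g x) = 0" if "E \<in> sets borel" for E
  proof -
    have st: "Int_stable (range (\<lambda>(a, b). box a b :: (real^'n) set))"
    proof (rule Int_stableI)
      fix A B :: "(real^'n) set"
      assume "A \<in> range (\<lambda>(a, b). box a b)" "B \<in> range (\<lambda>(a, b). box a b)"
      then obtain p q r s where "A = box p q" "B = box r s" by auto
      then obtain u v where "A \<inter> B = box u v" by (simp add: box_Int_box)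
      then show "A \<inter> B \<in> range (\<lambda>(a, b). box a b)" by (intro range_eqI[of _ _ "(u, v)"]) simp
    qed
    have sub: "sigma_sets UNIV (range (\<lambda>(a, b). box a b :: (real^'n) set)) \<subseteq> sets lebesgue"
    proof -
      have "sigma_sets UNIV (range (\<lambda>(a, b). box a b :: (real^'n) set)) = sets borel"
        by (simp add: borel_eq_box)
      then show ?thesis by auto
    qed
    from that have "E \<in> sigma_sets UNIV (range (\<lambda>(a, b). box a b :: (real^'n) set))"
      by (simp add: borel_eq_box)
    then show ?thesis
    proof (induction rule: sigma_sets_induct_disjoint[OF st, of UNIV, OF subset_trans[OF subset_UNIV Pow_UNIV[THEN equalityD2]],
        consumes 1, case_names basic empty compl union])
      case (basic A)
      then show ?case using box by auto
    next
      case empty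
      then show ?case by (simp add: set_lebesgue_integral_def)
    next
      case (compl A)
      have A: "A \<in> sets lebesgue" using compl sub by auto
      \<comment> \<open>The complement step needs the total integral, which reduces to a box because
        \<open>g\<close> vanishes off \<open>box a b\<close>.\<close>
      have "(LINT x:UNIV|lebesgue. g x) = (LINT x:box a b|lebesgue. g x)"
        unfolding set_lebesgue_integral_def by (intro Bochner_Integration.integral_cong) (auto simp: g_def indicator_def)
      then have "(LINT x:A \<union> (UNIV - A)|lebesgue. g x) = 0" using box by simp
      moreover have "(LINT x:A \<union> (UNIV - A)|lebesgue. g x)
          = (LINT x:A|lebesgue. g x) + (LINT x:UNIV - A|lebesgue. g x)"
        by (rule set_integral_Un[OF _ gE[OF A] gE]) (auto intro!: sets.Diff A)
      ultimately show ?case using compl by simp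
    next
      case (union A)
      have A: "\<And>i. A i \<in> sets lebesgue" using union sub by auto
      have "(LINT x:(\<Union>i. A i)|lebesgue. g x) = (\<Sum>i. LINT x:A i|lebesgue. g x)"
        by (rule lebesgue_integral_countable_add)
          (use A gE union in \<open>auto simp: disjoint_family_on_def\<close>)
      then show ?case using union by simp
    qed
  qed
  have leb: "(LINT x:E|lebesgue. g x) = 0" if E: "E \<in> sets lebesgue" for E
  proof -
    \<comment> \<open>A Lebesgue set differs from an F-sigma set, hence from a Borel set, by a null
      set.\<close>
    obtain C N where C: "fsigma C" "N \<in> null_sets lebesgue" "C \<union> N = E" "disjnt C N"
      using lebesgue_set_almost_fsigma[OF E] by metis
    have CB: "C \<in> sets borel" using C(1) by cases auto
    then have CL: "C \<in> sets lebesgue" by simp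
    have "(LINT x:E|lebesgue. g x) = (LINT x:C|lebesgue. g x)"
    proof (rule set_integral_cong_set)
      show "set_borel_measurable lebesgue C g" "set_borel_measurable lebesgue E g"
        using gE[OF E] gE[OF CL] by (auto simp: set_borel_measurable_def set_integrable_def)
      have "AE x in lebesgue. x \<notin> N"
        using C(2) by (rule AE_not_in)
      then show "AE x in lebesgue. (x \<in> C) = (x \<in> E)"
        by (rule AE_mp) (use C(3) in auto)
    qed
    then show ?thesis using borel[OF CB] by simp
  qed
  have "AE x in lebesgue. g x = 0"
    by (rule sigma_finite_measure.density_zero[OF sigma_finite_lebesgue g leb])
  then show ?thesis by (rule AE_mp) (auto simp: g_def indicator_def)
qed

text \<open>An open set is a countable union of open boxes, and the countably many exceptional null
  sets may be united.\<close>

lemma AE_zero: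
  assumes "open \<Omega>"
  shows "AE x in lebesgue. x \<in> \<Omega> \<longrightarrow> f x = 0"
proof -
  obtain \<D> where D: "countable \<D>" "\<Union>\<D> = \<Omega>" "\<And>X. X \<in> \<D> \<Longrightarrow> \<exists>a b. X = box a b"
    using open_countable_Union_open_box[OF assms] by metis
  have "AE x in lebesgue. \<forall>X\<in>\<D>. x \<in> X \<longrightarrow> f x = 0"
    unfolding AE_ball_countable[OF D(1)]
  proof
    fix X assume X: "X \<in> \<D>"
    then obtain a b where "X = box a b" using D(3) by blast
    moreover have "X \<subseteq> \<Omega>" using X D(2) by blast
    ultimately show "AE x in lebesgue. x \<in> X \<longrightarrow> f x = 0" using AE_box_zero by blast
  qed
  then show ?thesis by (rule AE_mp) (use D(2) in auto)
qed

end

section \<open>Square integrable functions\<close>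

text \<open>Moving the indicator inside the norm makes both conditions statements about one function
  on the whole space.\<close>

lemma L2_iff:
  "f \<in> L2 \<Omega> \<longleftrightarrow> (\<lambda>x. indicator \<Omega> x *\<^sub>R f x) \<in> borel_measurable lebesgue \<and>
    integrable lebesgue (\<lambda>x. (cmod (indicator \<Omega> x *\<^sub>R f x))\<^sup>2)"
proof -
  have "(\<lambda>x. indicator \<Omega> x *\<^sub>R (cmod (f x))\<^sup>2) = (\<lambda>x. (cmod (indicator \<Omega> x *\<^sub>R f x))\<^sup>2)"
    by (auto simp: fun_eq_iff indicator_def)
  then show ?thesis by (simp add: L2_def set_borel_measurable_def set_integrable_def)
qed

lemma cmod_add_power2_le: "(cmod (a + b))\<^sup>2 \<le> 2 * (cmod a)\<^sup>2 + 2 * (cmod b)\<^sup>2"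
proof -
  have "(cmod (a + b))\<^sup>2 \<le> (cmod a + cmod b)\<^sup>2"
    by (rule power_mono[OF norm_triangle_ineq]) simp
  also have "\<dots> \<le> 2 * (cmod a)\<^sup>2 + 2 * (cmod b)\<^sup>2"
    using sum_squares_bound[of "cmod a" "cmod b"] by (simp add: power2_sum)
  finally show ?thesis .
qed

lemma set_integrable_sum:
  fixes f :: "'i \<Rightarrow> 'a \<Rightarrow> 'b::{banach, second_countable_topology}"
  assumes "\<And>i. i \<in> I \<Longrightarrow> set_integrable M A (f i)"
  shows "set_integrable M A (\<lambda>x. \<Sum>i\<in>I. f i x)"
  using assms unfolding set_integrable_def scaleR_sum_right by (intro Bochner_Integration.integrable_sum)

lemma L2_mult_integrable:
  assumes f: "f \<in> L2 \<Omega>" and g: "g \<in> L2 \<Omega>"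
  shows "set_integrable lebesgue \<Omega> (\<lambda>x. f x * g x)"
proof -
  let ?F = "\<lambda>x. indicator \<Omega> x *\<^sub>R f x" and ?G = "\<lambda>x. indicator \<Omega> x *\<^sub>R g x"
  have eq: "indicator \<Omega> x *\<^sub>R (f x * g x) = ?F x * ?G x" for x
    by (simp add: indicator_def)
  have "integrable lebesgue (\<lambda>x. ?F x * ?G x)"
  proof (rule Bochner_Integration.integrable_bound)
    show "integrable lebesgue (\<lambda>x. (cmod (?F x))\<^sup>2 + (cmod (?G x))\<^sup>2)"
      using f g unfolding L2_iff by (intro Bochner_Integration.integrable_add) auto
    show "(\<lambda>x. ?F x * ?G x) \<in> borel_measurable lebesgue"
      using f g unfolding L2_iff by (intro borel_measurable_times) auto
    have B: "cmod (a * b) \<le> (cmod a)\<^sup>2 + (cmod b)\<^sup>2" for a b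
      using sum_squares_bound[of "cmod a" "cmod b"] mult_nonneg_nonneg[OF norm_ge_zero[of a] norm_ge_zero[of b]]
      unfolding norm_mult by linarith
    show "AE x in lebesgue. norm (?F x * ?G x) \<le> norm ((cmod (?F x))\<^sup>2 + (cmod (?G x))\<^sup>2)"
      unfolding real_norm_def by (rule AE_I2, rule order_trans[OF B abs_ge_self])
  qed
  then show ?thesis unfolding set_integrable_def eq .
qed

lemma L2_add:
  assumes f: "f \<in> L2 \<Omega>" and g: "g \<in> L2 \<Omega>"
  shows "(\<lambda>x. f x + g x) \<in> L2 \<Omega>"
proof -
  let ?F = "\<lambda>x. indicator \<Omega> x *\<^sub>R f x" and ?G = "\<lambda>x. indicator \<Omega> x *\<^sub>R g x"
  have eq: "indicator \<Omega> x *\<^sub>R (f x + g x) = ?F x + ?G x" for x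
    by (simp add: indicator_def)
  have m: "(\<lambda>x. ?F x + ?G x) \<in> borel_measurable lebesgue"
    using f g unfolding L2_iff by (intro borel_measurable_add) auto
  have "integrable lebesgue (\<lambda>x. (cmod (?F x + ?G x))\<^sup>2)"
  proof (rule Bochner_Integration.integrable_bound)
    show "integrable lebesgue (\<lambda>x. 2 * (cmod (?F x))\<^sup>2 + 2 * (cmod (?G x))\<^sup>2)"
      using f g unfolding L2_iff
      by (intro Bochner_Integration.integrable_add Bochner_Integration.integrable_mult_right) auto
    show "(\<lambda>x. (cmod (?F x + ?G x))\<^sup>2) \<in> borel_measurable lebesgue"
      by (rule borel_measurable_power[OF measurable_compose[OF m borel_measurable_norm]])
    show "AE x in lebesgue. norm ((cmod (?F x + ?G x))\<^sup>2)
        \<le> norm (2 * (cmod (?F x))\<^sup>2 + 2 * (cmod (?G x))\<^sup>2)"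
    proof (rule AE_I2)
      fix x
      show "norm ((cmod (?F x + ?G x))\<^sup>2) \<le> norm (2 * (cmod (?F x))\<^sup>2 + 2 * (cmod (?G x))\<^sup>2)"
        using cmod_add_power2_le[of "?F x" "?G x"] by (simp del: norm_scaleR)
    qed
  qed
  then show ?thesis unfolding L2_iff eq using m by (rule conjI[rotated])
qed

text \<open>Serves constants, \<open>\<kappa>\<close> squared and continuous factors on bounded sets
  alike; the bound holds almost everywhere because \<open>\<kappa>\<close> is only essentially
  bounded.\<close>

lemma L2_bounded_mult:
  assumes b: "b \<in> borel_measurable lebesgue" "AE x in lebesgue. x \<in> \<Omega> \<longrightarrow> cmod (b x) \<le> C"
    and f: "f \<in> L2 \<Omega>"
  shows "(\<lambda>x. b x * f x) \<in> L2 \<Omega>"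
proof -
  let ?F = "\<lambda>x. indicator \<Omega> x *\<^sub>R f x"
  have eq: "indicator \<Omega> x *\<^sub>R (b x * f x) = b x * ?F x" for x
    by (simp add: indicator_def)
  have m: "(\<lambda>x. b x * ?F x) \<in> borel_measurable lebesgue"
    using f b(1) unfolding L2_iff by (intro borel_measurable_times) auto
  have "integrable lebesgue (\<lambda>x. (cmod (b x * ?F x))\<^sup>2)"
  proof (rule Bochner_Integration.integrable_bound)
    show "integrable lebesgue (\<lambda>x. C\<^sup>2 * (cmod (?F x))\<^sup>2)"
      using f unfolding L2_iff by (intro Bochner_Integration.integrable_mult_right) auto
    show "(\<lambda>x. (cmod (b x * ?F x))\<^sup>2) \<in> borel_measurable lebesgue"
      by (rule borel_measurable_power[OF measurable_compose[OF m borel_measurable_norm]])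
    show "AE x in lebesgue. norm ((cmod (b x * ?F x))\<^sup>2) \<le> norm (C\<^sup>2 * (cmod (?F x))\<^sup>2)"
      using b(2)
    proof (rule AE_mp, intro AE_I2 impI)
      fix x assume x: "x \<in> \<Omega> \<longrightarrow> cmod (b x) \<le> C"
      show "norm ((cmod (b x * ?F x))\<^sup>2) \<le> norm (C\<^sup>2 * (cmod (?F x))\<^sup>2)"
      proof (cases "x \<in> \<Omega>")
        case True
        then have "(cmod (b x))\<^sup>2 \<le> C\<^sup>2" using x by (intro power_mono) auto
        then have "(cmod (b x))\<^sup>2 * (cmod (?F x))\<^sup>2 \<le> C\<^sup>2 * (cmod (?F x))\<^sup>2"
          by (rule mult_right_mono) simp
        then show ?thesis using True by (simp add: norm_mult power_mult_distrib)
      qed simp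
    qed
  qed
  then show ?thesis unfolding L2_iff eq using m by (rule conjI[rotated])
qed

lemma L2_scale: "f \<in> L2 \<Omega> \<Longrightarrow> (\<lambda>x. c * f x) \<in> L2 \<Omega>"
  by (rule L2_bounded_mult[where C = "cmod c"]) auto

lemma L2_cnj:
  assumes "f \<in> L2 \<Omega>" shows "(\<lambda>x. cnj (f x)) \<in> L2 \<Omega>"
proof -
  have eq: "indicator \<Omega> x *\<^sub>R cnj (f x) = cnj (indicator \<Omega> x *\<^sub>R f x)" for x
    by simp
  have "cnj \<in> borel_measurable borel"
    by (intro borel_measurable_continuous_onI continuous_intros)
  from measurable_compose[OF _ this]
  have "(\<lambda>x. cnj (indicator \<Omega> x *\<^sub>R f x)) \<in> borel_measurable lebesgue"
    using assms unfolding L2_iff by (elim conjE)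
  then show ?thesis using assms unfolding L2_iff eq complex_mod_cnj by (elim conjE) (rule conjI)
qed

lemma L2_restrict:
  assumes f: "f \<in> L2 \<Omega>" and \<Theta>: "\<Theta> \<subseteq> \<Omega>" "\<Theta> \<in> sets lebesgue" and g: "\<And>x. x \<in> \<Theta> \<Longrightarrow> g x = f x"
  shows "g \<in> L2 \<Theta>"
proof -
  let ?F = "\<lambda>x. indicator \<Omega> x *\<^sub>R f x"
  have eq: "indicator \<Theta> x *\<^sub>R g x = indicator \<Theta> x *\<^sub>R ?F x" for x
    using \<Theta>(1) g by (auto simp: indicator_def)
  have eq2: "(cmod (indicator \<Theta> x *\<^sub>R ?F x))\<^sup>2 = indicator \<Theta> x *\<^sub>R (cmod (?F x))\<^sup>2" for x
    by (auto simp: indicator_def)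
  show ?thesis
    unfolding L2_iff eq eq2
  proof
    show "(\<lambda>x. indicator \<Theta> x *\<^sub>R ?F x) \<in> borel_measurable lebesgue"
      by (rule borel_measurable_scaleR[OF borel_measurable_indicator[OF \<Theta>(2)]
          conjunct1[OF f[unfolded L2_iff]]])
    show "integrable lebesgue (\<lambda>x. indicator \<Theta> x *\<^sub>R (cmod (?F x))\<^sup>2)"
      using f unfolding L2_iff by (intro integrable_mult_indicator \<Theta>(2)) (elim conjE)
  qed
qed

lemma L2_integrable_norm:
  "f \<in> L2 \<Omega> \<Longrightarrow> set_integrable lebesgue \<Omega> (\<lambda>x. (cmod (f x))\<^sup>2)"
  by (simp add: L2_def)

context
  fixes \<Omega> :: "(real^'n::finite) set"
  assumes op: "open \<Omega>" and bd: "bounded \<Omega>"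
begin

text \<open>A bounded set has finite measure, so the constant 1 is square integrable and
  \<open>f\<close> is a product of two square integrable functions.\<close>

lemma L2_integrable:
  assumes "f \<in> L2 \<Omega>"
  shows "set_integrable lebesgue \<Omega> f"
proof -
  have "\<Omega> \<in> lmeasurable" using op bd by (rule lmeasurable_open[rotated])
  then have "set_integrable lebesgue \<Omega> (\<lambda>x. 1 :: real)"
    by (simp add: set_integrable_def lmeasurable_iff_integrable)
  then have i: "integrable lebesgue (indicator \<Omega> :: _ \<Rightarrow> real)" by (simp add: set_integrable_def)
  have "(\<lambda>x. 1) \<in> L2 \<Omega>"
  proof -
    have "(\<lambda>x. (cmod (indicator \<Omega> x *\<^sub>R 1))\<^sup>2) = indicator \<Omega>"
      by (auto simp: fun_eq_iff indicator_def)
    then show ?thesis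
      unfolding L2_iff using i op by (auto intro!: borel_measurable_scaleR borel_measurable_indicator)
  qed
  from L2_mult_integrable[OF this assms] show ?thesis by simp
qed

lemma continuous_mult_L2:
  assumes h: "continuous_on UNIV (h :: real^'n \<Rightarrow> real)" and f: "f \<in> L2 \<Omega>"
  shows "(\<lambda>x. complex_of_real (h x) * f x) \<in> L2 \<Omega>"
proof -
  have "compact (closure \<Omega>)" using bd by simp
  then have "compact (h ` closure \<Omega>)"
    using h continuous_on_subset by (intro compact_continuous_image) auto
  then obtain C where C: "\<And>x. x \<in> closure \<Omega> \<Longrightarrow> \<bar>h x\<bar> \<le> C"
    using compact_imp_bounded bounded_iff by (metis imageI real_norm_def)
  show ?thesis
  proof (rule L2_bounded_mult[OF _ _ f])
    have "(\<lambda>x. complex_of_real (h x)) \<in> borel_measurable borel"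
      using h by (intro borel_measurable_continuous_onI continuous_intros)
    then show "(\<lambda>x. complex_of_real (h x)) \<in> borel_measurable lebesgue"
      by (intro measurable_completion) simp
    show "AE x in lebesgue. x \<in> \<Omega> \<longrightarrow> cmod (complex_of_real (h x)) \<le> C"
      using C closure_subset by auto
  qed
qed

lemma continuous_mult_integrable:
  "continuous_on UNIV (h :: real^'n \<Rightarrow> real) \<Longrightarrow> f \<in> L2 \<Omega> \<Longrightarrow>
    set_integrable lebesgue \<Omega> (\<lambda>x. complex_of_real (h x) * f x)"
  using L2_integrable continuous_mult_L2 by blast

end

section \<open>Weak gradients\<close>

lemma test_fun_continuous:
  assumes "test_fun \<Omega> \<phi> D"
  shows "continuous_on UNIV \<phi>" "continuous_on UNIV (\<lambda>x. D x $ i)"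
proof -
  have "\<And>x. (\<phi> has_derivative (\<lambda>h. D x \<bullet> h)) (at x)" using assms by (simp add: test_fun_def)
  then show "continuous_on UNIV \<phi>"
    by (intro continuous_at_imp_continuous_on ballI) (rule has_derivative_continuous)
  show "continuous_on UNIV (\<lambda>x. D x $ i)"
    using assms by (intro bounded_linear.continuous_on[OF bounded_linear_vec_nth])
      (simp add: test_fun_def)
qed

lemma test_fun_mono: "test_fun \<Theta> \<phi> D \<Longrightarrow> \<Theta> \<subseteq> \<Omega> \<Longrightarrow> test_fun \<Omega> \<phi> D"
  unfolding test_fun_def by (meson subset_trans)

text \<open>The complement of the compact support is open, so the derivative vanishes there along
  with the function. Integrals against a test function of \<Theta> therefore do not change when
  \<Theta> is enlarged.\<close>

lemma test_fun_zero:
  assumes t: "test_fun \<Theta> \<phi> D" and x: "x \<notin> \<Theta>"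
  shows "\<phi> x = 0" "D x = 0"
proof -
  obtain K where K: "K \<subseteq> \<Theta>" "compact K" "\<And>x. x \<notin> K \<Longrightarrow> \<phi> x = 0"
    using t by (auto simp: test_fun_def)
  show "\<phi> x = 0" using K x by auto
  have "(\<phi> has_derivative (\<lambda>h. 0)) (at x)"
  proof (rule has_derivative_transform_within_open[of "\<lambda>x. 0" _ _ _ "- K"])
    show "open (- K)" using K(2) by (simp add: compact_imp_closed open_Compl)
  qed (use K x in auto)
  moreover have "(\<phi> has_derivative (\<lambda>h. D x \<bullet> h)) (at x)" using t by (simp add: test_fun_def)
  ultimately have "(\<lambda>h. 0) = (\<lambda>h. D x \<bullet> h)" by (rule has_derivative_unique)
  from fun_cong[OF this, of "D x"] show "D x = 0" by simp
qed

lemma is_weak_gradD: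
  assumes "is_weak_grad \<Omega> u g"
  shows "(\<lambda>x. g x $ i) \<in> L2 \<Omega>"
    and "test_fun \<Omega> \<phi> D \<Longrightarrow> (LINT x:\<Omega>|lebesgue. complex_of_real (D x $ i) * u x)
         = - (LINT x:\<Omega>|lebesgue. complex_of_real (\<phi> x) * g x $ i)"
  using assms by (auto simp: is_weak_grad_def)

text \<open>Test functions of \<Theta> are test functions of \<Omega>, so the same gradient serves.
  Agreement is asked for on \<Theta> alone, because elements of the local spaces are cut off outside
  the closure of their subdomain.\<close>

lemma is_weak_grad_restrict:
  assumes g: "is_weak_grad \<Omega> u g" and \<Theta>: "\<Theta> \<subseteq> \<Omega>" "open \<Theta>" and v: "\<And>x. x \<in> \<Theta> \<Longrightarrow> v x = u x"
  shows "is_weak_grad \<Theta> v g"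
  unfolding is_weak_grad_def
proof (intro conjI allI impI)
  show "(\<lambda>x. g x $ i) \<in> L2 \<Theta>" for i
    by (rule L2_restrict[OF is_weak_gradD(1)[OF g] \<Theta>(1)]) (use \<Theta>(2) in auto)
  fix \<phi> D i assume t: "test_fun \<Theta> \<phi> D"
  have "(LINT x:\<Theta>|lebesgue. complex_of_real (D x $ i) * v x)
      = (LINT x:\<Omega>|lebesgue. complex_of_real (D x $ i) * u x)"
    unfolding set_lebesgue_integral_def
    by (rule Bochner_Integration.integral_cong)
      (use \<Theta> v test_fun_zero[OF t] in \<open>auto simp: indicator_def\<close>)
  moreover have "(LINT x:\<Theta>|lebesgue. complex_of_real (\<phi> x) * g x $ i)
      = (LINT x:\<Omega>|lebesgue. complex_of_real (\<phi> x) * g x $ i)"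
    unfolding set_lebesgue_integral_def
    by (rule Bochner_Integration.integral_cong)
      (use \<Theta> test_fun_zero[OF t] in \<open>auto simp: indicator_def\<close>)
  ultimately show "(LINT x:\<Theta>|lebesgue. complex_of_real (D x $ i) * v x)
      = - (LINT x:\<Theta>|lebesgue. complex_of_real (\<phi> x) * g x $ i)"
    using is_weak_gradD(2)[OF g test_fun_mono[OF t \<Theta>(1)]] by simp
qed

lemma is_weak_grad_scale:
  assumes g: "is_weak_grad \<Omega> u g"
  shows "is_weak_grad \<Omega> (c *\<^sub>C u) (\<lambda>x. c *s g x)"
  unfolding is_weak_grad_def
proof (intro conjI allI impI)
  show "(\<lambda>x. (c *s g x) $ i) \<in> L2 \<Omega>" for i
    using L2_scale[OF is_weak_gradD(1)[OF g]] by simp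
  fix \<phi> D i assume "test_fun \<Omega> \<phi> D"
  from is_weak_gradD(2)[OF g this, of i]
  show "(LINT x:\<Omega>|lebesgue. complex_of_real (D x $ i) * (c *\<^sub>C u) x)
         = - (LINT x:\<Omega>|lebesgue. complex_of_real (\<phi> x) * (c *s g x) $ i)"
    by (simp add: scaleC_fun_def scaleC_complex_def mult.left_commute)
qed

lemma is_weak_grad_cnj:
  assumes g: "is_weak_grad \<Omega> u g"
  shows "is_weak_grad \<Omega> (cnj_fun u) (\<lambda>x. \<chi> i. cnj (g x $ i))"
  unfolding is_weak_grad_def
proof (intro conjI allI impI)
  show "(\<lambda>x. (\<chi> i. cnj (g x $ i)) $ i) \<in> L2 \<Omega>" for i
    using L2_cnj[OF is_weak_gradD(1)[OF g]] by simp
  fix \<phi> D i assume "test_fun \<Omega> \<phi> D"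
  note E = is_weak_gradD(2)[OF g this, of i]
  have "(LINT x:\<Omega>|lebesgue. complex_of_real (D x $ i) * cnj_fun u x)
      = cnj (LINT x:\<Omega>|lebesgue. complex_of_real (D x $ i) * u x)"
    unfolding set_lebesgue_integral_def Bochner_Integration.integral_cnj[symmetric]
    by (rule Bochner_Integration.integral_cong) (auto simp: cnj_fun_def)
  moreover have "(LINT x:\<Omega>|lebesgue. complex_of_real (\<phi> x) * (\<chi> i. cnj (g x $ i)) $ i)
      = cnj (LINT x:\<Omega>|lebesgue. complex_of_real (\<phi> x) * g x $ i)"
    unfolding set_lebesgue_integral_def Bochner_Integration.integral_cnj[symmetric]
    by (rule Bochner_Integration.integral_cong) auto
  ultimately show "(LINT x:\<Omega>|lebesgue. complex_of_real (D x $ i) * cnj_fun u x)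
         = - (LINT x:\<Omega>|lebesgue. complex_of_real (\<phi> x) * (\<chi> i. cnj (g x $ i)) $ i)"
    unfolding E by simp
qed

context
  fixes \<Omega> :: "(real^'n::finite) set"
  assumes op: "open \<Omega>" and bd: "bounded \<Omega>"
begin

lemma is_weak_grad_add:
  assumes u: "u \<in> L2 \<Omega>" "is_weak_grad \<Omega> u g" and v: "v \<in> L2 \<Omega>" "is_weak_grad \<Omega> v h"
  shows "is_weak_grad \<Omega> (u + v) (\<lambda>x. g x + h x)"
  unfolding is_weak_grad_def
proof (intro conjI allI impI)
  show "(\<lambda>x. (g x + h x) $ i) \<in> L2 \<Omega>" for i
    using L2_add[OF is_weak_gradD(1)[OF u(2)] is_weak_gradD(1)[OF v(2)]] by simp
  fix \<phi> D i assume t: "test_fun \<Omega> \<phi> D"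
  note int = continuous_mult_integrable[OF op bd]
  show "(LINT x:\<Omega>|lebesgue. complex_of_real (D x $ i) * (u + v) x)
         = - (LINT x:\<Omega>|lebesgue. complex_of_real (\<phi> x) * (g x + h x) $ i)"
    using is_weak_gradD(2)[OF u(2) t, of i] is_weak_gradD(2)[OF v(2) t, of i]
      int[OF test_fun_continuous(2)[OF t] u(1)] int[OF test_fun_continuous(2)[OF t] v(1)]
      int[OF test_fun_continuous(1)[OF t] is_weak_gradD(1)[OF u(2)]]
      int[OF test_fun_continuous(1)[OF t] is_weak_gradD(1)[OF v(2)]]
    by (simp add: distrib_left set_integral_add)
qed

lemma is_weak_grad_unique:
  assumes g: "is_weak_grad \<Omega> u g" and h: "is_weak_grad \<Omega> u h"
  shows "AE x in lebesgue. x \<in> \<Omega> \<longrightarrow> g x = h x"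
proof -
  have "AE x in lebesgue. x \<in> \<Omega> \<longrightarrow> g x $ i - h x $ i = 0" for i
  proof (rule AE_zero[OF _ _ op])
    show "set_integrable lebesgue \<Omega> (\<lambda>x. g x $ i - h x $ i)"
      by (intro set_integral_diff L2_integrable[OF op bd] is_weak_gradD[OF g] is_weak_gradD[OF h])
    fix \<phi> D assume t: "test_fun \<Omega> \<phi> D"
    note int = continuous_mult_integrable[OF op bd test_fun_continuous(1)[OF t]]
    show "(LINT x:\<Omega>|lebesgue. complex_of_real (\<phi> x) * (g x $ i - h x $ i)) = 0"
      using is_weak_gradD(2)[OF g t, of i] is_weak_gradD(2)[OF h t, of i]
        int[OF is_weak_gradD(1)[OF g]] int[OF is_weak_gradD(1)[OF h]]
      by (simp add: right_diff_distrib set_integral_diff)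
  qed
  then have "AE x in lebesgue. \<forall>i. x \<in> \<Omega> \<longrightarrow> g x $ i - h x $ i = 0"
    unfolding AE_all_countable by blast
  then show ?thesis by (rule AE_mp) (auto simp: vec_eq_iff)
qed

end

section \<open>The space \<open>H\<^sup>1\<close> and the Helmholtz form\<close>

lemma helmholtz_form_commute:
  "helmholtz_form \<kappa> \<Omega> u v = helmholtz_form \<kappa> \<Omega> v u"
  by (simp add: helmholtz_form_def mult_ac)

lemma H1_weak_grad: "u \<in> H1 \<Omega> \<Longrightarrow> is_weak_grad \<Omega> u (weak_grad \<Omega> u)"
  unfolding weak_grad_def by (rule someI_ex[of "is_weak_grad \<Omega> u"]) (simp add: H1_def)

lemma H1_L2: "u \<in> H1 \<Omega> \<Longrightarrow> u \<in> L2 \<Omega>"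
  by (simp add: H1_def)

lemma H1_scale: "u \<in> H1 \<Omega> \<Longrightarrow> c *\<^sub>C u \<in> H1 \<Omega>"
  using is_weak_grad_scale L2_scale unfolding H1_def
  by (fastforce simp: scaleC_fun_def scaleC_complex_def)

lemma H1_cnj: "u \<in> H1 \<Omega> \<Longrightarrow> cnj_fun u \<in> H1 \<Omega>"
  using is_weak_grad_cnj L2_cnj unfolding H1_def cnj_fun_def by blast

lemma H1_restrict:
  assumes "u \<in> H1 \<Omega>" "\<Theta> \<subseteq> \<Omega>" "open \<Theta>" "\<And>x. x \<in> \<Theta> \<Longrightarrow> v x = u x"
  shows "v \<in> H1 \<Theta>"
proof -
  have "is_weak_grad \<Theta> v (weak_grad \<Omega> u)"
    by (rule is_weak_grad_restrict[OF H1_weak_grad[OF assms(1)] assms(2,3,4)])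
  moreover have "v \<in> L2 \<Theta>"
    by (rule L2_restrict[OF H1_L2[OF assms(1)] assms(2) _ assms(4)]) (use assms(3) in auto)
  ultimately show ?thesis by (auto simp: H1_def)
qed

context
  fixes \<Omega> :: "(real^'n::finite) set"
  assumes op: "open \<Omega>" and bd: "bounded \<Omega>"
begin

lemma H1_add: "u \<in> H1 \<Omega> \<Longrightarrow> v \<in> H1 \<Omega> \<Longrightarrow> u + v \<in> H1 \<Omega>"
  using is_weak_grad_add[OF op bd] L2_add unfolding H1_def plus_fun_def by blast

lemma H1_diff: "u \<in> H1 \<Omega> \<Longrightarrow> v \<in> H1 \<Omega> \<Longrightarrow> u - v \<in> H1 \<Omega>"
  using H1_add[of u "(-1) *\<^sub>C v"] H1_scale[of v \<Omega> "-1"] by (simp add: complex_vector.scale_minus_left)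

lemma is_weak_grad_zero: "is_weak_grad \<Omega> 0 (\<lambda>x. 0)"
  by (simp add: is_weak_grad_def L2_iff)

lemma H1_zero: "0 \<in> H1 \<Omega>"
  using is_weak_grad_zero unfolding H1_def by (auto simp: L2_iff)

text \<open>Under an integral, the gradient chosen by \<open>SOME\<close> may thus be replaced by an
  explicit one, such as the sum, multiple or conjugate of known gradients.\<close>

lemma weak_grad_AE: "u \<in> H1 \<Omega> \<Longrightarrow> is_weak_grad \<Omega> u g \<Longrightarrow>
    AE x in lebesgue. x \<in> \<Omega> \<longrightarrow> weak_grad \<Omega> u x = g x"
  by (rule is_weak_grad_unique[OF op bd H1_weak_grad])

lemma H1_norm_integrable:
  assumes u: "u \<in> L2 \<Omega>" "is_weak_grad \<Omega> u g"
  shows "set_integrable lebesgue \<Omega> (\<lambda>x. (cmod (u x))\<^sup>2 + (\<Sum>i\<in>UNIV. (cmod (g x $ i))\<^sup>2))"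
  by (intro set_integral_add set_integrable_sum L2_integrable_norm u(1) is_weak_gradD(1)[OF u(2)])

lemma H1_norm_eq:
  assumes u: "u \<in> L2 \<Omega>" "is_weak_grad \<Omega> u g"
  shows "H1_norm \<Omega> u = sqrt (LINT x:\<Omega>|lebesgue. (cmod (u x))\<^sup>2 + (\<Sum>i\<in>UNIV. (cmod (g x $ i))\<^sup>2))"
proof -
  have h: "u \<in> H1 \<Omega>" using u by (auto simp: H1_def)
  have "(LINT x:\<Omega>|lebesgue. (cmod (u x))\<^sup>2 + (\<Sum>i\<in>UNIV. (cmod (weak_grad \<Omega> u x $ i))\<^sup>2))
      = (LINT x:\<Omega>|lebesgue. (cmod (u x))\<^sup>2 + (\<Sum>i\<in>UNIV. (cmod (g x $ i))\<^sup>2))"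
    unfolding set_lebesgue_integral_def
  proof (rule integral_cong_AE)
    show "AE x in lebesgue. indicator \<Omega> x *\<^sub>R ((cmod (u x))\<^sup>2 + (\<Sum>i\<in>UNIV. (cmod (weak_grad \<Omega> u x $ i))\<^sup>2))
      = indicator \<Omega> x *\<^sub>R ((cmod (u x))\<^sup>2 + (\<Sum>i\<in>UNIV. (cmod (g x $ i))\<^sup>2))"
      using weak_grad_AE[OF h u(2)] by (rule AE_mp) (auto simp: indicator_def)
  qed (intro borel_measurable_integrable H1_norm_integrable[unfolded set_integrable_def] u H1_weak_grad h)+
  then show ?thesis by (simp add: H1_norm_def)
qed

lemma H1_norm_nonneg: "H1_norm \<Omega> u \<ge> 0"
  unfolding H1_norm_def set_lebesgue_integral_def
  by (intro real_sqrt_ge_zero integral_nonneg_AE AE_I2) (auto intro!: mult_nonneg_nonneg add_nonneg_nonneg sum_nonneg)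

lemma H1_norm_zero: "H1_norm \<Omega> 0 = 0"
  using H1_norm_eq[OF H1_L2[OF H1_zero] is_weak_grad_zero] by simp

lemma H1_norm_power2:
  assumes u: "u \<in> L2 \<Omega>" "is_weak_grad \<Omega> u g"
  shows "(H1_norm \<Omega> u)\<^sup>2 = (LINT x:\<Omega>|lebesgue. (cmod (u x))\<^sup>2 + (\<Sum>i\<in>UNIV. (cmod (g x $ i))\<^sup>2))"
  unfolding H1_norm_eq[OF u]
  by (rule real_sqrt_pow2, unfold set_lebesgue_integral_def, intro integral_nonneg_AE AE_I2)
    (auto intro!: mult_nonneg_nonneg add_nonneg_nonneg sum_nonneg)

lemma H1_norm_scale:
  assumes u: "u \<in> H1 \<Omega>"
  shows "H1_norm \<Omega> (c *\<^sub>C u) = cmod c * H1_norm \<Omega> u"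
proof -
  note g = H1_weak_grad[OF u]
  have "H1_norm \<Omega> (c *\<^sub>C u) = sqrt ((cmod c)\<^sup>2 * (LINT x:\<Omega>|lebesgue. (cmod (u x))\<^sup>2 +
      (\<Sum>i\<in>UNIV. (cmod (weak_grad \<Omega> u x $ i))\<^sup>2)))"
    using H1_norm_eq[OF H1_L2[OF H1_scale[OF u]] is_weak_grad_scale[OF g], of c]
    by (simp add: scaleC_fun_def scaleC_complex_def norm_mult power_mult_distrib
        sum_distrib_left[symmetric] distrib_left[symmetric])
  then show ?thesis by (simp add: H1_norm_def real_sqrt_mult)
qed

text \<open>The factor 2 comes from integrating the pointwise bound |a + b|^2 \<le> 2|a|^2 + 2|b|^2
  instead of proving Minkowski's inequality; for sequences tending to 0 it is harmless.\<close>

lemma H1_norm_add_le: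
  assumes u: "u \<in> H1 \<Omega>" and v: "v \<in> H1 \<Omega>"
  shows "H1_norm \<Omega> (u + v) \<le> 2 * (H1_norm \<Omega> u + H1_norm \<Omega> v)"
proof (rule power2_le_imp_le)
  define g h where "g = weak_grad \<Omega> u" and "h = weak_grad \<Omega> v"
  have g: "u \<in> L2 \<Omega>" "is_weak_grad \<Omega> u g" and h: "v \<in> L2 \<Omega>" "is_weak_grad \<Omega> v h"
    using u v by (auto simp: g_def h_def H1_L2 H1_weak_grad)
  have uv: "u + v \<in> L2 \<Omega>" "is_weak_grad \<Omega> (u + v) (\<lambda>x. g x + h x)"
    using H1_L2[OF H1_add[OF u v]] is_weak_grad_add[OF op bd g h] by auto
  let ?I = "\<lambda>u g x. (cmod (u x))\<^sup>2 + (\<Sum>i\<in>UNIV. (cmod (g x $ i))\<^sup>2)"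
  have iu: "set_integrable lebesgue \<Omega> (\<lambda>x. 2 * ?I u g x)" and iv: "set_integrable lebesgue \<Omega> (\<lambda>x. 2 * ?I v h x)"
    by (intro set_integrable_mult_right H1_norm_integrable g h)+
  have "(H1_norm \<Omega> (u + v))\<^sup>2 = (LINT x:\<Omega>|lebesgue. ?I (u + v) (\<lambda>x. g x + h x) x)"
    by (rule H1_norm_power2[OF uv])
  also have "\<dots> \<le> (LINT x:\<Omega>|lebesgue. 2 * ?I u g x + 2 * ?I v h x)"
  proof (rule set_integral_mono[OF H1_norm_integrable[OF uv] set_integral_add(1)[OF iu iv]])
    fix x
    have "(\<Sum>i\<in>UNIV. (cmod ((g x + h x) $ i))\<^sup>2)
        \<le> (\<Sum>i\<in>UNIV. 2 * (cmod (g x $ i))\<^sup>2 + 2 * (cmod (h x $ i))\<^sup>2)"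
      by (intro sum_mono) (simp add: cmod_add_power2_le)
    then show "?I (u + v) (\<lambda>x. g x + h x) x \<le> 2 * ?I u g x + 2 * ?I v h x"
      using cmod_add_power2_le[of "u x" "v x"] by (simp add: sum.distrib sum_distrib_left[symmetric])
  qed
  also have "\<dots> = 2 * (H1_norm \<Omega> u)\<^sup>2 + 2 * (H1_norm \<Omega> v)\<^sup>2"
    unfolding set_integral_add(2)[OF iu iv] H1_norm_power2[OF g] H1_norm_power2[OF h]
    by (simp only: set_integral_mult_right)
  also have "\<dots> \<le> (2 * (H1_norm \<Omega> u + H1_norm \<Omega> v))\<^sup>2"
    using H1_norm_nonneg by (simp add: power2_eq_square algebra_simps)
  finally show "(H1_norm \<Omega> (u + v))\<^sup>2 \<le> (2 * (H1_norm \<Omega> u + H1_norm \<Omega> v))\<^sup>2" .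
  show "0 \<le> 2 * (H1_norm \<Omega> u + H1_norm \<Omega> v)" using H1_norm_nonneg by simp
qed

section \<open>Bilinearity and sign of the Helmholtz form\<close>

context
  fixes \<kappa> :: "'n cfun"
  assumes \<kappa>: "\<kappa> \<in> borel_measurable lebesgue" "\<exists>C. AE x in lebesgue. cmod (\<kappa> x) \<le> C"
begin

lemma helmholtz_integrable:
  assumes "u \<in> L2 \<Omega>" "is_weak_grad \<Omega> u g" and "v \<in> L2 \<Omega>" "is_weak_grad \<Omega> v h"
  shows "set_integrable lebesgue \<Omega> (\<lambda>x. (\<Sum>i\<in>UNIV. g x $ i * h x $ i) - (\<kappa> x)\<^sup>2 * u x * v x)"
proof (intro set_integral_diff set_integrable_sum L2_mult_integrable is_weak_gradD(1)[OF assms(2)]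
    is_weak_gradD(1)[OF assms(4)] assms(3))
  obtain C where C: "AE x in lebesgue. cmod (\<kappa> x) \<le> C" using \<kappa>(2) by blast
  show "(\<lambda>x. (\<kappa> x)\<^sup>2 * u x) \<in> L2 \<Omega>"
  proof (rule L2_bounded_mult[OF _ _ assms(1)])
    show "(\<lambda>x. (\<kappa> x)\<^sup>2) \<in> borel_measurable lebesgue" using \<kappa>(1) by (rule borel_measurable_power)
    show "AE x in lebesgue. x \<in> \<Omega> \<longrightarrow> cmod ((\<kappa> x)\<^sup>2) \<le> C\<^sup>2"
      using C by (rule AE_mp) (auto simp: norm_power intro!: power_mono)
  qed
qed

lemma helmholtz_form_eq:
  assumes u: "u \<in> L2 \<Omega>" "is_weak_grad \<Omega> u g" and v: "v \<in> L2 \<Omega>" "is_weak_grad \<Omega> v h"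
  shows "helmholtz_form \<kappa> \<Omega> u v =
    (LINT x:\<Omega>|lebesgue. (\<Sum>i\<in>UNIV. g x $ i * h x $ i) - (\<kappa> x)\<^sup>2 * u x * v x)"
  unfolding helmholtz_form_def set_lebesgue_integral_def
proof (rule integral_cong_AE)
  have U: "u \<in> H1 \<Omega>" and V: "v \<in> H1 \<Omega>" using u v by (auto simp: H1_def)
  show "(\<lambda>x. indicator \<Omega> x *\<^sub>R ((\<Sum>i\<in>UNIV. weak_grad \<Omega> u x $ i * weak_grad \<Omega> v x $ i) - (\<kappa> x)\<^sup>2 * u x * v x))
      \<in> borel_measurable lebesgue"
    using helmholtz_integrable[OF u(1) H1_weak_grad[OF U] v(1) H1_weak_grad[OF V]]
    unfolding set_integrable_def by (rule borel_measurable_integrable)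
  show "(\<lambda>x. indicator \<Omega> x *\<^sub>R ((\<Sum>i\<in>UNIV. g x $ i * h x $ i) - (\<kappa> x)\<^sup>2 * u x * v x))
      \<in> borel_measurable lebesgue"
    using helmholtz_integrable[OF u v]
    unfolding set_integrable_def by (rule borel_measurable_integrable)
  from weak_grad_AE[OF U u(2)] weak_grad_AE[OF V v(2)]
  show "AE x in lebesgue. indicator \<Omega> x *\<^sub>R ((\<Sum>i\<in>UNIV. weak_grad \<Omega> u x $ i * weak_grad \<Omega> v x $ i) - (\<kappa> x)\<^sup>2 * u x * v x)
      = indicator \<Omega> x *\<^sub>R ((\<Sum>i\<in>UNIV. g x $ i * h x $ i) - (\<kappa> x)\<^sup>2 * u x * v x)"
    by eventually_elim (auto simp: indicator_def)
qed

lemma helmholtz_form_add: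
  assumes u: "u \<in> H1 \<Omega>" and v: "v \<in> H1 \<Omega>" and w: "w \<in> H1 \<Omega>"
  shows "helmholtz_form \<kappa> \<Omega> (u + v) w = helmholtz_form \<kappa> \<Omega> u w + helmholtz_form \<kappa> \<Omega> v w"
proof -
  define g h k where "g = weak_grad \<Omega> u" and "h = weak_grad \<Omega> v" and "k = weak_grad \<Omega> w"
  have g: "u \<in> L2 \<Omega>" "is_weak_grad \<Omega> u g" and h: "v \<in> L2 \<Omega>" "is_weak_grad \<Omega> v h"
    and k: "w \<in> L2 \<Omega>" "is_weak_grad \<Omega> w k"
    using u v w by (auto simp: g_def h_def k_def H1_L2 H1_weak_grad)
  have uv: "u + v \<in> L2 \<Omega>" "is_weak_grad \<Omega> (u + v) (\<lambda>x. g x + h x)"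
    using H1_L2[OF H1_add[OF u v]] is_weak_grad_add[OF op bd g h] by auto
  show ?thesis
    unfolding helmholtz_form_eq[OF uv k] helmholtz_form_eq[OF g k] helmholtz_form_eq[OF h k]
      set_integral_add(2)[OF helmholtz_integrable[OF g k] helmholtz_integrable[OF h k], symmetric]
    by (simp add: algebra_simps sum.distrib)
qed

lemma helmholtz_form_scale:
  assumes u: "u \<in> H1 \<Omega>" and w: "w \<in> H1 \<Omega>"
  shows "helmholtz_form \<kappa> \<Omega> (c *\<^sub>C u) w = c * helmholtz_form \<kappa> \<Omega> u w"
proof -
  define g k where "g = weak_grad \<Omega> u" and "k = weak_grad \<Omega> w"
  have g: "u \<in> L2 \<Omega>" "is_weak_grad \<Omega> u g" and k: "w \<in> L2 \<Omega>" "is_weak_grad \<Omega> w k"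
    using u w by (auto simp: g_def k_def H1_L2 H1_weak_grad)
  have cu: "c *\<^sub>C u \<in> L2 \<Omega>" "is_weak_grad \<Omega> (c *\<^sub>C u) (\<lambda>x. c *s g x)"
    using H1_L2[OF H1_scale[OF u]] is_weak_grad_scale[OF g(2)] by auto
  have "(\<Sum>i\<in>UNIV. (c *s g x) $ i * k x $ i) - (\<kappa> x)\<^sup>2 * (c *\<^sub>C u) x * w x
      = c * ((\<Sum>i\<in>UNIV. g x $ i * k x $ i) - (\<kappa> x)\<^sup>2 * u x * w x)" for x
    by (simp add: scaleC_fun_def scaleC_complex_def right_diff_distrib sum_distrib_left mult_ac)
  then show ?thesis
    unfolding helmholtz_form_eq[OF cu k] helmholtz_form_eq[OF g k] by simp
qed

text \<open>Against the conjugate, the gradient part of the integrand is a sum of squared moduli and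
  hence real; what remains is minus Im (\<open>\<kappa>\<close> squared) times |u|^2.\<close>

lemma helmholtz_form_cnj:
  assumes u: "u \<in> H1 \<Omega>" and im: "\<And>x. x \<in> \<Omega> \<Longrightarrow> Im ((\<kappa> x)\<^sup>2) \<ge> 0"
  shows "Im (helmholtz_form \<kappa> \<Omega> u (cnj_fun u)) \<le> 0"
proof -
  define g where "g = weak_grad \<Omega> u"
  have g: "u \<in> L2 \<Omega>" "is_weak_grad \<Omega> u g" using u by (auto simp: g_def H1_L2 H1_weak_grad)
  have c: "cnj_fun u \<in> L2 \<Omega>" "is_weak_grad \<Omega> (cnj_fun u) (\<lambda>x. \<chi> i. cnj (g x $ i))"
    using H1_L2[OF H1_cnj[OF u]] is_weak_grad_cnj[OF g(2)] by auto
  let ?f = "\<lambda>x. indicator \<Omega> x *\<^sub>R ((\<Sum>i\<in>UNIV. g x $ i * (\<chi> i. cnj (g x $ i)) $ i) - (\<kappa> x)\<^sup>2 * u x * cnj_fun u x)"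
  have int: "integrable lebesgue ?f"
    using helmholtz_integrable[OF g c] by (simp add: set_integrable_def)
  have "Im (helmholtz_form \<kappa> \<Omega> u (cnj_fun u)) = (LINT x|lebesgue. Im (?f x))"
    unfolding helmholtz_form_eq[OF g c] set_lebesgue_integral_def
    by (rule integral_Im[symmetric, OF int])
  also have "\<dots> \<le> (LINT x|(lebesgue :: (real^'n) measure). 0)"
  proof (rule integral_mono_AE)
    show "integrable lebesgue (\<lambda>x. Im (?f x))" using int by (rule integrable_Im)
    have "Im (g x $ i * cnj (g x $ i)) = 0" for i x by simp
    moreover have "Im ((\<kappa> x)\<^sup>2 * u x * cnj (u x)) = Im ((\<kappa> x)\<^sup>2) * (cmod (u x))\<^sup>2" for x
      by (simp only: mult.assoc complex_norm_square[symmetric]) simp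
    ultimately have "Im (?f x) \<le> 0" for x
      using im[of x] by (simp add: cnj_fun_def indicator_def)
    then show "AE x in lebesgue. Im (?f x) \<le> 0" by (rule AE_I2)
  qed simp
  finally show ?thesis by simp
qed

end

end

section \<open>Traces\<close>

text \<open>Makes Borel functions measurable for the surface measure, as the additivity of
  \<open>nn_integral\<close> requires.\<close>

lemma sets_surface_measure: "sets surface_measure = sets borel"
  using sets.sigma_sets_eq[of borel] by (simp add: surface_measure_def)

lemma restr_measurable:
  assumes "continuous_on (closure \<Omega>) u"
  shows "restr (frontier \<Omega>) u \<in> borel_measurable borel"
proof -
  have "continuous_on (frontier \<Omega>) u"
    using assms by (rule continuous_on_subset) (simp add: frontier_def)
  then have "(\<lambda>x. indicator (frontier \<Omega>) x *\<^sub>R u x) \<in> borel_measurable borel"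
    by (intro borel_measurable_continuous_on_indicator) auto
  moreover have "(\<lambda>x. indicator (frontier \<Omega>) x *\<^sub>R u x) = restr (frontier \<Omega>) u"
    by (auto simp: restr_def fun_eq_iff)
  ultimately show ?thesis by simp
qed

text \<open>The squared boundary error in \<open>has_trace\<close>, named in order to be estimated
  like a squared seminorm. It may be infinite, hence the type.\<close>

definition trace_error :: "(real^'n) set \<Rightarrow> 'n::finite cfun \<Rightarrow> 'n cfun \<Rightarrow> ennreal"
  where "trace_error \<Omega> u g =
    (\<integral>\<^sup>+x. ennreal ((cmod (restr (frontier \<Omega>) u x - g x))\<^sup>2) \<partial>surface_measure)"

lemma trace_error_measurable:
  assumes "continuous_on (closure \<Omega>) u" "g \<in> borel_measurable borel"
  shows "(\<lambda>x. ennreal ((cmod (restr (frontier \<Omega>) u x - g x))\<^sup>2)) \<in> borel_measurable surface_measure"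
proof -
  have "(\<lambda>x. ennreal ((cmod (restr (frontier \<Omega>) u x - g x))\<^sup>2)) \<in> borel_measurable borel"
    using restr_measurable[OF assms(1)] assms(2) by measurable
  then show ?thesis by (simp add: measurable_cong_sets[OF sets_surface_measure refl])
qed

lemma trace_error_add_le:
  assumes "continuous_on (closure \<Omega>) u" "g \<in> borel_measurable borel"
    and "continuous_on (closure \<Omega>) v" "h \<in> borel_measurable borel"
  shows "trace_error \<Omega> (u + v) (g + h) \<le> 2 * trace_error \<Omega> u g + 2 * trace_error \<Omega> v h"
proof -
  let ?e = "\<lambda>u g x. ennreal ((cmod (restr (frontier \<Omega>) u x - g x))\<^sup>2)"
  note m = trace_error_measurable[OF assms(1,2)] trace_error_measurable[OF assms(3,4)]
  have "trace_error \<Omega> (u + v) (g + h) \<le> (\<integral>\<^sup>+x. 2 * ?e u g x + 2 * ?e v h x \<partial>surface_measure)"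
    unfolding trace_error_def
  proof (rule nn_integral_mono)
    fix x
    define a b where "a = restr (frontier \<Omega>) u x - g x" and "b = restr (frontier \<Omega>) v x - h x"
    have "?e (u + v) (g + h) x = ennreal ((cmod (a + b))\<^sup>2)"
      by (simp add: a_def b_def restr_def add_diff_add)
    also have "\<dots> \<le> ennreal (2 * (cmod a)\<^sup>2 + 2 * (cmod b)\<^sup>2)"
      by (rule ennreal_leI[OF cmod_add_power2_le])
    also have "\<dots> = 2 * ennreal ((cmod a)\<^sup>2) + 2 * ennreal ((cmod b)\<^sup>2)"
      by (simp add: ennreal_plus ennreal_mult'')
    finally show "?e (u + v) (g + h) x \<le> 2 * ?e u g x + 2 * ?e v h x"
      by (simp only: a_def b_def)
  qed
  also have "\<dots> = 2 * trace_error \<Omega> u g + 2 * trace_error \<Omega> v h"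
    unfolding trace_error_def using m
    by (subst nn_integral_add) (simp_all add: nn_integral_cmult)
  finally show ?thesis .
qed

lemma trace_error_scale:
  assumes "continuous_on (closure \<Omega>) u" "g \<in> borel_measurable borel"
  shows "trace_error \<Omega> (c *\<^sub>C u) (c *\<^sub>C g) = ennreal ((cmod c)\<^sup>2) * trace_error \<Omega> u g"
proof -
  have "ennreal ((cmod (restr (frontier \<Omega>) (c *\<^sub>C u) x - (c *\<^sub>C g) x))\<^sup>2)
      = ennreal ((cmod c)\<^sup>2) * ennreal ((cmod (restr (frontier \<Omega>) u x - g x))\<^sup>2)" for x
  proof -
    have "restr (frontier \<Omega>) (c *\<^sub>C u) x - (c *\<^sub>C g) x = c * (restr (frontier \<Omega>) u x - g x)"
      by (simp add: restr_def right_diff_distrib)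
    then show ?thesis by (simp add: norm_mult power_mult_distrib ennreal_mult)
  qed
  then show ?thesis
    unfolding trace_error_def using trace_error_measurable[OF assms] by (simp add: nn_integral_cmult)
qed

lemma has_traceE:
  assumes "has_trace \<Omega> u g"
  obtains \<phi> where "g \<in> borel_measurable borel" "\<And>x. x \<notin> frontier \<Omega> \<Longrightarrow> g x = 0"
    "\<And>n. \<phi> n \<in> H1 \<Omega>" "\<And>n. continuous_on (closure \<Omega>) (\<phi> n)"
    "(\<lambda>n. H1_norm \<Omega> (\<phi> n - u)) \<longlonglongrightarrow> 0" "(\<lambda>n. trace_error \<Omega> (\<phi> n) g) \<longlonglongrightarrow> 0"
  using assms unfolding has_trace_def trace_error_def[symmetric] by auto

lemma has_traceI:
  assumes "g \<in> borel_measurable borel" "\<And>x. x \<notin> frontier \<Omega> \<Longrightarrow> g x = 0"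
    "\<And>n. \<phi> n \<in> H1 \<Omega>" "\<And>n. continuous_on (closure \<Omega>) (\<phi> n)"
    "(\<lambda>n. H1_norm \<Omega> (\<phi> n - u)) \<longlonglongrightarrow> 0" "(\<lambda>n. trace_error \<Omega> (\<phi> n) g) \<longlonglongrightarrow> 0"
  shows "has_trace \<Omega> u g"
  unfolding has_trace_def trace_error_def[symmetric] using assms by auto

context
  fixes \<Omega> :: "(real^'n::finite) set"
  assumes op: "open \<Omega>" and bd: "bounded \<Omega>"
begin

lemma has_trace_add:
  assumes u: "u \<in> H1 \<Omega>" "has_trace \<Omega> u g" and v: "v \<in> H1 \<Omega>" "has_trace \<Omega> v h"
  shows "has_trace \<Omega> (u + v) (g + h)"
proof -
  obtain \<phi> where \<phi>: "g \<in> borel_measurable borel" "\<And>x. x \<notin> frontier \<Omega> \<Longrightarrow> g x = 0"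
    "\<And>n. \<phi> n \<in> H1 \<Omega>" "\<And>n. continuous_on (closure \<Omega>) (\<phi> n)"
    "(\<lambda>n. H1_norm \<Omega> (\<phi> n - u)) \<longlonglongrightarrow> 0" "(\<lambda>n. trace_error \<Omega> (\<phi> n) g) \<longlonglongrightarrow> 0"
    by (rule has_traceE[OF u(2)]) (rule that)
  obtain \<psi> where \<psi>: "h \<in> borel_measurable borel" "\<And>x. x \<notin> frontier \<Omega> \<Longrightarrow> h x = 0"
    "\<And>n. \<psi> n \<in> H1 \<Omega>" "\<And>n. continuous_on (closure \<Omega>) (\<psi> n)"
    "(\<lambda>n. H1_norm \<Omega> (\<psi> n - v)) \<longlonglongrightarrow> 0" "(\<lambda>n. trace_error \<Omega> (\<psi> n) h) \<longlonglongrightarrow> 0"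
    by (rule has_traceE[OF v(2)]) (rule that)
  show ?thesis
  proof (rule has_traceI[where \<phi> = "\<lambda>n. \<phi> n + \<psi> n"])
    show "g + h \<in> borel_measurable borel"
      unfolding plus_fun_def by (rule borel_measurable_add[OF \<phi>(1) \<psi>(1)])
    show "(g + h) x = 0" if "x \<notin> frontier \<Omega>" for x using \<phi>(2)[OF that] \<psi>(2)[OF that] by simp
    show "\<phi> n + \<psi> n \<in> H1 \<Omega>" for n by (rule H1_add[OF op bd \<phi>(3) \<psi>(3)])
    show "continuous_on (closure \<Omega>) (\<phi> n + \<psi> n)" for n
      unfolding plus_fun_def by (rule continuous_on_add[OF \<phi>(4) \<psi>(4)])
    show "(\<lambda>n. H1_norm \<Omega> (\<phi> n + \<psi> n - (u + v))) \<longlonglongrightarrow> 0"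
    proof (rule tendsto_sandwich[OF _ _ tendsto_const])
      show "\<forall>\<^sub>F n in sequentially. 0 \<le> H1_norm \<Omega> (\<phi> n + \<psi> n - (u + v))"
        by (simp add: H1_norm_nonneg[OF op bd])
      have "H1_norm \<Omega> (\<phi> n + \<psi> n - (u + v)) \<le> 2 * (H1_norm \<Omega> (\<phi> n - u) + H1_norm \<Omega> (\<psi> n - v))" for n
        using H1_norm_add_le[OF op bd H1_diff[OF op bd \<phi>(3)[of n] u(1)] H1_diff[OF op bd \<psi>(3)[of n] v(1)]]
        by (simp add: add_diff_add)
      then show "\<forall>\<^sub>F n in sequentially. H1_norm \<Omega> (\<phi> n + \<psi> n - (u + v))
          \<le> 2 * (H1_norm \<Omega> (\<phi> n - u) + H1_norm \<Omega> (\<psi> n - v))" by simp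
      show "(\<lambda>n. 2 * (H1_norm \<Omega> (\<phi> n - u) + H1_norm \<Omega> (\<psi> n - v))) \<longlonglongrightarrow> 0"
        using tendsto_mult[OF tendsto_const[of 2] tendsto_add[OF \<phi>(5) \<psi>(5)]] by simp
    qed
    show "(\<lambda>n. trace_error \<Omega> (\<phi> n + \<psi> n) (g + h)) \<longlonglongrightarrow> 0"
    proof (rule tendsto_sandwich[OF _ _ tendsto_const])
      show "\<forall>\<^sub>F n in sequentially. 0 \<le> trace_error \<Omega> (\<phi> n + \<psi> n) (g + h)" by simp
      show "\<forall>\<^sub>F n in sequentially. trace_error \<Omega> (\<phi> n + \<psi> n) (g + h)
          \<le> 2 * trace_error \<Omega> (\<phi> n) g + 2 * trace_error \<Omega> (\<psi> n) h"
        by (intro always_eventually allI trace_error_add_le \<phi> \<psi>)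
      have "(\<lambda>n. 2 * trace_error \<Omega> (\<phi> n) g + 2 * trace_error \<Omega> (\<psi> n) h) \<longlonglongrightarrow> 2 * 0 + 2 * 0"
        by (intro tendsto_add ennreal_tendsto_cmult \<phi>(6) \<psi>(6)) auto
      then show "(\<lambda>n. 2 * trace_error \<Omega> (\<phi> n) g + 2 * trace_error \<Omega> (\<psi> n) h) \<longlonglongrightarrow> 0" by simp
    qed
  qed
qed

lemma has_trace_scale:
  assumes u: "u \<in> H1 \<Omega>" "has_trace \<Omega> u g"
  shows "has_trace \<Omega> (c *\<^sub>C u) (c *\<^sub>C g)"
proof -
  obtain \<phi> where \<phi>: "g \<in> borel_measurable borel" "\<And>x. x \<notin> frontier \<Omega> \<Longrightarrow> g x = 0"
    "\<And>n. \<phi> n \<in> H1 \<Omega>" "\<And>n. continuous_on (closure \<Omega>) (\<phi> n)"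
    "(\<lambda>n. H1_norm \<Omega> (\<phi> n - u)) \<longlonglongrightarrow> 0" "(\<lambda>n. trace_error \<Omega> (\<phi> n) g) \<longlonglongrightarrow> 0"
    by (rule has_traceE[OF u(2)]) (rule that)
  show ?thesis
  proof (rule has_traceI[where \<phi> = "\<lambda>n. c *\<^sub>C \<phi> n"])
    show "c *\<^sub>C g \<in> borel_measurable borel"
      using \<phi>(1) by (simp add: scaleC_fun_def scaleC_complex_def)
    show "(c *\<^sub>C g) x = 0" if "x \<notin> frontier \<Omega>" for x using \<phi>(2)[OF that] by simp
    show "c *\<^sub>C \<phi> n \<in> H1 \<Omega>" for n by (rule H1_scale[OF \<phi>(3)])
    show "continuous_on (closure \<Omega>) (c *\<^sub>C \<phi> n)" for n
      unfolding scaleC_fun_def scaleC_complex_def by (rule continuous_on_mult_left[OF \<phi>(4)])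
    have "H1_norm \<Omega> (c *\<^sub>C \<phi> n - c *\<^sub>C u) = cmod c * H1_norm \<Omega> (\<phi> n - u)" for n
      using H1_norm_scale[OF op bd H1_diff[OF op bd \<phi>(3)[of n] u(1)], of c]
      by (simp add: complex_vector.scale_right_diff_distrib)
    then show "(\<lambda>n. H1_norm \<Omega> (c *\<^sub>C \<phi> n - c *\<^sub>C u)) \<longlonglongrightarrow> 0"
      using tendsto_mult[OF tendsto_const[of "cmod c"] \<phi>(5)] by simp
    have "(\<lambda>n. ennreal ((cmod c)\<^sup>2) * trace_error \<Omega> (\<phi> n) g) \<longlonglongrightarrow> ennreal ((cmod c)\<^sup>2) * 0"
      by (intro ennreal_tendsto_cmult \<phi>(6)) simp
    then show "(\<lambda>n. trace_error \<Omega> (c *\<^sub>C \<phi> n) (c *\<^sub>C g)) \<longlonglongrightarrow> 0"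
      using trace_error_scale[OF \<phi>(4) \<phi>(1)] by simp
  qed
qed

text \<open>The constant sequence is admissible, with both errors equal to 0. In this way boundary
  values of finite element functions get into \<open>H_half\<close>.\<close>

lemma has_trace_restr:
  assumes u: "u \<in> H1 \<Omega>" "continuous_on (closure \<Omega>) u"
  shows "has_trace \<Omega> u (restr (frontier \<Omega>) u)"
proof (rule has_traceI[where \<phi> = "\<lambda>n. u"])
  show "restr (frontier \<Omega>) u \<in> borel_measurable borel" by (rule restr_measurable[OF u(2)])
  show "restr (frontier \<Omega>) u x = 0" if "x \<notin> frontier \<Omega>" for x using that by (simp add: restr_def)
qed (use u in \<open>simp_all add: H1_norm_zero[OF op bd] trace_error_def\<close>)

text \<open>Differences of representatives must stay in the domain of the functionals of
  \<open>H_mhalf\<close> before these can be shown not to separate equivalent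
  representatives.\<close>

lemma subspace_H_half: "complex_vector.subspace (H_half \<Omega>)"
  unfolding complex_vector.subspace_def
proof (intro conjI ballI allI)
  have "restr (frontier \<Omega>) 0 = (0 :: 'n cfun)" by (simp add: restr_def fun_eq_iff)
  moreover have "continuous_on (closure \<Omega>) (0 :: 'n cfun)" by (simp add: zero_fun_def)
  ultimately show "0 \<in> H_half \<Omega>"
    using has_trace_restr[OF H1_zero[OF op bd]] H1_zero[OF op bd] unfolding H_half_def by auto
next
  fix g h assume "g \<in> H_half \<Omega>" "h \<in> H_half \<Omega>"
  then obtain u v where "u \<in> H1 \<Omega>" "has_trace \<Omega> u g" "v \<in> H1 \<Omega>" "has_trace \<Omega> v h"
    by (auto simp: H_half_def)
  then show "g + h \<in> H_half \<Omega>"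
    using has_trace_add H1_add[OF op bd] unfolding H_half_def by blast
next
  fix c g assume "g \<in> H_half \<Omega>"
  then obtain u where "u \<in> H1 \<Omega>" "has_trace \<Omega> u g" by (auto simp: H_half_def)
  then show "c *\<^sub>C g \<in> H_half \<Omega>"
    using has_trace_scale H1_scale unfolding H_half_def by blast
qed

section \<open>Bilinearity of the boundary pairing on representatives\<close>

text \<open>A functional bounded by the seminorm vanishes on differences of seminorm zero. This
  turns linearity up to \<open>boundary_eq\<close> into linearity after pairing.\<close>

lemma H_mhalf_cong:
  assumes f: "f \<in> H_mhalf \<Omega>" and g: "g \<in> H_half \<Omega>" and h: "h \<in> H_half \<Omega>"
    and eq: "trace_norm \<Omega> (g - h) = 0"
  shows "f g = f h"
proof -
  have d: "g - h \<in> H_half \<Omega>" by (rule complex_vector.subspace_diff[OF subspace_H_half g h])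
  have lin: "f \<in> cdual (H_half \<Omega>)" using f by (simp add: H_mhalf_def)
  obtain C where "\<forall>g\<in>H_half \<Omega>. cmod (f g) \<le> C * trace_norm \<Omega> g"
    using f by (auto simp: H_mhalf_def)
  then have "cmod (f (g - h)) \<le> C * trace_norm \<Omega> (g - h)" using d by blast
  then have "f (g - h) = 0" using eq by simp
  then show ?thesis using clinear_on_diff[OF cdualD(1)[OF lin] subspace_H_half g h] by simp
qed

context
  fixes \<A> :: "'n cfun \<times> ('n cfun \<Rightarrow> complex) \<Rightarrow> ('n cfun \<Rightarrow> complex) \<times> 'n cfun"
  assumes \<A>: "bounded_boundary_op \<Omega> \<A>"
begin

lemma boundary_op_in: "x \<in> H_half \<Omega> \<times> H_mhalf \<Omega> \<Longrightarrow> \<A> x \<in> H_mhalf \<Omega> \<times> H_half \<Omega>"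
  using \<A> unfolding bounded_boundary_op_def Let_def by blast

lemma boundary_pairing_right:
  assumes x: "x \<in> H_half \<Omega> \<times> H_mhalf \<Omega>"
    and y: "y \<in> H_half \<Omega> \<times> H_mhalf \<Omega>" and z: "z \<in> H_half \<Omega> \<times> H_mhalf \<Omega>"
  shows "boundary_pairing (\<A> x) (y + z) = boundary_pairing (\<A> x) y + boundary_pairing (\<A> x) z"
    and "boundary_pairing (\<A> x) (c *\<^sub>C y) = c * boundary_pairing (\<A> x) y"
proof -
  have lin: "fst (\<A> x) \<in> cdual (H_half \<Omega>)"
    using boundary_op_in[OF x] by (auto simp: H_mhalf_def)
  have mem: "fst y \<in> H_half \<Omega>" "fst z \<in> H_half \<Omega>" using y z by auto
  show "boundary_pairing (\<A> x) (y + z) = boundary_pairing (\<A> x) y + boundary_pairing (\<A> x) z"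
    using cdual_add[OF lin mem] by (simp add: boundary_pairing_def)
  show "boundary_pairing (\<A> x) (c *\<^sub>C y) = c * boundary_pairing (\<A> x) y"
    using cdual_scale[OF lin mem(1)] by (simp add: boundary_pairing_def scaleC_prod_def distrib_left)
qed

text \<open>The second components of \<open>\<A> (x + y)\<close> and \<open>\<A> x + \<A> y\<close>
  may differ as functions, but \<open>snd z\<close> takes the same value on them. Membership of the
  sum or multiple is a premise; in the application it is inherited from the subspace
  \<open>V\<close>.\<close>

lemma boundary_pairing_left:
  assumes x: "x \<in> H_half \<Omega> \<times> H_mhalf \<Omega>"
    and y: "y \<in> H_half \<Omega> \<times> H_mhalf \<Omega>" and z: "z \<in> H_half \<Omega> \<times> H_mhalf \<Omega>"
  shows "x + y \<in> H_half \<Omega> \<times> H_mhalf \<Omega> \<Longrightarrow>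
      boundary_pairing (\<A> (x + y)) z = boundary_pairing (\<A> x) z + boundary_pairing (\<A> y) z"
    and "c *\<^sub>C x \<in> H_half \<Omega> \<times> H_mhalf \<Omega> \<Longrightarrow>
      boundary_pairing (\<A> (c *\<^sub>C x)) z = c * boundary_pairing (\<A> x) z"
proof -
  have q: "snd z \<in> H_mhalf \<Omega>" using z by auto
  then have lin: "snd z \<in> cdual (H_half \<Omega>)" by (simp add: H_mhalf_def)
  have mem: "snd (\<A> x) \<in> H_half \<Omega>" "snd (\<A> y) \<in> H_half \<Omega>"
    using boundary_op_in[OF x] boundary_op_in[OF y] by auto
  note H = subspace_H_half
  show "boundary_pairing (\<A> (x + y)) z = boundary_pairing (\<A> x) z + boundary_pairing (\<A> y) z"
    if xy: "x + y \<in> H_half \<Omega> \<times> H_mhalf \<Omega>"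
  proof -
    have eq: "boundary_eq \<Omega> (\<A> (x + y)) (\<A> x + \<A> y)"
      using \<A> x y unfolding bounded_boundary_op_def Let_def by blast
    have "snd z (snd (\<A> (x + y))) = snd z (snd (\<A> x + \<A> y))"
    proof (rule H_mhalf_cong[OF q])
      show "snd (\<A> (x + y)) \<in> H_half \<Omega>" using boundary_op_in[OF xy] by auto
      show "snd (\<A> x + \<A> y) \<in> H_half \<Omega>" using complex_vector.subspace_add[OF H mem] by simp
      show "trace_norm \<Omega> (snd (\<A> (x + y)) - snd (\<A> x + \<A> y)) = 0"
        using eq by (simp add: boundary_eq_def)
    qed
    then show ?thesis
      using eq cdual_add[OF lin mem] by (simp add: boundary_pairing_def boundary_eq_def)
  qed
  show "boundary_pairing (\<A> (c *\<^sub>C x)) z = c * boundary_pairing (\<A> x) z"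
    if cx: "c *\<^sub>C x \<in> H_half \<Omega> \<times> H_mhalf \<Omega>"
  proof -
    have eq: "boundary_eq \<Omega> (\<A> (c *\<^sub>C x)) (c *\<^sub>C \<A> x)"
      using \<A> x unfolding bounded_boundary_op_def Let_def by blast
    have "snd z (snd (\<A> (c *\<^sub>C x))) = snd z (snd (c *\<^sub>C \<A> x))"
    proof (rule H_mhalf_cong[OF q])
      show "snd (\<A> (c *\<^sub>C x)) \<in> H_half \<Omega>" using boundary_op_in[OF cx] by auto
      show "snd (c *\<^sub>C \<A> x) \<in> H_half \<Omega>"
        using complex_vector.subspace_scale[OF H mem(1)] by (simp add: scaleC_prod_def)
      show "trace_norm \<Omega> (snd (\<A> (c *\<^sub>C x)) - snd (c *\<^sub>C \<A> x)) = 0"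
        using eq by (simp add: boundary_eq_def)
    qed
    then show ?thesis
      using eq cdual_scale[OF lin mem(1)]
      by (simp add: boundary_pairing_def boundary_eq_def scaleC_prod_def distrib_left)
  qed
qed

end

end

section \<open>Finite element spaces\<close>

text \<open>A finite union of simplices is compact, so it contains the closure of its interior, and
  taking the interior again adds nothing. The last fact is the absence of slits, which places the
  subdomains inside \<Omega>.\<close>

lemma polyhedral_openD:
  assumes "polyhedral_open \<Omega>"
  shows "open \<Omega>" "bounded \<Omega>" "interior (closure \<Omega>) = \<Omega>"
proof -
  obtain \<S> where S: "finite \<S>" "\<And>S. S \<in> \<S> \<Longrightarrow> int CARD('a) simplex S" "\<Omega> = interior (\<Union>\<S>)"
    using assms by (auto simp: polyhedral_open_def)
  have c: "compact (\<Union>\<S>)" using S(1,2) compact_simplex by (intro compact_Union) auto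
  show op: "open \<Omega>" using S(3) by simp
  show "bounded \<Omega>"
    using bounded_subset[OF compact_imp_bounded[OF c]] interior_subset S(3) by blast
  have "closure \<Omega> \<subseteq> \<Union>\<S>"
    using S(3) interior_subset compact_imp_closed[OF c] by (metis closure_minimal)
  then show "interior (closure \<Omega>) = \<Omega>"
    using S(3) interior_mono interior_maximal[OF closure_subset op] by blast
qed

lemma polys_add: "p \<in> polys k \<Longrightarrow> q \<in> polys k \<Longrightarrow> (\<lambda>x. p x + q x) \<in> polys k"
proof -
  assume "p \<in> polys k" "q \<in> polys k"
  then obtain c d where cd: "p = (\<lambda>x. \<Sum>\<alpha> | (\<Sum>i\<in>UNIV. \<alpha> i) \<le> k. c \<alpha> * complex_of_real (\<Prod>i\<in>UNIV. (x $ i) ^ \<alpha> i))"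
    "q = (\<lambda>x. \<Sum>\<alpha> | (\<Sum>i\<in>UNIV. \<alpha> i) \<le> k. d \<alpha> * complex_of_real (\<Prod>i\<in>UNIV. (x $ i) ^ \<alpha> i))"
    by (auto simp: polys_def)
  show ?thesis
    unfolding polys_def cd by (rule CollectI, rule exI[of _ "\<lambda>\<alpha>. c \<alpha> + d \<alpha>"])
      (simp add: sum.distrib distrib_right)
qed

lemma polys_scale: "p \<in> polys k \<Longrightarrow> (\<lambda>x. a * p x) \<in> polys k"
proof -
  assume "p \<in> polys k"
  then obtain c where c: "p = (\<lambda>x. \<Sum>\<alpha> | (\<Sum>i\<in>UNIV. \<alpha> i) \<le> k. c \<alpha> * complex_of_real (\<Prod>i\<in>UNIV. (x $ i) ^ \<alpha> i))"
    by (auto simp: polys_def)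
  show ?thesis
    unfolding polys_def c by (rule CollectI, rule exI[of _ "\<lambda>\<alpha>. a * c \<alpha>"])
      (simp add: sum_distrib_left mult.assoc)
qed

lemma polys_cnj: "p \<in> polys k \<Longrightarrow> (\<lambda>x. cnj (p x)) \<in> polys k"
proof -
  assume "p \<in> polys k"
  then obtain c where c: "p = (\<lambda>x. \<Sum>\<alpha> | (\<Sum>i\<in>UNIV. \<alpha> i) \<le> k. c \<alpha> * complex_of_real (\<Prod>i\<in>UNIV. (x $ i) ^ \<alpha> i))"
    by (auto simp: polys_def)
  show ?thesis
    unfolding polys_def c by (rule CollectI, rule exI[of _ "\<lambda>\<alpha>. cnj (c \<alpha>)"]) simp
qed

lemma fe_space_polys: "u \<in> fe_space k \<T> \<Omega> \<Longrightarrow> \<tau> \<in> \<T> \<Longrightarrow> \<exists>p\<in>polys k. \<forall>x\<in>\<tau>. u x = p x"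
  by (simp add: fe_space_def)

lemma fe_space_cnj:
  assumes u: "u \<in> fe_space k \<T> \<Omega>"
  shows "cnj_fun u \<in> fe_space k \<T> \<Omega>"
  unfolding fe_space_def
proof (intro CollectI conjI ballI)
  show "cnj_fun u \<in> H1 \<Omega>" using u by (simp add: fe_space_def H1_cnj)
  show "\<forall>x. x \<notin> closure \<Omega> \<longrightarrow> cnj_fun u x = 0" using u by (simp add: fe_space_def cnj_fun_def)
  have "continuous_on (closure \<Omega>) u" using u by (simp add: fe_space_def)
  then show "continuous_on (closure \<Omega>) (cnj_fun u)" unfolding cnj_fun_def by (rule continuous_on_cnj)
  fix \<tau> assume "\<tau> \<in> \<T>"
  then obtain p where "p \<in> polys k" "\<forall>x\<in>\<tau>. u x = p x" using fe_space_polys[OF u] by blast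
  then show "\<exists>p\<in>polys k. \<forall>x\<in>\<tau>. cnj_fun u x = p x"
    using polys_cnj[of p k] by (intro bexI[of _ "\<lambda>x. cnj (p x)"]) (auto simp: cnj_fun_def)
qed

lemma subspace_fe_space:
  assumes op: "open \<Omega>" and bd: "bounded \<Omega>"
  shows "complex_vector.subspace (fe_space k \<T> \<Omega>)"
  unfolding complex_vector.subspace_def
proof (intro conjI ballI allI)
  have "(\<lambda>x. 0) \<in> polys k"
    unfolding polys_def by (rule CollectI, rule exI[of _ "\<lambda>\<alpha>. 0"]) simp
  then show "0 \<in> fe_space k \<T> \<Omega>"
    using H1_zero[OF op bd] by (auto simp: fe_space_def zero_fun_def)
next
  fix u v assume u: "u \<in> fe_space k \<T> \<Omega>" and v: "v \<in> fe_space k \<T> \<Omega>"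
  have "\<exists>p\<in>polys k. \<forall>x\<in>\<tau>. (u + v) x = p x" if "\<tau> \<in> \<T>" for \<tau>
  proof -
    obtain p q where "p \<in> polys k" "\<forall>x\<in>\<tau>. u x = p x" "q \<in> polys k" "\<forall>x\<in>\<tau>. v x = q x"
      using fe_space_polys[OF u \<open>\<tau> \<in> \<T>\<close>] fe_space_polys[OF v \<open>\<tau> \<in> \<T>\<close>] by blast
    then show ?thesis using polys_add[of p k q] by (intro bexI[of _ "\<lambda>x. p x + q x"]) auto
  qed
  moreover have "continuous_on (closure \<Omega>) (u + v)"
    using u v unfolding plus_fun_def fe_space_def by (auto intro: continuous_on_add)
  ultimately show "u + v \<in> fe_space k \<T> \<Omega>"
    using u v H1_add[OF op bd] by (auto simp: fe_space_def)
next
  fix c u assume u: "u \<in> fe_space k \<T> \<Omega>"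
  have "\<exists>p\<in>polys k. \<forall>x\<in>\<tau>. (c *\<^sub>C u) x = p x" if "\<tau> \<in> \<T>" for \<tau>
  proof -
    obtain p where "p \<in> polys k" "\<forall>x\<in>\<tau>. u x = p x"
      using fe_space_polys[OF u \<open>\<tau> \<in> \<T>\<close>] by blast
    then show ?thesis using polys_scale[of p k c] by (intro bexI[of _ "\<lambda>x. c * p x"]) auto
  qed
  moreover have "continuous_on (closure \<Omega>) (c *\<^sub>C u)"
    using u unfolding scaleC_fun_def scaleC_complex_def fe_space_def by (auto intro: continuous_on_mult_left)
  ultimately show "c *\<^sub>C u \<in> fe_space k \<T> \<Omega>"
    using u H1_scale[of u \<Omega>] by (auto simp: fe_space_def)
qed

lemma sum_fun_apply: "(\<Sum>i\<in>I. f i) x = (\<Sum>i\<in>I. f i x)"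
  by (induction I rule: infinite_finite_induct) auto

text \<open>Spanned by monomials of degree at most \<open>k\<close> cut off to single cells,
  functions outside the space in general. Neighbouring cells share faces, so \<open>cell\<close>
  assigns each point to one of them; otherwise values on faces would be counted repeatedly.\<close>

lemma fin_dim_fe_space:
  fixes \<T> :: "(real^'n::finite) set set"
  assumes T: "finite \<T>" "\<Union>\<T> = closure \<Omega>"
  shows "fin_dim (fe_space k \<T> \<Omega>)"
proof -
  define E where "E = {\<alpha> :: 'n \<Rightarrow> nat. (\<Sum>i\<in>UNIV. \<alpha> i) \<le> k}"
  define m where "m \<alpha> x = complex_of_real (\<Prod>i\<in>UNIV. (x $ i) ^ \<alpha> i)" for \<alpha> :: "'n \<Rightarrow> nat" and x :: "real^'n"
  define cell where "cell x = (SOME \<tau>. \<tau> \<in> \<T> \<and> x \<in> \<tau>)" for x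
  define e where "e \<tau> \<alpha> = (\<lambda>x. if x \<in> closure \<Omega> \<and> cell x = \<tau> then m \<alpha> x else 0)" for \<tau> \<alpha>
  have cell: "cell x \<in> \<T>" "x \<in> cell x" if "x \<in> closure \<Omega>" for x
  proof -
    have "\<exists>\<tau>. \<tau> \<in> \<T> \<and> x \<in> \<tau>" using that T(2) by blast
    from someI_ex[OF this] show "cell x \<in> \<T>" "x \<in> cell x" by (auto simp: cell_def)
  qed
  have "E \<subseteq> (UNIV \<rightarrow>\<^sub>E {..k})"
  proof
    fix \<alpha> assume "\<alpha> \<in> E"
    then have "\<alpha> i \<le> k" for i
      using member_le_sum[of i UNIV \<alpha>] by (simp add: E_def)
    then show "\<alpha> \<in> (UNIV \<rightarrow>\<^sub>E {..k})" by (auto simp: PiE_UNIV_domain)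
  qed
  then have "finite E" by (rule finite_subset) (intro finite_PiE, auto)
  then have fin: "finite ((\<lambda>(\<tau>, \<alpha>). e \<tau> \<alpha>) ` (\<T> \<times> E))" using T(1) by blast
  have "u \<in> complex_vector.span ((\<lambda>(\<tau>, \<alpha>). e \<tau> \<alpha>) ` (\<T> \<times> E))" if u: "u \<in> fe_space k \<T> \<Omega>" for u
  proof -
    have "\<exists>c. \<forall>x\<in>\<tau>. u x = (\<Sum>\<alpha>\<in>E. c \<alpha> * m \<alpha> x)" if "\<tau> \<in> \<T>" for \<tau>
    proof -
      obtain p where "p \<in> polys k" "\<forall>x\<in>\<tau>. u x = p x" using fe_space_polys[OF u \<open>\<tau> \<in> \<T>\<close>] by blast
      then show ?thesis by (auto simp: polys_def E_def m_def)
    qed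
    then obtain c where c: "\<And>\<tau> x. \<tau> \<in> \<T> \<Longrightarrow> x \<in> \<tau> \<Longrightarrow> u x = (\<Sum>\<alpha>\<in>E. c \<tau> \<alpha> * m \<alpha> x)"
      by metis
    have "u = (\<Sum>\<tau>\<in>\<T>. \<Sum>\<alpha>\<in>E. c \<tau> \<alpha> *\<^sub>C e \<tau> \<alpha>)"
    proof
      fix x
      show "u x = (\<Sum>\<tau>\<in>\<T>. \<Sum>\<alpha>\<in>E. c \<tau> \<alpha> *\<^sub>C e \<tau> \<alpha>) x"
      proof (cases "x \<in> closure \<Omega>")
        case True
        have "(\<Sum>\<tau>\<in>\<T>. \<Sum>\<alpha>\<in>E. c \<tau> \<alpha> *\<^sub>C e \<tau> \<alpha>) x
            = (\<Sum>\<tau>\<in>\<T>. if cell x = \<tau> then (\<Sum>\<alpha>\<in>E. c \<tau> \<alpha> * m \<alpha> x) else 0)"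
          unfolding sum_fun_apply by (intro sum.cong refl) (simp add: e_def True)
        also have "\<dots> = (\<Sum>\<alpha>\<in>E. c (cell x) \<alpha> * m \<alpha> x)"
          using T(1) cell(1)[OF True] by simp
        finally show ?thesis using c[OF cell[OF True]] by simp
      next
        case False
        then have "u x = 0" using u by (simp add: fe_space_def)
        then show ?thesis using False by (simp add: sum_fun_apply e_def)
      qed
    qed
    also have "\<dots> \<in> complex_vector.span ((\<lambda>(\<tau>, \<alpha>). e \<tau> \<alpha>) ` (\<T> \<times> E))"
      by (intro complex_vector.span_sum complex_vector.span_scale complex_vector.span_base) auto
    finally show ?thesis .
  qed
  then show ?thesis unfolding fin_dim_def using fin by (intro exI conjI subsetI)
qed

lemma restr_add: "restr \<Theta> (u + v) = restr \<Theta> u + restr \<Theta> v"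
  and restr_scale: "restr \<Theta> (c *\<^sub>C u) = c *\<^sub>C restr \<Theta> u"
  and restr_zero: "restr \<Theta> 0 = 0"
  and restr_cnj: "restr \<Theta> (cnj_fun u) = cnj_fun (restr \<Theta> u)"
  and restr_restr: "\<Theta> \<subseteq> \<Theta>' \<Longrightarrow> restr \<Theta> (restr \<Theta>' u) = restr \<Theta> u"
  by (auto simp: restr_def fun_eq_iff cnj_fun_def)

lemma clinear_on_restr: "clinear_on V (restr \<Theta>)"
  by (simp add: clinear_on_def restr_add restr_scale)

lemma subspace_fe_restr:
  "open \<Omega> \<Longrightarrow> bounded \<Omega> \<Longrightarrow> complex_vector.subspace (fe_restr k \<T> \<Omega> \<Theta>)"
  unfolding fe_restr_def by (rule subspace_image[OF subspace_fe_space clinear_on_restr])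

lemma fin_dim_fe_restr:
  "open \<Omega> \<Longrightarrow> bounded \<Omega> \<Longrightarrow> finite \<T> \<Longrightarrow> \<Union>\<T> = closure \<Omega> \<Longrightarrow> fin_dim (fe_restr k \<T> \<Omega> \<Theta>)"
  unfolding fe_restr_def
  by (rule fin_dim_image[OF subspace_fe_space fin_dim_fe_space clinear_on_restr])

lemma fe_restr_cnj: "u \<in> fe_restr k \<T> \<Omega> \<Theta> \<Longrightarrow> cnj_fun u \<in> fe_restr k \<T> \<Omega> \<Theta>"
  unfolding fe_restr_def by (elim imageE) (metis fe_space_cnj restr_cnj imageI)

lemma fe_restr_restr: "\<Theta> \<subseteq> \<Theta>' \<Longrightarrow> u \<in> fe_restr k \<T> \<Omega> \<Theta>' \<Longrightarrow> restr \<Theta> u \<in> fe_restr k \<T> \<Omega> \<Theta>"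
  unfolding fe_restr_def by (auto simp: restr_restr)

lemma fe_restr_H_half:
  assumes "open \<Omega>" "bounded \<Omega>" "g \<in> fe_restr k \<T> \<Omega> (frontier \<Omega>)"
  shows "g \<in> H_half \<Omega>"
proof -
  obtain u where "u \<in> fe_space k \<T> \<Omega>" "g = restr (frontier \<Omega>) u"
    using assms(3) by (auto simp: fe_restr_def)
  then show ?thesis
    using has_trace_restr[OF assms(1,2)] unfolding H_half_def fe_space_def by blast
qed

lemma fe_restr_H1:
  assumes "\<Theta> \<subseteq> \<Omega>" "open \<Theta>" "v \<in> fe_restr k \<T> \<Omega> (closure \<Theta>)"
  shows "v \<in> H1 \<Theta>"
proof -
  obtain u where "u \<in> fe_space k \<T> \<Omega>" "v = restr (closure \<Theta>) u"
    using assms(3) by (auto simp: fe_restr_def)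
  moreover have "restr (closure \<Theta>) u x = u x" if "x \<in> \<Theta>" for x
    using that closure_subset[of \<Theta>] by (auto simp: restr_def)
  ultimately show ?thesis
    using H1_restrict[of u \<Omega> \<Theta> v] assms(1,2) by (simp add: fe_space_def)
qed

section \<open>Products and tuples\<close>

text \<open>Asking for a decomposition of each element, rather than for a direct sum, lets one lemma
  serve both products and tuples.\<close>

lemma fin_dim_sum:
  assumes "fin_dim U" "fin_dim U'" "\<And>v. v \<in> V \<Longrightarrow> \<exists>u\<in>U. \<exists>u'\<in>U'. v = u + u'"
  shows "fin_dim V"
proof -
  obtain b b' where b: "finite b" "U \<subseteq> complex_vector.span b" "finite b'" "U' \<subseteq> complex_vector.span b'"
    using assms(1,2) unfolding fin_dim_def by blast
  have "V \<subseteq> complex_vector.span (b \<union> b')"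
  proof
    fix v assume "v \<in> V"
    then obtain u u' where u: "u \<in> U" "u' \<in> U'" "v = u + u'" using assms(3) by blast
    have "u \<in> complex_vector.span (b \<union> b')" "u' \<in> complex_vector.span (b \<union> b')"
      using u b complex_vector.span_mono[of b "b \<union> b'"] complex_vector.span_mono[of b' "b \<union> b'"] by auto
    then show "v \<in> complex_vector.span (b \<union> b')" unfolding u(3) by (rule complex_vector.span_add)
  qed
  then show ?thesis unfolding fin_dim_def using b by (intro exI[of _ "b \<union> b'"]) simp
qed

lemma subspace_Times:
  assumes "complex_vector.subspace U" "complex_vector.subspace V"
  shows "complex_vector.subspace (U \<times> V)"
  using assms unfolding complex_vector.subspace_def by (auto simp: zero_prod_def scaleC_prod_def)

lemma fin_dim_Times:
  assumes U: "complex_vector.subspace U" "fin_dim U" and V: "complex_vector.subspace V" "fin_dim V"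
  shows "fin_dim (U \<times> V)"
proof (rule fin_dim_sum)
  show "fin_dim ((\<lambda>u. (u, 0 :: 'b)) ` U)"
    by (rule fin_dim_image[OF U]) (simp add: clinear_on_def scaleC_prod_def)
  show "fin_dim ((\<lambda>v. (0 :: 'a, v)) ` V)"
    by (rule fin_dim_image[OF V]) (simp add: clinear_on_def scaleC_prod_def)
qed auto

lemma subspace_tuples:
  assumes "\<And>j. j < J \<Longrightarrow> complex_vector.subspace (S j)"
  shows "complex_vector.subspace (tuples J S)"
  using assms unfolding complex_vector.subspace_def tuples_def by (auto simp: scaleC_fun_def)

lemma fin_dim_tuples:
  assumes "\<And>j. j < J \<Longrightarrow> complex_vector.subspace (S j)" "\<And>j. j < J \<Longrightarrow> fin_dim (S j)"
  shows "fin_dim (tuples J S)"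
  using assms
proof (induction J)
  case 0
  have "tuples 0 S = {0}" by (auto simp: tuples_def fun_eq_iff)
  then show ?case unfolding fin_dim_def by (intro exI[of _ "{}"]) simp
next
  case (Suc J)
  show ?case
  proof (rule fin_dim_sum)
    show "fin_dim (tuples J S)" using Suc by simp
    show "fin_dim ((\<lambda>v j. if j = J then v else 0) ` S J)"
      by (rule fin_dim_image) (use Suc.prems in \<open>auto simp: clinear_on_def scaleC_fun_def fun_eq_iff\<close>)
    fix u assume u: "u \<in> tuples (Suc J) S"
    have "u(J := 0) \<in> tuples J S" using u by (auto simp: tuples_def)
    moreover have "(\<lambda>j. if j = J then u J else 0) \<in> (\<lambda>v j. if j = J then v else 0) ` S J"
      using u by (auto simp: tuples_def)
    moreover have "u = u(J := 0) + (\<lambda>j. if j = J then u J else 0)" by (auto simp: fun_eq_iff)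
    ultimately show "\<exists>a\<in>tuples J S. \<exists>b\<in>(\<lambda>v j. if j = J then v else 0) ` S J. u = a + b"
      by blast
  qed
qed

section \<open>The scattering operator\<close>

lemma cnj_fun_add: "cnj_fun (u + v) = cnj_fun u + cnj_fun v"
  and cnj_fun_scale: "cnj_fun (c *\<^sub>C u) = cnj c *\<^sub>C cnj_fun u"
  and cnj_fun_cnj_fun: "cnj_fun (cnj_fun u) = u"
  and cnj_fun_zero: "cnj_fun 0 = 0"
  by (auto simp: cnj_fun_def fun_eq_iff)

lemma trace_op_linear: "clinear_on V (trace_op \<Omega>s)"
  by (simp add: clinear_on_def trace_op_def restr_add restr_scale scaleC_prod_def scaleC_fun_def[of _ "_ :: nat \<Rightarrow> _"]
      prod_eq_iff plus_fun_def[of "_ :: nat \<Rightarrow> _"])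

lemma trace_op_cnj: "trace_op \<Omega>s (cnj_volume w) = cnj_skeleton (trace_op \<Omega>s w)"
  by (simp add: trace_op_def cnj_volume_def cnj_skeleton_def cnj_boundary_def restr_cnj)

lemma cnj_volume_cnj_volume: "cnj_volume (cnj_volume w) = w"
  by (simp add: cnj_volume_def cnj_boundary_def dual_conj_def cnj_fun_cnj_fun)

lemma trace_op_in_skeleton:
  assumes "w \<in> volume_space k \<T> \<Omega> Q J \<Omega>s"
  shows "trace_op \<Omega>s w \<in> skeleton_space k \<T> \<Omega> J \<Omega>s"
proof -
  have "frontier (\<Omega>s j) \<subseteq> closure (\<Omega>s j)" for j by (simp add: frontier_def)
  from fe_restr_restr[OF this] show ?thesis
    using assms by (auto simp: volume_space_def skeleton_space_def trace_op_def tuples_def restr_zero)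
qed

lemma cnj_skeleton_in:
  "v \<in> skeleton_space k \<T> \<Omega> J \<Omega>s \<Longrightarrow> cnj_skeleton v \<in> skeleton_space k \<T> \<Omega> J \<Omega>s"
  by (auto simp: skeleton_space_def cnj_skeleton_def tuples_def fe_restr_cnj cnj_fun_zero)

lemma cnj_volume_in:
  assumes "\<And>q. q \<in> Q \<Longrightarrow> dual_conj cnj_fun q \<in> Q" and "w \<in> volume_space k \<T> \<Omega> Q J \<Omega>s"
  shows "cnj_volume w \<in> volume_space k \<T> \<Omega> Q J \<Omega>s"
  using assms
  by (auto simp: volume_space_def cnj_volume_def cnj_boundary_def tuples_def fe_restr_cnj cnj_fun_zero)

lemma cnj_skeleton_add: "cnj_skeleton (x + y) = cnj_skeleton x + cnj_skeleton y"
  and cnj_skeleton_scale: "cnj_skeleton (a *\<^sub>C x) = cnj a *\<^sub>C cnj_skeleton x"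
  and cnj_skeleton_cnj_skeleton: "cnj_skeleton (cnj_skeleton x) = x"
  by (simp_all add: cnj_skeleton_def cnj_fun_add cnj_fun_scale cnj_fun_cnj_fun scaleC_prod_def
      scaleC_fun_def[of _ "_ :: nat \<Rightarrow> _"] prod_eq_iff plus_fun_def[of "_ :: nat \<Rightarrow> _"])

lemma subspace_block_spaces:
  assumes "open \<Omega>" "bounded \<Omega>" and "complex_vector.subspace Q"
  shows "complex_vector.subspace (volume_space k \<T> \<Omega> Q J \<Omega>s)"
    and "complex_vector.subspace (skeleton_space k \<T> \<Omega> J \<Omega>s)"
  unfolding volume_space_def skeleton_space_def
  by (intro subspace_Times subspace_tuples subspace_fe_restr assms)+

lemma fin_dim_block_spaces:
  assumes "open \<Omega>" "bounded \<Omega>" "finite \<T>" "\<Union>\<T> = closure \<Omega>" "complex_vector.subspace Q" "fin_dim Q"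
  shows "fin_dim (volume_space k \<T> \<Omega> Q J \<Omega>s)" and "fin_dim (skeleton_space k \<T> \<Omega> J \<Omega>s)"
  unfolding volume_space_def skeleton_space_def
  by (intro fin_dim_Times fin_dim_tuples subspace_Times subspace_tuples subspace_fe_restr
      fin_dim_fe_restr assms)+

theorem mainTheorem5:
  fixes \<Omega> :: "(real^'n::finite) set"
    and \<Omega>s :: "nat \<Rightarrow> (real^'n) set"
    and J k :: nat
    and \<T> :: "(real^'n) set set"
    and \<kappa> :: "real^'n \<Rightarrow> complex"
    and \<A> :: "'n cfun \<times> ('n cfun \<Rightarrow> complex) \<Rightarrow> ('n cfun \<Rightarrow> complex) \<times> 'n cfun"
    and Q :: "('n cfun \<Rightarrow> complex) set"
    and T :: "'n cfun \<times> (nat \<Rightarrow> 'n cfun) \<Rightarrow> 'n cfun \<times> (nat \<Rightarrow> 'n cfun) \<Rightarrow> complex"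
    and ip :: "('n cfun \<times> ('n cfun \<Rightarrow> complex)) \<times> (nat \<Rightarrow> 'n cfun) \<Rightarrow>
               ('n cfun \<times> ('n cfun \<Rightarrow> complex)) \<times> (nat \<Rightarrow> 'n cfun) \<Rightarrow> complex"
  defines "V \<equiv> volume_space k \<T> \<Omega> Q J \<Omega>s"
    and "V\<Sigma> \<equiv> skeleton_space k \<T> \<Omega> J \<Omega>s"
  defines "A \<equiv> block_op V J \<Omega>s \<kappa> \<A>"
    and "B \<equiv> trace_op \<Omega>s"
  defines "M \<equiv> \<lambda>u. A u - \<i> *\<^sub>C transpose_on V B (T (B u))"
  defines "Mdag \<equiv> moore_penrose V ip (cdual V) (dual_ip V ip) M"
    and "\<C> \<equiv> cauchy_data V V\<Sigma> A B"
    and "Tinv_norm \<equiv> inv_norm V\<Sigma> cnj_skeleton T"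
  assumes dim: "CARD('n) = 2 \<or> CARD('n) = 3"
    and Omega: "polyhedral_open \<Omega>"
    and kappa: "\<kappa> \<in> borel_measurable lebesgue" "\<exists>C. AE x in lebesgue. cmod (\<kappa> x) \<le> C"
      "\<forall>x\<in>\<Omega>. Im ((\<kappa> x)\<^sup>2) \<ge> 0" "\<exists>\<kappa>0>0. \<forall>x. x \<notin> \<Omega> \<longrightarrow> \<kappa> x = complex_of_real \<kappa>0"
    and boundary_op: "bounded_boundary_op \<Omega> \<A>"
    and mesh: "simplicial_mesh \<Omega> \<T>" and order: "k \<ge> 1"
    and Q: "complex_vector.subspace Q" "Q \<subseteq> H_mhalf \<Omega>" "\<exists>b. finite b \<and> Q \<subseteq> complex_vector.span b"
      \<comment> \<open>makes the conjugates in the conclusion elements of \<open>V\<close>; needed for these only\<close>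
    and Q_cnj: "dissipative \<Omega> \<A> \<Longrightarrow> \<forall>q\<in>Q. dual_conj cnj_fun q \<in> Q"
    and subdomains: "domain_decomposition \<Omega> \<T> J \<Omega>s"
    and T: "impedance_op V\<Sigma> cnj_skeleton T"
    and ip: "inner_product_on V ip"
    and a_or_b: "bij_betw M V (cdual V) \<or> dissipative \<Omega> \<A>"
  shows "(\<exists>!S. is_scattering V\<Sigma> T \<C> S) \<and>
    (\<forall>S. is_scattering V\<Sigma> T \<C> S \<longrightarrow>
      (\<forall>q\<in>cdual V\<Sigma>. S q = q + (2 * \<i>) *\<^sub>C T (B (Mdag (transpose_on V B q)))) \<and>
      (dissipative \<Omega> \<A> \<longrightarrow>
        (\<forall>q\<in>cdual V\<Sigma>. Tinv_norm (S q) \<le> Tinv_norm q) \<and>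
        (\<forall>q\<in>cdual V\<Sigma>. let u = Mdag (transpose_on V B q) in
          (Tinv_norm (S q))\<^sup>2 - 4 * Im (A u (cnj_volume u)) = (Tinv_norm q)\<^sup>2)))"
proof -
  note op = polyhedral_openD(1)[OF Omega] and bd = polyhedral_openD(2)[OF Omega]
  have fin: "finite \<T>" "\<Union>\<T> = closure \<Omega>"
    using mesh by (auto simp: simplicial_mesh_def triangulation_def)
  have sub: "\<Omega>s j \<subseteq> \<Omega>" "open (\<Omega>s j)" "bounded (\<Omega>s j)" if j: "j < J" for j
  proof -
    have p: "polyhedral_open (\<Omega>s j)" using subdomains j by (simp add: domain_decomposition_def)
    show "open (\<Omega>s j)" "bounded (\<Omega>s j)" using polyhedral_openD[OF p] by auto
    have "closure (\<Omega>s j) \<subseteq> closure \<Omega>" using subdomains j by (auto simp: domain_decomposition_def)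
    \<comment> \<open>The decomposition controls closures only; an open set inside the closure of
      \<Omega> lies in its interior, which is \<Omega> for lack of slits.\<close>
    then have "\<Omega>s j \<subseteq> interior (closure \<Omega>)"
      using closure_subset polyhedral_openD(1)[OF p] by (intro interior_maximal) auto
    then show "\<Omega>s j \<subseteq> \<Omega>" using polyhedral_openD(3)[OF Omega] by simp
  qed
  have Qfd: "fin_dim Q" using Q(3) unfolding fin_dim_def .
  have V: "complex_vector.subspace V" "fin_dim V" and V\<Sigma>: "complex_vector.subspace V\<Sigma>" "fin_dim V\<Sigma>"
    unfolding V_def V\<Sigma>_def
    using subspace_block_spaces[OF op bd Q(1)] fin_dim_block_spaces[OF op bd fin Q(1) Qfd] by blast+
  have X: "fst w \<in> H_half \<Omega> \<times> H_mhalf \<Omega>" if "w \<in> V" for w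
    using that Q(2) fe_restr_H_half[OF op bd] unfolding V_def volume_space_def by fastforce
  have H: "snd w j \<in> H1 (\<Omega>s j)" if "w \<in> V" "j < J" for w j
    using that fe_restr_H1[OF sub(1,2)[OF that(2)]] unfolding V_def volume_space_def tuples_def by fastforce
  have A_apply: "A w z = boundary_pairing (\<A> (fst w)) (fst z)
       + (\<Sum>j<J. helmholtz_form \<kappa> (\<Omega>s j) (snd w j) (snd z j))" if "z \<in> V" for w z
    using that by (simp add: A_def block_op_def)
  have A_off: "A w z = 0" if "z \<notin> V" for w z
    using that by (simp add: A_def block_op_def)
  have A_add: "A (w + w') z = A w z + A w' z" if w: "w \<in> V" "w' \<in> V" for w w' z
  proof (cases "z \<in> V")
    case z: True
    have ww: "fst w + fst w' \<in> H_half \<Omega> \<times> H_mhalf \<Omega>"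
      using X[OF complex_vector.subspace_add[OF V(1) w]] by simp
    have "helmholtz_form \<kappa> (\<Omega>s j) (snd w j + snd w' j) (snd z j)
        = helmholtz_form \<kappa> (\<Omega>s j) (snd w j) (snd z j) + helmholtz_form \<kappa> (\<Omega>s j) (snd w' j) (snd z j)"
      if "j < J" for j
      by (rule helmholtz_form_add[OF sub(2,3)[OF that] kappa(1,2) H[OF w(1) that] H[OF w(2) that] H[OF z that]])
    then show ?thesis
      using boundary_pairing_left(1)[OF op bd boundary_op X[OF w(1)] X[OF w(2)] X[OF z] ww]
      by (simp add: A_apply[OF z] sum.distrib)
  qed (simp add: A_off)
  have A_scale: "A (a *\<^sub>C w) z = a * A w z" if w: "w \<in> V" for a w z
  proof (cases "z \<in> V")
    case z: True
    have aw: "a *\<^sub>C fst w \<in> H_half \<Omega> \<times> H_mhalf \<Omega>"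
      using X[OF complex_vector.subspace_scale[OF V(1) w, of a]] by (simp add: scaleC_prod_def)
    have "helmholtz_form \<kappa> (\<Omega>s j) (a *\<^sub>C snd w j) (snd z j)
        = a * helmholtz_form \<kappa> (\<Omega>s j) (snd w j) (snd z j)" if "j < J" for j
      by (rule helmholtz_form_scale[OF sub(2,3)[OF that] kappa(1,2) H[OF w that] H[OF z that]])
    moreover have "fst (a *\<^sub>C w) = a *\<^sub>C fst w" "snd (a *\<^sub>C w) j = a *\<^sub>C snd w j" for j
      by (simp_all add: scaleC_prod_def scaleC_fun_def[of _ "_ :: nat \<Rightarrow> _"])
    ultimately show ?thesis
      using boundary_pairing_left(2)[OF op bd boundary_op X[OF w] X[OF z] X[OF z] aw]
      by (simp add: A_apply[OF z] sum_distrib_left distrib_left)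
  qed (simp add: A_off)
  have A_in: "A w \<in> cdual V" if w: "w \<in> V" for w
  proof (rule cdualI)
    fix y z assume y: "y \<in> V" and z: "z \<in> V"
    \<comment> \<open>The Helmholtz form is symmetric, so linearity in the second argument is read
      off from the first. For the boundary part no symmetry is assumed, and its second argument has
      its own lemma.\<close>
    have "helmholtz_form \<kappa> (\<Omega>s j) (snd w j) (snd y j + snd z j)
        = helmholtz_form \<kappa> (\<Omega>s j) (snd w j) (snd y j) + helmholtz_form \<kappa> (\<Omega>s j) (snd w j) (snd z j)"
      if "j < J" for j
      using helmholtz_form_add[OF sub(2,3)[OF that] kappa(1,2) H[OF y that] H[OF z that] H[OF w that]]
      by (simp only: helmholtz_form_commute[of _ _ "snd w j"])
    then show "A w (y + z) = A w y + A w z"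
      using boundary_pairing_right(1)[OF op bd boundary_op X[OF w] X[OF y] X[OF z]]
      by (simp add: A_apply y z complex_vector.subspace_add[OF V(1)] sum.distrib)
  next
    fix a y assume y: "y \<in> V"
    have "helmholtz_form \<kappa> (\<Omega>s j) (snd w j) (a *\<^sub>C snd y j)
        = a * helmholtz_form \<kappa> (\<Omega>s j) (snd w j) (snd y j)" if "j < J" for j
      using helmholtz_form_scale[OF sub(2,3)[OF that] kappa(1,2) H[OF y that] H[OF w that], of a]
      by (simp only: helmholtz_form_commute[of _ _ "snd w j"])
    moreover have "fst (a *\<^sub>C y) = a *\<^sub>C fst y" "snd (a *\<^sub>C y) j = a *\<^sub>C snd y j" for j
      by (simp_all add: scaleC_prod_def scaleC_fun_def[of _ "_ :: nat \<Rightarrow> _"])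
    ultimately show "A w (a *\<^sub>C y) = a * A w y"
      using boundary_pairing_right(2)[OF op bd boundary_op X[OF w] X[OF y] X[OF y], of a]
      by (simp add: A_apply y complex_vector.subspace_scale[OF V(1)] sum_distrib_left distrib_left)
  qed (simp add: A_off)
  interpret P: scattering_problem V V\<Sigma> A B T cnj_skeleton ip
  proof
    show "clinear_on V A" by (simp add: clinear_on_def fun_eq_iff A_add A_scale)
    show "clinear_on V B" unfolding B_def by (rule trace_op_linear)
    show "B w \<in> V\<Sigma>" if "w \<in> V" for w
      using that trace_op_in_skeleton unfolding V_def V\<Sigma>_def B_def by blast
    show "cnj_skeleton v \<in> V\<Sigma>" if "v \<in> V\<Sigma>" for v
      using that cnj_skeleton_in unfolding V\<Sigma>_def by blast
  qed (simp_all add: V V\<Sigma> A_in T ip cnj_skeleton_add cnj_skeleton_scale cnj_skeleton_cnj_skeleton)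
  have M: "P.M = M" by (simp add: fun_eq_iff P.M_def M_def)
  have Mdag: "P.Mdag = Mdag" by (simp add: P.Mdag_def Mdag_def M)
  \<comment> \<open>Conditional on dissipativity, which supplies the sign of the boundary part and,
    through \<open>Q_cnj\<close>, the invariance of \<open>V\<close> under conjugation.\<close>
  have D: "dissipative_scattering_problem V V\<Sigma> A B T cnj_skeleton ip cnj_volume"
    if diss: "dissipative \<Omega> \<A>"
  proof
    show cV: "cnj_volume w \<in> V" if "w \<in> V" for w
      using that Q_cnj[OF diss] unfolding V_def by (intro cnj_volume_in) auto
    show "Im (A w (cnj_volume w)) \<le> 0" if w: "w \<in> V" for w
    proof -
      have "Im (helmholtz_form \<kappa> (\<Omega>s j) (snd w j) (cnj_fun (snd w j))) \<le> 0" if "j < J" for j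
        by (rule helmholtz_form_cnj[OF sub(2,3)[OF that] kappa(1,2) H[OF w that]])
          (use kappa(3) sub(1)[OF that] in auto)
      then have "(\<Sum>j<J. Im (helmholtz_form \<kappa> (\<Omega>s j) (snd w j) (cnj_fun (snd w j)))) \<le> 0"
        by (intro sum_nonpos) simp
      moreover have "Im (boundary_pairing (\<A> (fst w)) (cnj_boundary (fst w))) \<le> 0"
        using diss X[OF w] unfolding dissipative_def by (metis mem_Times_iff prod.collapse)
      ultimately show ?thesis unfolding A_apply[OF cV[OF w]] by (simp add: cnj_volume_def)
    qed
  qed (simp_all add: cnj_volume_cnj_volume trace_op_cnj B_def)
  \<comment> \<open>Each alternative of \<open>a_or_b\<close> yields the range and kernel
    conditions; beyond them, existence, uniqueness and the formula need no case distinction.\<close>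
  have "transpose_on V B q \<in> M ` V" if "q \<in> cdual V\<Sigma>" for q
    using a_or_b P.bij_range_kernel(1)[OF _ that] dissipative_scattering_problem.range[OF D that]
    unfolding M by blast
  moreover have "B u = 0" if "u \<in> V" "M u = 0" for u
    using a_or_b P.bij_range_kernel(2)[OF _ that(1)] dissipative_scattering_problem.kernel[OF D that(1)] that(2)
    unfolding M by blast
  \<comment> \<open>An equivalence with one equation gives existence and uniqueness together and
    reduces every further claim to \<open>P.scatter\<close>.\<close>
  ultimately have S: "is_scattering V\<Sigma> T \<C> S \<longleftrightarrow> S = P.scatter" for S
    unfolding \<C>_def by (intro P.scattering) (simp_all add: M)
  have formula: "P.scatter q = q + (2 * \<i>) *\<^sub>C T (B (Mdag (transpose_on V B q)))"
    if "q \<in> cdual V\<Sigma>" for q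
    using that by (simp add: P.scatter_def Mdag)
  have contr: "Tinv_norm (P.scatter q) \<le> Tinv_norm q" if "dissipative \<Omega> \<A>" "q \<in> cdual V\<Sigma>" for q
    unfolding Tinv_norm_def by (rule dissipative_scattering_problem.contraction[OF D[OF that(1)] that(2)])
  have energy: "(Tinv_norm (P.scatter q))\<^sup>2 - 4 * Im (A u (cnj_volume u)) = (Tinv_norm q)\<^sup>2"
    if "dissipative \<Omega> \<A>" "q \<in> cdual V\<Sigma>" "u = Mdag (transpose_on V B q)" for q u
    unfolding Tinv_norm_def
    by (rule dissipative_scattering_problem.energy[OF D[OF that(1)] that(2)]) (simp add: Mdag that(3))
  show ?thesis
    unfolding S Let_def by (auto intro: formula contr energy)
qed

end
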